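(* Let $p\ge3$, let $\mathcal M_1,\mathcal M_2\subset\mathcal E$ be $C^{p,1}$ embedded submanifolds, $\mathcal M=\mathcal M_1\cap\mathcal M_2$, and fix $\bar x\in\mathcal M$. Suppose that in a neighborhood of $\bar x$ the manifolds intersect cleanly and that the alternating framework and the decomposition property (as defined in the context) hold for maps $\phi_1,\phi_2$, with $\varphi=\phi_1\circ\phi_2$. Assume in addition that $\mathcal M_1$ is affine, $\mathcal M_2$ is a $C^{3,1}$ embedded submanifold, and $\mathcal M_1$ and $\mathcal M_2$ intersect transversally at $\bar x$, and that the standard NewtonSLRA map $$\varphi_{\mathrm N}(x)=\mathcal P_{\mathcal M_1\cap(\tilde x+\mathrm T_{\tilde x}\mathcal M_2)}(\tilde x),\qquad \tilde x=\mathcal P_{\mathcal M_2}(x),$$ is well-defined near $\bar x$. Let $k_A\le k_I$ be fixed constants in $\mathbb N$, independent of the input $(x,\eta)$. For $(x,\eta)\in\mathrm T\mathcal M$ set $x_0=x+\eta$ and $$x_{i+1}=\begin{cases}\mathcal P_{\mathcal M_1}(\mathcal P_{\mathcal M_2}(x_i)), & 0\le i\le k_A,\\ \varphi(x_i), & k_A+1\le i\le k_I,\\ \varphi_{\mathrm N}(x_i), & i\ge k_I+1,\end{cases}\qquad \psi(x,\eta)=x_0+\sum_{i=0}^{\infty}(x_{i+1}-x_i)=\lim_{i\to\infty}x_i .$$ Then, after possibly shrinking the neighborhood of $\bar x$, this fixed-phase hybrid map is well-defined for all $(x,\eta)\in\mathrm T\mathcal M$ with $x$ near $\bar x$ and $\|\eta\|$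 sufficiently small. Moreover, the induced limiting map $\psi$ is a second-order retraction on $\mathcal M$ near $\bar x$.
   Context: Notation. $\mathcal E$ is a Euclidean space with norm $\|\cdot\|$; $\mathbb B(x,r)$ is the open ball. For a closed set $D$, $\mathcal P_D$ is the orthogonal projection onto $D$ (locally single-valued near a submanifold and treated as such) and $d_D(x)=\|x-\mathcal P_D(x)\|$. A map is $C^{p,1}$ if it is $p$ times continuously differentiable with locally Lipschitz $p$-th derivative; a $C^{p,1}$ embedded submanifold has $C^{p,1}$ local defining functions of full rank. $\mathrm T_x\mathcal M$, $\mathrm N_x\mathcal M=(\mathrm T_x\mathcal M)^\perp$ are the tangent and normal spaces, and $\mathrm T\mathcal M$ the tangent bundle. Transversality at $x$: $\mathrm T_x\mathcal M_1+\mathrm T_x\mathcal M_2=\mathcal E$. Clean intersection. $\mathcal M_1,\mathcal M_2$ intersect cleanly at $x\in\mathcal M$ if $\mathcal M$ is a $C^{p,1}$ embedded submanifold in a neighborhood of $x$ and $\mathrm T_y\mathcal M=\mathrm T_y\mathcal M_1\cap\mathrm T_y\mathcal M_2$ for all $y$ in a neighborhood of $x$ in $\mathcal M$. Alternating framework. There are an open neighborhood $\mathcal U_{\bar x}\subset\mathcal E$ of $\bar x$ and $C^{p-1}$ maps $\phi_1:\mathcal U_{\bar x}\to\mathcal M_1$, $\phi_2:\mathcal U_{\bar x}\to\mathcal E$ such that one of the following holds: (i) $\phi_1=\mathcal P_{\mathcal M_1}$ on $\mathcal U_{\bar x}$ and $\phi_2$ is first-order consistent with $\mathcal P_{\mathcal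 M_2}$; (ii) $\phi_2=\mathcal P_{\mathcal M_2}$ on $\mathcal U_{\bar x}$ and $\phi_1$ is first-order consistent with $\mathcal P_{\mathcal M_1}$; (iii) for each $i$, $\phi_i$ is first-order consistent with $\mathcal P_{\mathcal M_i}$ and $\phi_i(\mathcal U_{\bar x})\subset\mathcal M_i$. First-order consistency: $\|\phi_i(y)-\mathcal P_{\mathcal M_i}(y)\|=o(d_{\mathcal M_i}(y))$ as $y\to x$, for $x\in\mathcal U_{\bar x}\cap\mathcal M_i$. Decomposition property ($p\ge3$). $K$ is a compact neighborhood of $\bar x$ in $\mathcal M$, the closure in $\mathcal M$ of an open neighborhood $\Omega_{\bar x}$ of $\bar x$, small enough that clean intersection holds on it and $K\subset\mathcal U_{\bar x}$; $\mathcal N_\delta(K)=\{y:d_K(y)<\delta\}$; and $\delta_K>0$ is a (small) radius with $\mathcal N_{\delta_K}(K)\subset\mathcal U_{\bar x}$ such that for some $\tau_K\in(0,1)$, $\varphi$ is well-defined with $d_{\mathcal M_2}(\varphi(y))\le\tau_Kd_{\mathcal M_2}(y)$ for $y\in\mathcal M_1\cap\mathcal N_{\delta_K}(K)$, and such that for small $\eta\in\mathrm T_x\mathcal M$, $x\in\Omega_{\bar x}$, the $\varphi$-iterates of $x+\eta$, and their images under $\phi_2$, remain in $\mathcal N_{\delta_K}(K)$. For each $i\in\{1,2\}$ there are $C^{p-1}$ maps $R_{\mathrm N_i},R_{\mathrm T_i}$ on $K\times\mathbb B(0,\delta_K)$ with $R_{\mathrm N_i}(x,u)\in\mathrm N_x\mathcal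 M_i$, $R_{\mathrm T_i}(x,u)\in\mathrm T_x\mathcal M_i$ and $\phi_i(x+u)=x+\mathcal P_{\mathrm T_x\mathcal M_i}(u)+R_{\mathrm N_i}(x,u)+R_{\mathrm T_i}(x,u)$. For $x\in K$ and $u$ with $x+u\in\mathcal N_{\delta_K}(K)$ and $\mathcal P_{\mathrm N_x\mathcal M_i}(u)=o(\|u\|)$, one has $R_{\mathrm N_i}(x,u)=O(\|u\|^2)$ and $R_{\mathrm T_i}(x,u)=o(\|u\|^2)$ as $u\to0$, uniformly in $x\in K$; and $\varphi\in C^{2,1}$ with $\mathrm D^2\varphi$ Lipschitz on $\mathcal N_{\delta_K}(K)$. Known NewtonSLRA facts (from the literature, part of the setting): there exist $\delta_N,\rho_N,\mu,\mu',\gamma,\gamma'>0$ such that for all $x\in\mathbb B(\bar x,\delta_N)$, $\varphi_{\mathrm N}(x)\in\mathbb B(\bar x,\rho_N)$, $\|\varphi_{\mathrm N}(x)-\mathcal P_{\mathcal M}(x)\|\le\mu\|x-\mathcal P_{\mathcal M}(x)\|^2$, $\|\mathcal P_{\mathcal M}(\varphi_{\mathrm N}(x))-\mathcal P_{\mathcal M}(x)\|\le\mu'\|x-\mathcal P_{\mathcal M}(x)\|^2$; and for any $y_0\in\mathbb B(\bar x,\delta_N)$ the sequence $y_{k+1}=\varphi_{\mathrm N}(y_k)$ is well-defined and converges to some $y^*\in\mathcal M$ with $\|y_{k+1}-y^*\|\le\gamma\|y_k-y^*\|^2$ and $\|y^*-\mathcal P_{\mathcal M}(y_0)\|\le\gamma'\|y_0-\mathcal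 P_{\mathcal M}(y_0)\|^2$. Second-order retraction on $\mathcal M$ near $\bar x$: a $C^2$ map $\psi$ on a set $\{(x,\eta)\in\mathrm T\mathcal M:x\in\Omega,\ \|\eta\|<r\}$, $\Omega$ an open neighborhood of $\bar x$ in $\mathcal M$, $r>0$, with values in $\mathcal M$, such that every curve $c(t)=\psi(x,t\eta)$ satisfies $c(t)=x+t\eta+o(t)$ and $\mathcal P_{\mathrm T_x\mathcal M}(c(t)-(x+t\eta))=o(t^2)$ as $t\to0$. *)

theory Defs
  imports "HOL-Analysis.Analysis" "HOL-Library.Landau_Symbols"
begin

text \<open>
  The derivative of order \<open>k\<close> is represented by the iterated directional derivatives
  \<open>x \<mapsto> D\<^sup>k f(x)[v\<^sub>1, \<dots>, v\<^sub>k]\<close>; in finite dimension, continuity (local Lipschitz continuity)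
  of all of these is continuity (local Lipschitz continuity) of the multilinear-map valued
  derivative.  Both predicates are meant for open \<open>S\<close>.
\<close>

primrec Ck_on ::
  "nat \<Rightarrow> 'a::euclidean_space set \<Rightarrow> ('a \<Rightarrow> 'b::real_normed_vector) \<Rightarrow> bool" where
  "Ck_on 0 S f \<longleftrightarrow> continuous_on S f"
| "Ck_on (Suc k) S f \<longleftrightarrow>
     (\<forall>x\<in>S. f differentiable (at x)) \<and>
     (\<forall>v. Ck_on k S (\<lambda>x. frechet_derivative f (at x) v))"

primrec Ck1_on ::
  "nat \<Rightarrow> 'a::euclidean_space set \<Rightarrow> ('a \<Rightarrow> 'b::real_normed_vector) \<Rightarrow> bool" where
  "Ck1_on 0 S f \<longleftrightarrow> (\<forall>x\<in>S. \<exists>e>0. \<exists>L. L-lipschitz_on (S \<inter> cball x e) f)"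
| "Ck1_on (Suc k) S f \<longleftrightarrow>
     (\<forall>x\<in>S. f differentiable (at x)) \<and>
     (\<forall>v. Ck1_on k S (\<lambda>x. frechet_derivative f (at x) v))"

text \<open>Maps on sets that are not open (subsets of a submanifold or of its tangent bundle) are
  of class \<open>C\<^sup>k\<close> if they locally extend to \<open>C\<^sup>k\<close> maps on open subsets of the ambient space.\<close>

definition Ck_map_on ::
  "nat \<Rightarrow> 'a::euclidean_space set \<Rightarrow> ('a \<Rightarrow> 'b::real_normed_vector) \<Rightarrow> bool" where
  "Ck_map_on k A f \<longleftrightarrow>
     (\<forall>a\<in>A. \<exists>V g. open V \<and> a \<in> V \<and> Ck_on k V g \<and> (\<forall>y\<in>A \<inter> V. g y = f y))"

text \<open>The norm bounds on \<open>v\<close>, \<open>w\<close> make \<open>L\<close> a Lipschitz constant for the operator norm of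
  the bilinear map \<open>D\<^sup>2 f(x)\<close>.\<close>

definition second_derivative_lipschitz_on ::
  "'a::euclidean_space set \<Rightarrow> ('a \<Rightarrow> 'b::real_normed_vector) \<Rightarrow> bool" where
  "second_derivative_lipschitz_on S f \<longleftrightarrow>
     (\<exists>L. \<forall>v w. norm v \<le> 1 \<longrightarrow> norm w \<le> 1 \<longrightarrow>
        L-lipschitz_on S
          (\<lambda>x. frechet_derivative (\<lambda>y. frechet_derivative f (at y) v) (at x) w))"

text \<open>A local defining function takes values in a linear subspace \<open>W\<close> of the ambient space;
  \<open>W\<close> plays the role of \<open>\<real>\<^sup>m\<close>, \<open>m\<close> being the local codimension, and full rank means that the
  derivative is onto \<open>W\<close>.\<close>

definition Ck1_submanifold_at :: "nat \<Rightarrow> 'a::euclidean_space set \<Rightarrow> 'a \<Rightarrow> bool" where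
  "Ck1_submanifold_at p M x \<longleftrightarrow>
     (\<exists>V W (g :: 'a \<Rightarrow> 'a).
        open V \<and> x \<in> V \<and> subspace W \<and> g ` V \<subseteq> W \<and> Ck1_on p V g \<and>
        (\<forall>y\<in>V. range (frechet_derivative g (at y)) = W) \<and>
        M \<inter> V = {y \<in> V. g y = 0})"

definition Ck1_submanifold :: "nat \<Rightarrow> 'a::euclidean_space set \<Rightarrow> bool" where
  "Ck1_submanifold p M \<longleftrightarrow> (\<forall>x\<in>M. Ck1_submanifold_at p M x)"

definition tangent_space :: "'a::euclidean_space set \<Rightarrow> 'a \<Rightarrow> 'a set" where
  "tangent_space M x =
     {v. \<exists>(c :: real \<Rightarrow> 'a) e. e > 0 \<and> c ` {-e<..<e} \<subseteq> M \<and> Ck_on 1 {-e<..<e} c \<and>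
           c 0 = x \<and> (c has_vector_derivative v) (at 0)}"

definition normal_space :: "'a::euclidean_space set \<Rightarrow> 'a \<Rightarrow> 'a set" where
  "normal_space M x = orthogonal_comp (tangent_space M x)"

definition transversal_at :: "'a::euclidean_space set \<Rightarrow> 'a set \<Rightarrow> 'a \<Rightarrow> bool" where
  "transversal_at M1 M2 x \<longleftrightarrow>
     {u + v | u v. u \<in> tangent_space M1 x \<and> v \<in> tangent_space M2 x} = UNIV"

definition clean_intersection_at ::
  "nat \<Rightarrow> 'a::euclidean_space set \<Rightarrow> 'a set \<Rightarrow> 'a \<Rightarrow> bool" where
  "clean_intersection_at p M1 M2 x \<longleftrightarrow>
     (\<exists>V. open V \<and> x \<in> V \<and>
        (\<forall>y \<in> M1 \<inter> M2 \<inter> V.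
           Ck1_submanifold_at p (M1 \<inter> M2) y \<and>
           tangent_space (M1 \<inter> M2) y = tangent_space M1 y \<inter> tangent_space M2 y))"

text \<open>The projection onto \<open>D\<close> is \<^term>\<open>closest_point D\<close>, which selects some nearest point if
  there is one.  The following predicate says that there is exactly one, so that no
  selection is involved.\<close>

definition projection_defined :: "'a::euclidean_space set \<Rightarrow> 'a \<Rightarrow> bool" where
  "projection_defined D x \<longleftrightarrow> (\<exists>!z. z \<in> D \<and> (\<forall>w\<in>D. dist x z \<le> dist x w))"

lemma infdist_closest_point:
  fixes D :: "'a::euclidean_space set"
  assumes "closed D" "D \<noteq> {}"
  shows "infdist x D = norm (x - closest_point D x)"
  using setdist_closest_point[OF assms, of x]
  by (simp add: infdist_eq_setdist dist_norm)

definition tube :: "'a::euclidean_space set \<Rightarrow> real \<Rightarrow> 'a set" where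
  "tube K \<delta> = {y. infdist y K < \<delta>}"

definition first_order_consistent ::
  "'a::euclidean_space set \<Rightarrow> 'a set \<Rightarrow> ('a \<Rightarrow> 'a) \<Rightarrow> bool" where
  "first_order_consistent U M \<phi> \<longleftrightarrow>
     (\<forall>x \<in> U \<inter> M. (\<lambda>y. norm (\<phi> y - closest_point M y)) \<in> o[at x](\<lambda>y. infdist y M))"

definition alternating_framework ::
  "nat \<Rightarrow> 'a::euclidean_space set \<Rightarrow> 'a set \<Rightarrow> 'a \<Rightarrow> 'a set \<Rightarrow> ('a \<Rightarrow> 'a) \<Rightarrow> ('a \<Rightarrow> 'a) \<Rightarrow> bool"
where
  "alternating_framework p M1 M2 xbar U \<phi>1 \<phi>2 \<longleftrightarrow>
     open U \<and> xbar \<in> U \<and>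
     Ck_on (p - 1) U \<phi>1 \<and> Ck_on (p - 1) U \<phi>2 \<and> \<phi>1 ` U \<subseteq> M1 \<and>
     (((\<forall>y\<in>U. \<phi>1 y = closest_point M1 y) \<and> first_order_consistent U M2 \<phi>2) \<or>
      ((\<forall>y\<in>U. \<phi>2 y = closest_point M2 y) \<and> first_order_consistent U M1 \<phi>1) \<or>
      (first_order_consistent U M1 \<phi>1 \<and> \<phi>1 ` U \<subseteq> M1 \<and>
       first_order_consistent U M2 \<phi>2 \<and> \<phi>2 ` U \<subseteq> M2))"

text \<open>
  The asymptotic statements ``as \<open>u \<rightarrow> 0\<close>, uniformly in \<open>x \<in> K\<close>, for \<open>u\<close> whose normal part is
  \<open>o(\<parallel>u\<parallel>)\<close>'' are Landau statements along every filter on pairs \<open>(x, u)\<close> with \<open>x\<close> in \<open>K\<close>,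
  \<open>u\<close> tending to 0 and normal part \<open>o(\<parallel>u\<parallel>)\<close>.  As \<open>x\<close> varies along the filter as well, this
  includes the uniformity.
\<close>

definition tangent_normal_decomposition ::
  "nat \<Rightarrow> 'a::euclidean_space set \<Rightarrow> ('a \<Rightarrow> 'a) \<Rightarrow> 'a set \<Rightarrow> real \<Rightarrow> bool" where
  "tangent_normal_decomposition p M \<phi> K \<delta> \<longleftrightarrow>
     (\<exists>R\<^sub>N R\<^sub>T :: 'a \<times> 'a \<Rightarrow> 'a.
        Ck_map_on (p - 1) (K \<times> ball 0 \<delta>) R\<^sub>N \<and>
        Ck_map_on (p - 1) (K \<times> ball 0 \<delta>) R\<^sub>T \<and>
        (\<forall>x\<in>K. \<forall>u\<in>ball 0 \<delta>.
           R\<^sub>N (x, u) \<in> normal_space M x \<and> R\<^sub>T (x, u) \<in> tangent_space M x \<and>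
           \<phi> (x + u) = x + closest_point (tangent_space M x) u + R\<^sub>N (x, u) + R\<^sub>T (x, u)) \<and>
        (\<forall>F :: ('a \<times> 'a) filter.
           (\<forall>\<^sub>F (x, u) in F. x \<in> K \<and> x + u \<in> tube K \<delta>) \<longrightarrow>
           filterlim snd (nhds 0) F \<longrightarrow>
           (\<lambda>(x, u). norm (closest_point (normal_space M x) u)) \<in> o[F](\<lambda>(x, u). norm u) \<longrightarrow>
           (\<lambda>(x, u). norm (R\<^sub>N (x, u))) \<in> O[F](\<lambda>(x, u). (norm u)\<^sup>2) \<and>
           (\<lambda>(x, u). norm (R\<^sub>T (x, u))) \<in> o[F](\<lambda>(x, u). (norm u)\<^sup>2)))"

text \<open>\<open>\<phi>1 \<circ> \<phi>2\<close> is well-defined at \<open>y\<close> if \<open>y\<close> and \<open>\<phi>2 y\<close> both lie in the common domain \<open>U\<close>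
  of \<open>\<phi>1\<close> and \<open>\<phi>2\<close>.  Saying that \<open>\<phi>1 \<circ> \<phi>2\<close> is of class \<open>C\<^sup>2\<^sup>,\<^sup>1\<close> on \<open>tube K \<delta>\<close> includes
  that it is well-defined there, so \<open>decomposition_property\<close> below states this explicitly.\<close>

definition composition_defined :: "'a set \<Rightarrow> ('a \<Rightarrow> 'a) \<Rightarrow> 'a \<Rightarrow> bool" where
  "composition_defined U \<phi>2 y \<longleftrightarrow> y \<in> U \<and> \<phi>2 y \<in> U"

definition decomposition_property ::
  "nat \<Rightarrow> 'a::euclidean_space set \<Rightarrow> 'a set \<Rightarrow> 'a \<Rightarrow> 'a set \<Rightarrow> ('a \<Rightarrow> 'a) \<Rightarrow> ('a \<Rightarrow> 'a) \<Rightarrow>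
   'a set \<Rightarrow> 'a set \<Rightarrow> real \<Rightarrow> bool"
where
  "decomposition_property p M1 M2 xbar U \<phi>1 \<phi>2 \<Omega> K \<delta> \<longleftrightarrow>
     openin (top_of_set (M1 \<inter> M2)) \<Omega> \<and> xbar \<in> \<Omega> \<and>
     K = M1 \<inter> M2 \<inter> closure \<Omega> \<and> compact K \<and> K \<subseteq> U \<and>
     (\<forall>x\<in>K. clean_intersection_at p M1 M2 x) \<and>
     \<delta> > 0 \<and> tube K \<delta> \<subseteq> U \<and>
     (\<exists>\<tau>. 0 < \<tau> \<and> \<tau> < 1 \<and>
        (\<forall>y \<in> M1 \<inter> tube K \<delta>.
           composition_defined U \<phi>2 y \<and>
           infdist ((\<phi>1 \<circ> \<phi>2) y) M2 \<le> \<tau> * infdist y M2)) \<and>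
     (\<exists>r>0. \<forall>x\<in>\<Omega>. \<forall>\<eta>\<in>tangent_space (M1 \<inter> M2) x. norm \<eta> < r \<longrightarrow>
        (\<forall>n. ((\<phi>1 \<circ> \<phi>2) ^^ n) (x + \<eta>) \<in> tube K \<delta> \<and>
             \<phi>2 (((\<phi>1 \<circ> \<phi>2) ^^ n) (x + \<eta>)) \<in> tube K \<delta>)) \<and>
     tangent_normal_decomposition p M1 \<phi>1 K \<delta> \<and>
     tangent_normal_decomposition p M2 \<phi>2 K \<delta> \<and>
     (\<forall>y \<in> tube K \<delta>. composition_defined U \<phi>2 y) \<and>
     Ck1_on 2 (tube K \<delta>) (\<phi>1 \<circ> \<phi>2) \<and>
     second_derivative_lipschitz_on (tube K \<delta>) (\<phi>1 \<circ> \<phi>2)"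

definition newton_target :: "'a::euclidean_space set \<Rightarrow> 'a set \<Rightarrow> 'a \<Rightarrow> 'a set" where
  "newton_target M1 M2 z = M1 \<inter> (\<lambda>v. z + v) ` tangent_space M2 z"

definition newton_slra :: "'a::euclidean_space set \<Rightarrow> 'a set \<Rightarrow> 'a \<Rightarrow> 'a" where
  "newton_slra M1 M2 x =
     (let z = closest_point M2 x in closest_point (newton_target M1 M2 z) z)"

definition newton_slra_defined :: "'a::euclidean_space set \<Rightarrow> 'a set \<Rightarrow> 'a \<Rightarrow> bool" where
  "newton_slra_defined M1 M2 x \<longleftrightarrow>
     projection_defined M2 x \<and>
     (let z = closest_point M2 x in projection_defined (newton_target M1 M2 z) z)"

definition newton_slra_facts :: "'a::euclidean_space set \<Rightarrow> 'a set \<Rightarrow> 'a \<Rightarrow> bool" where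
  "newton_slra_facts M1 M2 xbar \<longleftrightarrow>
     (let M = M1 \<inter> M2; \<phi>\<^sub>N = newton_slra M1 M2; P = closest_point M in
      \<exists>\<delta>\<^sub>N \<rho>\<^sub>N \<mu> \<mu>' \<gamma> \<gamma>'. \<delta>\<^sub>N > 0 \<and> \<rho>\<^sub>N > 0 \<and> \<mu> > 0 \<and> \<mu>' > 0 \<and> \<gamma> > 0 \<and> \<gamma>' > 0 \<and>
        (\<forall>x \<in> ball xbar \<delta>\<^sub>N.
           \<phi>\<^sub>N x \<in> ball xbar \<rho>\<^sub>N \<and>
           norm (\<phi>\<^sub>N x - P x) \<le> \<mu> * (norm (x - P x))\<^sup>2 \<and>
           norm (P (\<phi>\<^sub>N x) - P x) \<le> \<mu>' * (norm (x - P x))\<^sup>2) \<and>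
        (\<forall>y0 \<in> ball xbar \<delta>\<^sub>N.
           (\<forall>k. newton_slra_defined M1 M2 ((\<phi>\<^sub>N ^^ k) y0)) \<and>
           (\<exists>y\<in>M. (\<lambda>k. (\<phi>\<^sub>N ^^ k) y0) \<longlonglongrightarrow> y \<and>
              (\<forall>k. norm ((\<phi>\<^sub>N ^^ Suc k) y0 - y) \<le> \<gamma> * (norm ((\<phi>\<^sub>N ^^ k) y0 - y))\<^sup>2) \<and>
              norm (y - P y0) \<le> \<gamma>' * (norm (y0 - P y0))\<^sup>2)))"

definition hybrid_step ::
  "'a::euclidean_space set \<Rightarrow> 'a set \<Rightarrow> ('a \<Rightarrow> 'a) \<Rightarrow> ('a \<Rightarrow> 'a) \<Rightarrow> nat \<Rightarrow> nat \<Rightarrow> nat \<Rightarrow> 'a \<Rightarrow> 'a"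
where
  "hybrid_step M1 M2 \<phi>1 \<phi>2 kA kI i y =
     (if i \<le> kA then closest_point M1 (closest_point M2 y)
      else if i \<le> kI then (\<phi>1 \<circ> \<phi>2) y
      else newton_slra M1 M2 y)"

definition hybrid_step_defined ::
  "'a::euclidean_space set \<Rightarrow> 'a set \<Rightarrow> 'a set \<Rightarrow> ('a \<Rightarrow> 'a) \<Rightarrow> nat \<Rightarrow> nat \<Rightarrow> nat \<Rightarrow> 'a \<Rightarrow> bool"
where
  "hybrid_step_defined M1 M2 U \<phi>2 kA kI i y \<longleftrightarrow>
     (if i \<le> kA then projection_defined M2 y \<and> projection_defined M1 (closest_point M2 y)
      else if i \<le> kI then composition_defined U \<phi>2 y
      else newton_slra_defined M1 M2 y)"

primrec hybrid_seq ::
  "'a::euclidean_space set \<Rightarrow> 'a set \<Rightarrow> ('a \<Rightarrow> 'a) \<Rightarrow> ('a \<Rightarrow> 'a) \<Rightarrow> nat \<Rightarrow> nat \<Rightarrow> 'a \<Rightarrow> nat \<Rightarrow> 'a"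
where
  "hybrid_seq M1 M2 \<phi>1 \<phi>2 kA kI x0 0 = x0"
| "hybrid_seq M1 M2 \<phi>1 \<phi>2 kA kI x0 (Suc i) =
     hybrid_step M1 M2 \<phi>1 \<phi>2 kA kI i (hybrid_seq M1 M2 \<phi>1 \<phi>2 kA kI x0 i)"

definition hybrid_map ::
  "'a::euclidean_space set \<Rightarrow> 'a set \<Rightarrow> ('a \<Rightarrow> 'a) \<Rightarrow> ('a \<Rightarrow> 'a) \<Rightarrow> nat \<Rightarrow> nat \<Rightarrow> 'a \<times> 'a \<Rightarrow> 'a"
where
  "hybrid_map M1 M2 \<phi>1 \<phi>2 kA kI = (\<lambda>(x, \<eta>).
     let X = hybrid_seq M1 M2 \<phi>1 \<phi>2 kA kI (x + \<eta>)
     in (x + \<eta>) + (\<Sum>i. X (Suc i) - X i))"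

definition hybrid_map_defined ::
  "'a::euclidean_space set \<Rightarrow> 'a set \<Rightarrow> 'a set \<Rightarrow> ('a \<Rightarrow> 'a) \<Rightarrow> ('a \<Rightarrow> 'a) \<Rightarrow> nat \<Rightarrow> nat \<Rightarrow> 'a \<times> 'a \<Rightarrow> bool"
where
  "hybrid_map_defined M1 M2 U \<phi>1 \<phi>2 kA kI = (\<lambda>(x, \<eta>).
     let X = hybrid_seq M1 M2 \<phi>1 \<phi>2 kA kI (x + \<eta>)
     in (\<forall>i. hybrid_step_defined M1 M2 U \<phi>2 kA kI i (X i)) \<and>
        summable (\<lambda>i. X (Suc i) - X i) \<and>
        X \<longlonglongrightarrow> hybrid_map M1 M2 \<phi>1 \<phi>2 kA kI (x, \<eta>))"

definition tangent_bundle_part ::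
  "'a::euclidean_space set \<Rightarrow> 'a set \<Rightarrow> real \<Rightarrow> ('a \<times> 'a) set" where
  "tangent_bundle_part M \<Omega> r = {(x, \<eta>). x \<in> \<Omega> \<and> \<eta> \<in> tangent_space M x \<and> norm \<eta> < r}"

definition second_order_retraction_on ::
  "'a::euclidean_space set \<Rightarrow> 'a set \<Rightarrow> real \<Rightarrow> ('a \<times> 'a \<Rightarrow> 'a) \<Rightarrow> bool" where
  "second_order_retraction_on M \<Omega> r \<psi> \<longleftrightarrow>
     Ck_map_on 2 (tangent_bundle_part M \<Omega> r) \<psi> \<and>
     \<psi> ` tangent_bundle_part M \<Omega> r \<subseteq> M \<and>
     (\<forall>x\<in>\<Omega>. \<forall>\<eta>\<in>tangent_space M x.
        (\<lambda>t. norm (\<psi> (x, t *\<^sub>R \<eta>) - (x + t *\<^sub>R \<eta>))) \<in> o[at 0](\<lambda>t. t) \<and>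
        (\<lambda>t. norm (closest_point (tangent_space M x) (\<psi> (x, t *\<^sub>R \<eta>) - (x + t *\<^sub>R \<eta>))))
          \<in> o[at 0](\<lambda>t. t\<^sup>2))"

end

theory Submission
  imports Defs
begin

text \<open>
  Write \<open>M = M1 \<inter> M2\<close>.  The hybrid map is \<open>\<psi> (x, \<eta>) = \<pi> (X (x + \<eta>))\<close>, where \<open>X\<close> is the composition of the
  \<open>kI + 1\<close> steps that precede the Newton phase and \<open>\<pi>\<close> maps a point to the limit of its Newton iteration.
  Two things have to be seen: \<open>\<psi>\<close> is of class \<open>C\<^sup>2\<close>, and its curves agree with \<open>x + t \<eta>\<close> to second
  order tangentially.
  
  \<^bold>\<open>Smoothness.\<close>  The finitely many initial steps are \<open>C\<^sup>2\<close>: nearest-point maps of submanifolds are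
  regular because the foot point and the Lagrange multiplier solve a system to which the inverse
  function theorem applies (\<open>regular_nearest_point\<close>), and the inexact steps are regular by
  assumption.  The Newton step is \<open>C\<^sup>2\<close> with locally Lipschitz second derivative, since transversality
  makes the linear system in its definition invertible (\<open>regular_newton_slra\<close>).  The limit map \<open>\<pi>\<close> of
  infinitely many steps needs an argument.  At a fixed point the derivative \<open>A\<close> of the Newton map is
  idempotent, and the second derivative \<open>b\<close> satisfies \<open>A (b (A v) (A w)) = 0\<close>; both follow by
  differentiating identities along curves of fixed points (\<open>quadratic_iteration_limit\<close>).  The
  derivatives of the iterates then satisfy linear recursions whose operators converge
  geometrically to an idempotent, and whose source terms it annihilates in the limit.  Such
  recursions converge geometrically, uniformly in the starting point
  (\<open>perturbed_projection_recursion\<close>), so \<open>\<pi>\<close> is \<open>C\<^sup>2\<close> (\<open>limit_twice_differentiable\<close>).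
  
  \<^bold>\<open>Second order.\<close>  The property that a curve \<open>c\<close> satisfies \<open>c t = x + t \<eta> + o(t)\<close> and that the
  component of \<open>c t - (x + t \<eta>)\<close> tangent to \<open>M\<close> is \<open>o(t\<^sup>2)\<close> is preserved by every initial step and by \<open>\<pi>\<close>.  For projections,
  the displacement is \<open>o(t)\<close> and normal at a point at distance \<open>O(t)\<close> from \<open>x\<close>, so its component tangent at \<open>x\<close>
  is \<open>o(t\<^sup>2)\<close> (\<open>second_order_curve_nearest_point\<close>).  For the inexact steps this is the decomposition
  property (\<open>second_order_curve_decomposition\<close>).  The limit \<open>\<pi>\<close> differs from the projection onto \<open>M\<close> by at
  most a multiple of the square of the distance to \<open>M\<close>, which is \<open>o(t\<^sup>2)\<close> (\<open>second_order_step_perturb\<close>).  The property holds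
  trivially for \<open>x + t \<eta>\<close>, hence for \<open>\<psi> (x, t \<eta>)\<close>.  All these maps fix \<open>M\<close>, so the neighbourhoods on which
  they are defined can be composed.
\<close>

section \<open>Regularity classes\<close>

definition locally_lipschitz :: "'a::metric_space set \<Rightarrow> ('a \<Rightarrow> 'b::metric_space) \<Rightarrow> bool" where
  "locally_lipschitz S f \<longleftrightarrow> (\<forall>x\<in>S. \<exists>e>0. \<exists>L. L-lipschitz_on (S \<inter> cball x e) f)"

text \<open>
  \<^const>\<open>Ck_on\<close> and \<^const>\<open>Ck1_on\<close> have the same recursion and differ only at order 0 (continuous versus
  locally Lipschitz).  The flag \<open>l\<close> selects the base class, so that every closure property is
  proved once for both scales.
\<close>

definition regular_on ::
  "bool \<Rightarrow> nat \<Rightarrow> 'a::euclidean_space set \<Rightarrow> ('a \<Rightarrow> 'b::real_normed_vector) \<Rightarrow> bool" where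
  "regular_on l k S f \<longleftrightarrow> (if l then Ck1_on k S f else Ck_on k S f)"

lemma regular_on_0:
  "regular_on l 0 S f \<longleftrightarrow> (if l then locally_lipschitz S f else continuous_on S f)"
  by (simp add: regular_on_def locally_lipschitz_def)

lemma regular_on_Suc:
  "regular_on l (Suc k) S f \<longleftrightarrow>
     (\<forall>x\<in>S. f differentiable (at x)) \<and> (\<forall>v. regular_on l k S (\<lambda>x. frechet_derivative f (at x) v))"
  by (simp add: regular_on_def)

lemma locally_lipschitz_continuous_on:
  assumes "locally_lipschitz S f"
  shows "continuous_on S f"
  unfolding continuous_on_eq_continuous_within
proof
  fix x assume x: "x \<in> S"
  then obtain e L where e: "e > 0" "L-lipschitz_on (S \<inter> cball x e) f"
    using assms unfolding locally_lipschitz_def by blast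
  have "continuous (at x within (S \<inter> cball x e)) f"
    using lipschitz_on_continuous_on[OF e(2)] x e(1) by (simp add: continuous_on_eq_continuous_within)
  moreover have "at x within (S \<inter> cball x e) = at x within S"
    by (rule at_within_nhd[of _ "ball x e"]) (use e(1) in auto)
  ultimately show "continuous (at x within S) f"
    by (simp add: continuous_within)
qed

lemma locally_lipschitz_cong:
  assumes "\<And>x. x \<in> S \<Longrightarrow> f x = g x" "locally_lipschitz S f"
  shows "locally_lipschitz S g"
proof -
  have "L-lipschitz_on (S \<inter> cball x e) g" if "L-lipschitz_on (S \<inter> cball x e) f" for x e L
    using lipschitz_on_transform[OF that, of g] assms(1) by auto
  then show ?thesis using assms(2) unfolding locally_lipschitz_def by blast
qed

lemma locally_lipschitz_subset:
  assumes "T \<subseteq> S" "locally_lipschitz S f"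
  shows "locally_lipschitz T f"
  unfolding locally_lipschitz_def
proof
  fix x assume "x \<in> T"
  then obtain e L where "e > 0" "L-lipschitz_on (S \<inter> cball x e) f"
    using assms unfolding locally_lipschitz_def by blast
  moreover from this have "L-lipschitz_on (T \<inter> cball x e) f"
    by (rule_tac lipschitz_on_subset) (use assms in auto)
  ultimately show "\<exists>e>0. \<exists>L. L-lipschitz_on (T \<inter> cball x e) f" by blast
qed

lemma locally_lipschitz_compose:
  assumes f: "locally_lipschitz S f" and g: "locally_lipschitz T g" and gT: "g ` T \<subseteq> S"
  shows "locally_lipschitz T (\<lambda>x. f (g x))"
  unfolding locally_lipschitz_def
proof
  fix x assume x: "x \<in> T"
  obtain e2 L2 where e2: "e2 > 0" "L2-lipschitz_on (T \<inter> cball x e2) g"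
    using g x unfolding locally_lipschitz_def by blast
  obtain e1 L1 where e1: "e1 > 0" "L1-lipschitz_on (S \<inter> cball (g x) e1) f"
    using f x gT unfolding locally_lipschitz_def by blast
  have L2: "L2 \<ge> 0" using e2(2) lipschitz_on_nonneg by blast
  define e where "e = min e2 (e1 / (L2 + 1))"
  have e: "e > 0" using e1 e2 L2 by (simp add: e_def)
  have Le: "L2 * e \<le> e1"
  proof -
    have "L2 * e \<le> (L2 + 1) * (e1 / (L2 + 1))"
      using L2 e1 e by (intro mult_mono) (auto simp: e_def)
    then show ?thesis using L2 by simp
  qed
  have g1: "L2-lipschitz_on (T \<inter> cball x e) g"
    by (rule lipschitz_on_subset[OF e2(2)]) (auto simp: e_def)
  have im: "g ` (T \<inter> cball x e) \<subseteq> S \<inter> cball (g x) e1"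
  proof (rule image_subsetI)
    fix y assume "y \<in> T \<inter> cball x e"
    then have y: "y \<in> T" "dist x y \<le> e" by auto
    have "dist (g x) (g y) \<le> L2 * dist x y"
      by (rule lipschitz_onD[OF e2(2)]) (use x y e2 e in \<open>auto simp: e_def\<close>)
    also have "\<dots> \<le> L2 * e" using y L2 by (intro mult_left_mono)
    finally show "g y \<in> S \<inter> cball (g x) e1" using Le y gT by auto
  qed
  have "(L1 * L2)-lipschitz_on (T \<inter> cball x e) (\<lambda>x. f (g x))"
    using lipschitz_on_compose2[OF g1 lipschitz_on_subset[OF e1(2) im]] by (simp add: mult.commute)
  then show "\<exists>e>0. \<exists>L. L-lipschitz_on (T \<inter> cball x e) (\<lambda>x. f (g x))" using e by blast
qed

lemma locally_lipschitz_add: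
  fixes f g :: "'a::metric_space \<Rightarrow> 'b::real_normed_vector"
  assumes f: "locally_lipschitz S f" and g: "locally_lipschitz S g"
  shows "locally_lipschitz S (\<lambda>x. f x + g x)"
  unfolding locally_lipschitz_def
proof
  fix x assume x: "x \<in> S"
  obtain e1 L1 where e1: "e1 > 0" "L1-lipschitz_on (S \<inter> cball x e1) f"
    using f x unfolding locally_lipschitz_def by blast
  obtain e2 L2 where e2: "e2 > 0" "L2-lipschitz_on (S \<inter> cball x e2) g"
    using g x unfolding locally_lipschitz_def by blast
  have "(L1 + L2)-lipschitz_on (S \<inter> cball x (min e1 e2)) (\<lambda>x. f x + g x)"
    by (intro lipschitz_on_add lipschitz_on_subset[OF e1(2)] lipschitz_on_subset[OF e2(2)]) auto
  then show "\<exists>e>0. \<exists>L. L-lipschitz_on (S \<inter> cball x e) (\<lambda>x. f x + g x)"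
    using e1 e2 by (intro exI[of _ "min e1 e2"]) auto
qed

lemma locally_lipschitz_scaleR:
  fixes f :: "'a::metric_space \<Rightarrow> 'b::real_normed_vector" and c :: "'a \<Rightarrow> real"
  assumes c: "locally_lipschitz S c" and f: "locally_lipschitz S f"
  shows "locally_lipschitz S (\<lambda>x. c x *\<^sub>R f x)"
  unfolding locally_lipschitz_def
proof
  fix x assume x: "x \<in> S"
  obtain e1 L1 where e1: "e1 > 0" "L1-lipschitz_on (S \<inter> cball x e1) c"
    using c x unfolding locally_lipschitz_def by blast
  obtain e2 L2 where e2: "e2 > 0" "L2-lipschitz_on (S \<inter> cball x e2) f"
    using f x unfolding locally_lipschitz_def by blast
  have L: "L1 \<ge> 0" "L2 \<ge> 0" using e1 e2 lipschitz_on_nonneg by blast+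
  define e where "e = min e1 e2"
  define C where "C = \<bar>c x\<bar> + L1 * e"
  define F where "F = norm (f x) + L2 * e"
  have e: "e > 0" using e1 e2 by (simp add: e_def)
  have C: "C \<ge> 0" "F \<ge> 0" using L e by (auto simp: C_def F_def)
  have cb: "\<bar>c y\<bar> \<le> C" if "y \<in> S \<inter> cball x e" for y
  proof -
    have "dist (c y) (c x) \<le> L1 * dist y x"
      by (rule lipschitz_onD[OF e1(2)]) (use that x e1 in \<open>auto simp: e_def\<close>)
    also have "\<dots> \<le> L1 * e" using that L by (intro mult_left_mono) (auto simp: dist_commute)
    finally show ?thesis by (simp add: C_def dist_real_def)
  qed
  have fb: "norm (f y) \<le> F" if "y \<in> S \<inter> cball x e" for y
  proof -
    have "dist (f y) (f x) \<le> L2 * dist y x"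
      by (rule lipschitz_onD[OF e2(2)]) (use that x e2 in \<open>auto simp: e_def\<close>)
    also have "\<dots> \<le> L2 * e" using that L by (intro mult_left_mono) (auto simp: dist_commute)
    finally show ?thesis using norm_triangle_sub[of "f y" "f x"] by (simp add: F_def dist_norm)
  qed
  have "(C * L2 + L1 * F)-lipschitz_on (S \<inter> cball x e) (\<lambda>x. c x *\<^sub>R f x)"
  proof (rule lipschitz_onI)
    fix y z assume y: "y \<in> S \<inter> cball x e" and z: "z \<in> S \<inter> cball x e"
    have 1: "dist (c y) (c z) \<le> L1 * dist y z" "dist (f y) (f z) \<le> L2 * dist y z"
      by (rule lipschitz_onD[OF e1(2)] lipschitz_onD[OF e2(2)]; use y z in \<open>auto simp: e_def\<close>)+
    have "dist (c y *\<^sub>R f y) (c z *\<^sub>R f z) = norm (c y *\<^sub>R (f y - f z) + (c y - c z) *\<^sub>R f z)"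
      by (simp add: dist_norm algebra_simps)
    also have "\<dots> \<le> \<bar>c y\<bar> * dist (f y) (f z) + dist (c y) (c z) * norm (f z)"
      using norm_triangle_ineq[of "c y *\<^sub>R (f y - f z)" "(c y - c z) *\<^sub>R f z"]
      by (simp add: dist_norm)
    also have "\<dots> \<le> C * (L2 * dist y z) + (L1 * dist y z) * F"
      using cb[OF y] fb[OF z] 1 C L by (intro add_mono mult_mono) auto
    finally show "dist (c y *\<^sub>R f y) (c z *\<^sub>R f z) \<le> (C * L2 + L1 * F) * dist y z"
      by (simp add: algebra_simps)
  qed (use C L in simp)
  then show "\<exists>e>0. \<exists>L. L-lipschitz_on (S \<inter> cball x e) (\<lambda>x. c x *\<^sub>R f x)" using e by blast
qed

lemma locally_lipschitz_bounded_linear: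
  assumes "bounded_linear f"
  shows "locally_lipschitz S f"
proof -
  obtain B where "B-lipschitz_on UNIV f" using bounded_linear.lipschitz_boundE[OF assms] by blast
  then have "B-lipschitz_on (S \<inter> cball x 1) f" for x by (rule lipschitz_on_subset) auto
  then show ?thesis unfolding locally_lipschitz_def using zero_less_one by blast
qed

lemma locally_lipschitz_const: "locally_lipschitz S (\<lambda>x. c)"
  unfolding locally_lipschitz_def using lipschitz_on_constant zero_less_one by blast

lemma regular_on_cong:
  assumes "open S" "\<And>x. x \<in> S \<Longrightarrow> f x = g x" "regular_on l k S f"
  shows "regular_on l k S g"
  using assms(2,3)
proof (induction k arbitrary: f g)
  case 0
  then show ?case using locally_lipschitz_cong[of S f g] continuous_on_cong[of S S f g]
    by (auto simp: regular_on_0 split: if_splits)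
next
  case (Suc k)
  have d: "(g has_derivative frechet_derivative f (at x)) (at x)" if "x \<in> S" for x
    by (rule has_derivative_transform_within_open[of f _ _ _ S])
       (use that Suc.prems assms(1) in \<open>auto simp: regular_on_Suc frechet_derivative_works\<close>)
  have e: "frechet_derivative f (at x) = frechet_derivative g (at x)" if "x \<in> S" for x
    using frechet_derivative_at[OF d[OF that]] .
  show ?case unfolding regular_on_Suc
  proof (intro conjI ballI allI)
    show "g differentiable at x" if "x \<in> S" for x using d[OF that] differentiable_def by blast
    show "regular_on l k S (\<lambda>x. frechet_derivative g (at x) v)" for v
      by (rule Suc.IH[of "\<lambda>x. frechet_derivative f (at x) v"])
         (use Suc.prems e in \<open>auto simp: regular_on_Suc\<close>)
  qed
qed

lemma regular_on_SucI:
  assumes "open S" "\<And>x. x \<in> S \<Longrightarrow> (f has_derivative D x) (at x)"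
    and "\<And>v. regular_on l k S (\<lambda>x. D x v)"
  shows "regular_on l (Suc k) S f"
  unfolding regular_on_Suc
proof (intro conjI ballI allI)
  show "f differentiable at x" if "x \<in> S" for x using assms(2)[OF that] differentiable_def by blast
  show "regular_on l k S (\<lambda>x. frechet_derivative f (at x) v)" for v
    by (rule regular_on_cong[OF assms(1) _ assms(3)[of v]])
       (use frechet_derivative_at[OF assms(2)] in simp)
qed

lemma regular_on_SucD:
  assumes "regular_on l (Suc k) S f"
  shows "x \<in> S \<Longrightarrow> (f has_derivative frechet_derivative f (at x)) (at x)"
    and "regular_on l k S (\<lambda>x. frechet_derivative f (at x) v)"
  using assms by (auto simp: regular_on_Suc frechet_derivative_works)

lemma regular_on_subset:
  assumes "T \<subseteq> S" "regular_on l k S f"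
  shows "regular_on l k T f"
  using assms(2)
proof (induction k arbitrary: f)
  case 0
  then show ?case using locally_lipschitz_subset[OF assms(1)] continuous_on_subset[OF _ assms(1)]
    by (auto simp: regular_on_0 split: if_splits)
next
  case (Suc k) then show ?case using assms(1) unfolding regular_on_Suc by blast
qed

lemma regular_on_imp_continuous_on:
  assumes "regular_on l k S f"
  shows "continuous_on S f"
proof (cases k)
  case 0 then show ?thesis using assms locally_lipschitz_continuous_on
    by (auto simp: regular_on_0 split: if_splits)
next
  case (Suc k) then show ?thesis
    using assms by (auto simp: regular_on_Suc intro!: continuous_at_imp_continuous_on
        differentiable_imp_continuous_within)
qed

lemma bounded_linear_basis_expansion:
  fixes A :: "'a::euclidean_space \<Rightarrow> 'b::real_normed_vector"
  assumes "bounded_linear A"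
  shows "A v = (\<Sum>i\<in>Basis. (v \<bullet> i) *\<^sub>R A i)"
proof -
  interpret A: bounded_linear A by fact
  have "A v = A (\<Sum>i\<in>Basis. (v \<bullet> i) *\<^sub>R i)" by (simp add: euclidean_representation)
  then show ?thesis by (simp add: A.sum A.scaleR)
qed

lemma norm_le_basis_bound:
  fixes A :: "'a::euclidean_space \<Rightarrow> 'b::real_normed_vector"
  assumes "bounded_linear A" "\<And>i. i \<in> Basis \<Longrightarrow> norm (A i) \<le> C"
  shows "norm (A v) \<le> (real DIM('a) * C) * norm v"
proof -
  have "norm (A v) \<le> (\<Sum>i\<in>Basis. norm ((v \<bullet> i) *\<^sub>R A i))"
    unfolding bounded_linear_basis_expansion[OF assms(1), of v] by (rule norm_sum)
  also have "\<dots> \<le> (\<Sum>i\<in>(Basis::'a set). norm v * C)"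
    by (intro sum_mono) (auto intro!: mult_mono assms(2) Basis_le_norm)
  finally show ?thesis by (simp add: mult_ac)
qed

text \<open>
  The derivative is bounded on a compact ball, and the mean value inequality applies there.
\<close>

lemma differentiable_imp_locally_lipschitz:
  fixes f :: "'a::euclidean_space \<Rightarrow> 'b::real_normed_vector"
  assumes "open S" and D: "\<And>x. x \<in> S \<Longrightarrow> (f has_derivative D x) (at x)"
    and c: "\<And>v. continuous_on S (\<lambda>x. D x v)"
  shows "locally_lipschitz S f"
  unfolding locally_lipschitz_def
proof
  fix x assume x: "x \<in> S"
  then obtain e where e: "e > 0" "cball x e \<subseteq> S" using assms(1) open_contains_cball by blast
  have "\<exists>C. \<forall>i\<in>Basis. \<forall>y\<in>cball x e. norm (D y i) \<le> C"
  proof -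
    have "\<exists>C. \<forall>y\<in>cball x e. norm (D y i) \<le> C" for i
    proof -
      have "compact ((\<lambda>y. D y i) ` cball x e)"
        by (intro compact_continuous_image continuous_on_subset[OF c e(2)]) auto
      then show ?thesis using compact_imp_bounded[of "(\<lambda>y. D y i) ` cball x e"]
        by (auto simp: bounded_iff)
    qed
    then obtain C where C: "\<And>i y. y \<in> cball x e \<Longrightarrow> norm (D y i) \<le> C i" by metis
    have "norm (D y i) \<le> (\<Sum>j\<in>Basis. \<bar>C j\<bar>)" if "i \<in> Basis" "y \<in> cball x e" for i y
    proof -
      have "norm (D y i) \<le> \<bar>C i\<bar>" using C[OF that(2), of i] by simp
      also have "\<dots> \<le> (\<Sum>j\<in>Basis. \<bar>C j\<bar>)" using that by (intro member_le_sum) auto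
      finally show ?thesis .
    qed
    then show ?thesis by blast
  qed
  then obtain C where C: "\<And>i y. i \<in> Basis \<Longrightarrow> y \<in> cball x e \<Longrightarrow> norm (D y i) \<le> C" by blast
  define B where "B = real DIM('a) * C"
  have "C \<ge> 0" using order_trans[OF norm_ge_zero C[OF SOME_Basis, of x]] e by auto
  then have B0: "B \<ge> 0" by (simp add: B_def)
  have o: "onorm (D y) \<le> B" if "y \<in> cball x e" for y
    by (rule onorm_bound[OF B0]) (unfold B_def, rule norm_le_basis_bound,
      use has_derivative_bounded_linear[OF D, of y] that e C in auto)
  have "B-lipschitz_on (S \<inter> cball x e) f"
  proof (rule lipschitz_onI[OF _ B0])
    fix y z assume "y \<in> S \<inter> cball x e" "z \<in> S \<inter> cball x e"
    then show "dist (f y) (f z) \<le> B * dist y z" unfolding dist_norm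
      using e(2) by (intro differentiable_bound[of "cball x e" f D] o has_derivative_at_withinI[OF D])
         auto
  qed
  then show "\<exists>e>0. \<exists>L. L-lipschitz_on (S \<inter> cball x e) f" using e by blast
qed

lemma regular_on_lower:
  assumes "open S" "regular_on l (Suc k) S f"
  shows "regular_on l k S f"
  using assms(2)
proof (induction k arbitrary: f)
  case 0
  show ?case
  proof (cases l)
    case True
    have "locally_lipschitz S f"
      by (rule differentiable_imp_locally_lipschitz[OF assms(1) regular_on_SucD(1)[OF 0]
            regular_on_imp_continuous_on[OF regular_on_SucD(2)[OF 0]]])
    then show ?thesis using True by (simp add: regular_on_0)
  next
    case False
    then show ?thesis using regular_on_imp_continuous_on[OF 0] by (simp add: regular_on_0)
  qed
next
  case (Suc k)
  show ?case
    by (rule regular_on_SucI[OF assms(1) regular_on_SucD(1)[OF Suc.prems]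
         Suc.IH[OF regular_on_SucD(2)[OF Suc.prems]]])
qed

lemma regular_on_le:
  assumes "open S" "j \<le> k" "regular_on l k S f"
  shows "regular_on l j S f"
  using assms(2,3)
proof (induction rule: inc_induct)
  case base then show ?case .
next
  case (step n)
  show ?case by (rule regular_on_lower[OF assms(1) step.IH[OF step.prems]])
qed

lemma regular_on_forget_lipschitz:
  assumes "open S" "regular_on True k S f"
  shows "regular_on l k S f"
  using assms(2)
proof (induction k arbitrary: f)
  case 0 then show ?case by (auto simp: regular_on_0 locally_lipschitz_continuous_on)
next
  case (Suc k) then show ?case unfolding regular_on_Suc by blast
qed

lemma regular_on_const: "regular_on l k S (\<lambda>x. c)"
proof (induction k arbitrary: c)
  case 0 then show ?case by (simp add: regular_on_0 locally_lipschitz_const)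
qed (simp add: regular_on_Suc)

lemma regular_on_bounded_linear:
  assumes "open S" "bounded_linear f"
  shows "regular_on l k S f"
proof (cases k)
  case 0
  then show ?thesis using locally_lipschitz_bounded_linear[OF assms(2)]
    by (simp add: regular_on_0 linear_continuous_on assms(2))
next
  case (Suc k)
  show ?thesis unfolding Suc
    by (rule regular_on_SucI[OF assms(1) bounded_linear_imp_has_derivative[OF assms(2)]])
       (rule regular_on_const)
qed

lemma regular_on_add:
  assumes "open S" "regular_on l k S f" "regular_on l k S g"
  shows "regular_on l k S (\<lambda>x. f x + g x)"
  using assms(2,3)
proof (induction k arbitrary: f g)
  case 0
  then show ?case by (auto simp: regular_on_0 intro: locally_lipschitz_add continuous_on_add)
next
  case (Suc k)
  show ?case
    by (rule regular_on_SucI[OF assms(1) has_derivative_add[OF regular_on_SucD(1)[OF Suc.prems(1)]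
         regular_on_SucD(1)[OF Suc.prems(2)]]], assumption+)
       (rule Suc.IH[OF regular_on_SucD(2)[OF Suc.prems(1)] regular_on_SucD(2)[OF Suc.prems(2)]])
qed

lemma regular_on_sum:
  assumes "open S" "finite I" "\<And>i. i \<in> I \<Longrightarrow> regular_on l k S (f i)"
  shows "regular_on l k S (\<lambda>x. \<Sum>i\<in>I. f i x)"
  using assms(2,3)
proof (induction I)
  case (insert i I)
  show ?case unfolding sum.insert[OF insert.hyps]
    by (rule regular_on_add[OF assms(1)]) (use insert in auto)
qed (simp add: regular_on_const)

lemma regular_on_scaleR:
  fixes c :: "'a::euclidean_space \<Rightarrow> real"
  assumes "open S" "regular_on l k S c" "regular_on l k S f"
  shows "regular_on l k S (\<lambda>x. c x *\<^sub>R f x)"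
  using assms(2,3)
proof (induction k arbitrary: c f)
  case 0
  then show ?case by (auto simp: regular_on_0 intro: locally_lipschitz_scaleR continuous_on_scaleR)
next
  case (Suc k)
  note l = regular_on_lower[OF assms(1) Suc.prems(1)] regular_on_lower[OF assms(1) Suc.prems(2)]
  note d = regular_on_SucD(2)[OF Suc.prems(1)] regular_on_SucD(2)[OF Suc.prems(2)]
  show ?case
    by (rule regular_on_SucI[OF assms(1) has_derivative_scaleR[OF regular_on_SucD(1)[OF Suc.prems(1)]
         regular_on_SucD(1)[OF Suc.prems(2)]]], assumption+)
       (rule regular_on_add[OF assms(1) Suc.IH[OF l(1) d(2)] Suc.IH[OF d(1) l(2)]])
qed

lemma regular_on_bounded_linear_compose:
  assumes "open S" "bounded_linear A" "regular_on l k S f"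
  shows "regular_on l k S (\<lambda>x. A (f x))"
  using assms(3)
proof (induction k arbitrary: f)
  case 0
  then show ?case
    using locally_lipschitz_compose[OF locally_lipschitz_bounded_linear[OF assms(2), of UNIV], of S f]
    by (auto simp: regular_on_0 intro: bounded_linear.continuous_on[OF assms(2)])
next
  case (Suc k)
  show ?case
    by (rule regular_on_SucI[OF assms(1) bounded_linear.has_derivative[OF assms(2) regular_on_SucD(1)[OF Suc.prems]]], assumption)
       (rule Suc.IH[OF regular_on_SucD(2)[OF Suc.prems]])
qed

lemma regular_on_diff:
  assumes "open S" "regular_on l k S f" "regular_on l k S g"
  shows "regular_on l k S (\<lambda>x. f x - g x)"
  using regular_on_add[OF assms(1,2) regular_on_bounded_linear_compose[OF assms(1) _ assms(3), of uminus]]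
    bounded_linear_minus[OF bounded_linear_ident] by simp

lemma regular_on_inner_const:
  assumes "open S" "regular_on l k S f"
  shows "regular_on l k S (\<lambda>x. f x \<bullet> c)"
  by (rule regular_on_bounded_linear_compose[OF assms(1) bounded_linear_inner_left assms(2)])

lemma regular_on_Pair:
  assumes "open S" "regular_on l k S f" "regular_on l k S g"
  shows "regular_on l k S (\<lambda>x. (f x, g x))"
  using regular_on_add[OF assms(1)
      regular_on_bounded_linear_compose[OF assms(1) bounded_linear_Pair[OF bounded_linear_ident bounded_linear_zero] assms(2)]
      regular_on_bounded_linear_compose[OF assms(1) bounded_linear_Pair[OF bounded_linear_zero bounded_linear_ident] assms(3)]]
  by simp

text \<open>
  Expanding \<open>u x\<close> in the standard basis turns the evaluation of a family of linear maps into a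
  finite sum of products of regular functions.  With directional derivatives instead of
  operator-valued ones, this takes the place of a product rule for composition of operators; in
  \<open>regular_on_compose\<close> it is applied to the derivative given by the chain rule.
\<close>

lemma regular_on_apply:
  fixes A :: "'a::euclidean_space \<Rightarrow> 'b::euclidean_space \<Rightarrow> 'c::real_normed_vector"
  assumes "open S" "\<And>x. x \<in> S \<Longrightarrow> bounded_linear (A x)"
    and "\<And>v. regular_on l k S (\<lambda>x. A x v)" "regular_on l k S u"
  shows "regular_on l k S (\<lambda>x. A x (u x))"
proof -
  have "regular_on l k S (\<lambda>x. \<Sum>i\<in>Basis. (u x \<bullet> i) *\<^sub>R A x i)"
    by (intro regular_on_sum regular_on_scaleR regular_on_inner_const assms) auto
  then show ?thesis
    by (rule regular_on_cong[OF assms(1), rotated])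
       (use bounded_linear_basis_expansion[OF assms(2), symmetric] in simp)
qed

lemma regular_on_compose:
  fixes g :: "'a::euclidean_space \<Rightarrow> 'b::euclidean_space" and f :: "'b \<Rightarrow> 'c::real_normed_vector"
  assumes "open S" "open T" "g ` T \<subseteq> S" "regular_on l k S f" "regular_on l k T g"
  shows "regular_on l k T (\<lambda>x. f (g x))"
  using assms(4,5)
proof (induction k arbitrary: f)
  case 0
  show ?case
  proof (cases l)
    case True
    then show ?thesis using 0 locally_lipschitz_compose[OF _ _ assms(3), of f]
      by (simp add: regular_on_0)
  next
    case False
    then show ?thesis using 0 continuous_on_compose2[OF _ _ assms(3), of f]
      by (simp add: regular_on_0)
  qed
next
  case (Suc k)
  let ?Df = "\<lambda>y. frechet_derivative f (at y)" and ?Dg = "\<lambda>x. frechet_derivative g (at x)"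
  have g: "regular_on l k T g" by (rule regular_on_lower[OF assms(2) Suc.prems(2)])
  have Df: "(f has_derivative ?Df (g x)) (at (g x))" if "x \<in> T" for x
    using regular_on_SucD(1)[OF Suc.prems(1)] that assms(3) by blast
  show ?case
  proof (rule regular_on_SucI[OF assms(2)])
    show "((\<lambda>x. f (g x)) has_derivative (\<lambda>h. ?Df (g x) (?Dg x h))) (at x)" if "x \<in> T" for x
      by (rule has_derivative_compose[OF regular_on_SucD(1)[OF Suc.prems(2) that] Df[OF that]])
    show "regular_on l k T (\<lambda>x. ?Df (g x) (?Dg x h))" for h
      by (rule regular_on_apply[OF assms(2)])
         (auto intro: has_derivative_bounded_linear[OF Df] regular_on_SucD(2)[OF Suc.prems(2)]
            Suc.IH[OF regular_on_SucD(2)[OF Suc.prems(1)] g])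
  qed
qed

section \<open>Inverses of linear families and of maps\<close>

text \<open>
  Invertibility is an open condition, in quantitative form: near \<open>x0\<close> the maps stay bounded below
  by half the bound that \<open>A x0\<close> satisfies.  Continuity of the family is used on the finitely many
  basis vectors only.
\<close>

lemma invertible_family_bounded_below:
  fixes A :: "'a::metric_space \<Rightarrow> 'b::euclidean_space \<Rightarrow> 'c::euclidean_space"
  assumes lin: "\<And>x. x \<in> S \<Longrightarrow> bounded_linear (A x)" and inj: "inj (A x0)" and x0: "x0 \<in> S"
    and cont: "\<And>v. continuous_on S (\<lambda>x. A x v)"
  obtains c e where "c > 0" "e > 0" "\<And>x u. x \<in> S \<inter> cball x0 e \<Longrightarrow> c * norm u \<le> norm (A x u)"
proof -
  obtain c0 where c0: "c0 > 0" "\<And>u. c0 * norm u \<le> norm (A x0 u)"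
    using linear_inj_bounded_below_pos[of "A x0"] lin[OF x0] inj bounded_linear.linear by metis
  define \<eta> where "\<eta> = c0 / (2 * real DIM('b))"
  have \<eta>: "\<eta> > 0" using c0 by (simp add: \<eta>_def)
  have "\<forall>\<^sub>F x in at x0 within S. \<forall>i\<in>Basis. norm (A x i - A x0 i) < \<eta>"
  proof (rule eventually_ball_finite[OF finite_Basis], rule ballI)
    fix i :: 'b
    have "((\<lambda>x. A x i) \<longlongrightarrow> A x0 i) (at x0 within S)" using cont[of i] x0 by (simp add: continuous_on_def)
    then show "\<forall>\<^sub>F x in at x0 within S. norm (A x i - A x0 i) < \<eta>"
      unfolding dist_norm[symmetric] by (rule tendstoD[OF _ \<eta>])
  qed
  then obtain d where d: "d > 0"
    "\<And>x. x \<in> S \<Longrightarrow> x \<noteq> x0 \<Longrightarrow> dist x x0 < d \<Longrightarrow> (\<forall>i\<in>Basis. norm (A x i - A x0 i) < \<eta>)"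
    by (auto simp: eventually_at)
  have "c0 / 2 * norm u \<le> norm (A x u)" if x: "x \<in> S \<inter> cball x0 (d / 2)" for x u
  proof -
    have *: "norm (A x i - A x0 i) \<le> \<eta>" if "i \<in> Basis" for i
    proof (cases "x = x0")
      case True then show ?thesis using \<eta> by simp
    next
      case False then show ?thesis using d(2)[of x] x that d(1) by (auto simp: dist_commute less_imp_le)
    qed
    have "norm (A x u - A x0 u) \<le> (real DIM('b) * \<eta>) * norm u"
      by (rule norm_le_basis_bound[of "\<lambda>u. A x u - A x0 u"]) (use * lin x x0 in \<open>auto intro: bounded_linear_sub\<close>)
    also have "\<dots> = c0 / 2 * norm u" by (simp add: \<eta>_def)
    finally have "norm (A x0 u) - norm (A x u) \<le> c0 / 2 * norm u"
      using norm_triangle_ineq2[of "A x0 u" "A x u"] by (simp add: norm_minus_commute)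
    then show ?thesis using c0(2)[of u] by (simp add: field_simps)
  qed
  then show thesis using that[of "c0 / 2" "d / 2"] c0 d by simp
qed

text \<open>
  A product differentiates with one factor merely continuous, provided that the other factor
  vanishes at the point.  This is what makes the inverse of a differentiable family of operators
  differentiable before anything is known about the derivative of the inverse.
\<close>

lemma has_derivative_scaleR_at_zero:
  fixes \<rho> :: "'a::real_normed_vector \<Rightarrow> real" and c :: "'a \<Rightarrow> 'b::real_normed_vector"
  assumes \<rho>: "(\<rho> has_derivative \<rho>') (at x0)" "\<rho> x0 = 0" and c: "isCont c x0"
  shows "((\<lambda>x. \<rho> x *\<^sub>R c x) has_derivative (\<lambda>h. \<rho>' h *\<^sub>R c x0)) (at x0)"
proof -
  have bl: "bounded_linear \<rho>'" using \<rho>(1) has_derivative_bounded_linear by blast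
  obtain B where B: "B > 0" "\<And>h. norm (\<rho>' h) \<le> norm h * B"
    using bounded_linear.pos_bounded[OF bl] by blast
  have "((\<lambda>x. \<rho> x *\<^sub>R (c x - c x0)) has_derivative (\<lambda>h. 0)) (at x0)"
    unfolding has_derivative_at_alt
  proof (intro conjI allI impI bounded_linear_zero)
    fix e :: real assume e: "e > 0"
    obtain d1 where d1: "d1 > 0" "\<And>y. norm (y - x0) < d1 \<Longrightarrow>
        norm (\<rho> y - \<rho> x0 - \<rho>' (y - x0)) \<le> 1 * norm (y - x0)"
      using \<rho>(1) unfolding has_derivative_at_alt using zero_less_one by blast
    obtain d2 where d2: "d2 > 0" "\<And>y. dist y x0 < d2 \<Longrightarrow> dist (c y) (c x0) < e / (B + 1)"
      using c e B(1) unfolding continuous_at_eps_delta by (metis add_pos_pos divide_pos_pos zero_less_one)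
    show "\<exists>d>0. \<forall>y. norm (y - x0) < d \<longrightarrow>
       norm (\<rho> y *\<^sub>R (c y - c x0) - \<rho> x0 *\<^sub>R (c x0 - c x0) - 0) \<le> e * norm (y - x0)"
    proof (intro exI conjI allI impI)
      show "min d1 d2 > 0" using d1 d2 by simp
      fix y assume y: "norm (y - x0) < min d1 d2"
      have "norm (\<rho> y) \<le> norm (y - x0) + norm (\<rho>' (y - x0))"
        using d1(2)[of y] y \<rho>(2) norm_triangle_sub[of "\<rho> y" "\<rho>' (y - x0)"] by simp
      also have "\<dots> \<le> norm (y - x0) * (B + 1)" using B(2)[of "y - x0"] by (simp add: algebra_simps)
      finally have 1: "\<bar>\<rho> y\<bar> \<le> norm (y - x0) * (B + 1)" by simp
      have 2: "norm (c y - c x0) \<le> e / (B + 1)" using d2(2)[of y] y by (simp add: dist_norm)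
      have "\<bar>\<rho> y\<bar> * norm (c y - c x0) \<le> (norm (y - x0) * (B + 1)) * (e / (B + 1))"
        using 1 2 B(1) by (intro mult_mono) auto
      then show "norm (\<rho> y *\<^sub>R (c y - c x0) - \<rho> x0 *\<^sub>R (c x0 - c x0) - 0) \<le> e * norm (y - x0)"
        using B(1) by (simp add: mult.commute)
    qed
  qed
  then have "((\<lambda>x. \<rho> x *\<^sub>R c x0 + \<rho> x *\<^sub>R (c x - c x0)) has_derivative (\<lambda>h. \<rho>' h *\<^sub>R c x0 + 0)) (at x0)"
    by (intro has_derivative_add has_derivative_scaleR_left \<rho>(1))
  then show ?thesis by (simp add: scaleR_diff_right)
qed

text \<open>
  The identity \<open>B x - B y = B x (A y - A x) B y\<close> for \<open>B = A\<^sup>-\<^sup>1\<close> transfers continuity and Lipschitz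
  continuity from \<open>A\<close> to \<open>B\<close>.  It also gives \<open>DB[h] = - B (DA[h]) B\<close>, whose right-hand side has one order
  less, and so carries the induction on the order.
\<close>

lemma regular_on_inverse_family:
  fixes A :: "'a::euclidean_space \<Rightarrow> 'b::euclidean_space \<Rightarrow> 'b"
  assumes S: "open S" and lin: "\<And>x. x \<in> S \<Longrightarrow> bounded_linear (A x)"
    and bij: "\<And>x. x \<in> S \<Longrightarrow> bij (A x)" and reg: "\<And>v. regular_on l k S (\<lambda>x. A x v)"
  shows "regular_on l k S (\<lambda>x. inv (A x) v)"
proof -
  define B where "B = (\<lambda>x. inv (A x))"
  have cont: "continuous_on S (\<lambda>x. A x v)" for v by (rule regular_on_imp_continuous_on[OF reg])
  have AB: "A x (B x v) = v" if "x \<in> S" for x v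
    using bij[OF that] by (simp add: B_def bij_is_surj surj_f_inv_f)
  have BA: "B x (A x v) = v" if "x \<in> S" for x v
    using bij[OF that] by (simp add: B_def bij_is_inj inv_f_f)
  have linB: "bounded_linear (B x)" if "x \<in> S" for x
    unfolding B_def using inj_linear_imp_inv_bounded_linear[OF lin[OF that]] bij[OF that] bij_is_inj by blast
  have below: "\<exists>c e. c > 0 \<and> e > 0 \<and> (\<forall>x\<in>S \<inter> cball x0 e. \<forall>u. norm (B x u) \<le> norm u / c)" if x0: "x0 \<in> S" for x0
  proof -
    obtain c e where c: "c > 0" "e > 0" "\<And>x u. x \<in> S \<inter> cball x0 e \<Longrightarrow> c * norm u \<le> norm (A x u)"
      by (rule invertible_family_bounded_below[of S A x0, OF lin bij_is_inj[OF bij] _ cont])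
         (use x0 in auto)
    have "norm (B x u) \<le> norm u / c" if "x \<in> S \<inter> cball x0 e" for x u
      using c(3)[OF that, of "B x u"] c(1) AB[of x u] that by (simp add: field_simps)
    then show ?thesis using c by blast
  qed
  have res: "B x v - B y v = B x (A y (B y v) - A x (B y v))" if "x \<in> S" "y \<in> S" for x y v
    using linear_diff[OF bounded_linear.linear[OF linB[OF that(1)]]] BA AB that by simp
  have contB: "continuous_on S (\<lambda>x. B x v)" for v
    unfolding continuous_on_def
  proof
    fix x0 assume x0: "x0 \<in> S"
    obtain c e where c: "c > 0" "e > 0" "\<forall>x\<in>S \<inter> cball x0 e. \<forall>u. norm (B x u) \<le> norm u / c"
      using below[OF x0] by blast
    have "((\<lambda>x. A x (B x0 v)) \<longlongrightarrow> A x0 (B x0 v)) (at x0 within S)"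
      using cont[of "B x0 v"] x0 by (simp add: continuous_on_def)
    then have lim: "((\<lambda>x. norm (A x0 (B x0 v) - A x (B x0 v)) / c) \<longlongrightarrow> 0) (at x0 within S)"
      using c(1) by (auto intro!: tendsto_eq_intros)
    have "\<forall>\<^sub>F x in at x0 within S. norm (B x v - B x0 v) \<le> norm (A x0 (B x0 v) - A x (B x0 v)) / c"
      unfolding eventually_at using c x0 res
      by (intro exI[of _ e]) (auto simp: dist_commute)
    then have "((\<lambda>x. B x v - B x0 v) \<longlongrightarrow> 0) (at x0 within S)"
      by (rule Lim_null_comparison[OF _ lim])
    then show "((\<lambda>x. B x v) \<longlongrightarrow> B x0 v) (at x0 within S)" using Lim_null by blast
  qed
  have "regular_on l k S (\<lambda>x. B x v)"
    using reg
  proof (induction k arbitrary: v)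
    case 0
    show ?case
    proof (cases l)
      case False
      then show ?thesis using contB by (simp add: regular_on_0)
    next
      case True
      have "locally_lipschitz S (\<lambda>x. B x v)"
        unfolding locally_lipschitz_def
      proof
        fix x0 assume x0: "x0 \<in> S"
        obtain c e where c: "c > 0" "e > 0" "\<forall>x\<in>S \<inter> cball x0 e. \<forall>u. norm (B x u) \<le> norm u / c"
          using below[OF x0] by blast
        have "\<exists>e L. e > 0 \<and> L-lipschitz_on (S \<inter> cball x0 e) (\<lambda>x. A x i)" for i
          using 0 True x0 by (auto simp: regular_on_0 locally_lipschitz_def)
        then obtain d L where dL: "\<And>i. d i > 0" "\<And>i. (L i)-lipschitz_on (S \<inter> cball x0 (d i)) (\<lambda>x. A x i)"
          by metis
        have L0: "L i \<ge> 0" for i using dL(2) lipschitz_on_nonneg by blast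
        define r where "r = Min (insert e (d ` Basis))"
        define LL where "LL = (\<Sum>i\<in>Basis. L i)"
        have r: "r > 0" "r \<le> e" "\<And>i. i \<in> Basis \<Longrightarrow> r \<le> d i"
          using c dL unfolding r_def by (auto simp del: Min_insert simp: Min_gr_iff intro!: Min_le)
        have LL: "LL \<ge> 0" "\<And>i. i \<in> Basis \<Longrightarrow> L i \<le> LL"
          unfolding LL_def using L0 by (auto intro: sum_nonneg member_le_sum)
        define C where "C = real DIM('b) * LL * norm v / (c * c)"
        have "C-lipschitz_on (S \<inter> cball x0 r) (\<lambda>x. B x v)"
        proof (rule lipschitz_onI)
          show "0 \<le> C" using LL c by (simp add: C_def)
          fix x y assume x: "x \<in> S \<inter> cball x0 r" and y: "y \<in> S \<inter> cball x0 r"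
          let ?w = "B y v"
          have "norm (A y ?w - A x ?w) \<le> (real DIM('b) * (LL * dist x y)) * norm ?w"
          proof (rule norm_le_basis_bound[of "\<lambda>w. A y w - A x w"])
            show "bounded_linear (\<lambda>w. A y w - A x w)" using lin x y by (auto intro: bounded_linear_sub)
            fix i :: 'b assume i: "i \<in> Basis"
            have "dist (A y i) (A x i) \<le> L i * dist y x"
              by (rule lipschitz_onD[OF dL(2)]) (use x y r(3)[OF i] in auto)
            also have "\<dots> \<le> LL * dist x y" using LL(2)[OF i] by (simp add: dist_commute mult_right_mono)
            finally show "norm (A y i - A x i) \<le> LL * dist x y" by (simp add: dist_norm)
          qed
          also have "\<dots> \<le> (real DIM('b) * (LL * dist x y)) * (norm v / c)"
            using c(3) y r(2) LL by (intro mult_left_mono) auto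
          finally have "norm (A y ?w - A x ?w) / c \<le> C * dist x y"
            using c(1) by (simp add: C_def field_simps)
          moreover have "norm (B x v - B y v) \<le> norm (A y ?w - A x ?w) / c"
            using c(3) x y r(2) res by auto
          ultimately show "dist (B x v) (B y v) \<le> C * dist x y" by (simp add: dist_norm)
        qed
        then show "\<exists>e>0. \<exists>L. L-lipschitz_on (S \<inter> cball x0 e) (\<lambda>x. B x v)" using r by blast
      qed
      then show ?thesis using True by (simp add: regular_on_0)
    qed
  next
    case (Suc k)
    define D where "D = (\<lambda>x h w. \<Sum>i\<in>Basis. (w \<bullet> i) *\<^sub>R frechet_derivative (\<lambda>x. A x i) (at x) h)"
    have dA: "((\<lambda>x. A x w) has_derivative (\<lambda>h. D x h w)) (at x)" if x: "x \<in> S" for x w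
    proof -
      have "((\<lambda>x. \<Sum>i\<in>Basis. (w \<bullet> i) *\<^sub>R A x i) has_derivative (\<lambda>h. D x h w)) (at x)"
        unfolding D_def using regular_on_SucD(1)[OF Suc.prems x]
        by (intro has_derivative_sum has_derivative_scaleR_right)
      then show ?thesis
        by (rule has_derivative_transform_within_open[OF _ S x])
           (simp add: bounded_linear_basis_expansion[OF lin, symmetric])
    qed
    have B: "regular_on l k S (\<lambda>x. B x v)" for v
      by (rule Suc.IH[OF regular_on_lower[OF S Suc.prems]])
    have linD: "bounded_linear (D x h)" for x h
      unfolding D_def by (intro bounded_linear_sum bounded_linear_scaleR_const bounded_linear_inner_left)
    show ?case
    proof (rule regular_on_SucI[OF S])
      show "((\<lambda>x. B x v) has_derivative (\<lambda>h. - B x (D x h (B x v)))) (at x)" if x: "x \<in> S" for x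
      proof -
        \<comment> \<open>\<open>B y v = B x v + B y (r y)\<close> with \<open>r x = 0\<close>, so continuity of \<open>B\<close> suffices to differentiate at \<open>x\<close>.\<close>
        define r where "r = (\<lambda>y. A x (B x v) - A y (B x v))"
        have dr: "((\<lambda>y. r y \<bullet> i) has_derivative (\<lambda>h. (- D x h (B x v)) \<bullet> i)) (at x)" for i
          unfolding r_def using dA[OF x, of "B x v"]
          by (auto intro!: derivative_eq_intros)
        have r0: "r x = 0" by (simp add: r_def)
        have "((\<lambda>y. B x v + (\<Sum>i\<in>Basis. (r y \<bullet> i) *\<^sub>R B y i)) has_derivative
            (\<lambda>h. 0 + (\<Sum>i\<in>Basis. ((- D x h (B x v)) \<bullet> i) *\<^sub>R B x i))) (at x)"
          by (intro has_derivative_add has_derivative_const has_derivative_sum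
               has_derivative_scaleR_at_zero[OF dr])
             (use r0 contB S x in \<open>auto simp: continuous_on_eq_continuous_at\<close>)
        moreover have "(\<Sum>i\<in>Basis. ((- D x h (B x v)) \<bullet> i) *\<^sub>R B x i) = - B x (D x h (B x v))" for h
          using bounded_linear_basis_expansion[OF linB[OF x], of "- D x h (B x v)"]
            linear_neg[OF bounded_linear.linear[OF linB[OF x]]] by simp
        ultimately have "((\<lambda>y. B x v + (\<Sum>i\<in>Basis. (r y \<bullet> i) *\<^sub>R B y i)) has_derivative
            (\<lambda>h. - B x (D x h (B x v)))) (at x)" by simp
        then show ?thesis
        proof (rule has_derivative_transform_within_open[OF _ S x])
          fix y assume y: "y \<in> S"
          have "(\<Sum>i\<in>Basis. (r y \<bullet> i) *\<^sub>R B y i) = B y v - B x v"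
            using res[OF y x, of v] bounded_linear_basis_expansion[OF linB[OF y], of "r y"]
            by (simp add: r_def)
          then show "B x v + (\<Sum>i\<in>Basis. (r y \<bullet> i) *\<^sub>R B y i) = B y v" by simp
        qed
      qed
      have "regular_on l k S (\<lambda>x. B x (D x h (B x v)))" for h
      proof (rule regular_on_apply[OF S linB B], assumption)
        show "regular_on l k S (\<lambda>x. D x h (B x v))"
        proof (rule regular_on_apply[OF S linD _ B])
          show "regular_on l k S (\<lambda>x. D x h w)" for w unfolding D_def
            by (intro regular_on_sum[OF S] regular_on_bounded_linear_compose[OF S bounded_linear_scaleR_right]
                regular_on_SucD(2)[OF Suc.prems]) simp
        qed
      qed
      then show "regular_on l k S (\<lambda>x. - B x (D x h (B x v)))" for h
        by (rule regular_on_bounded_linear_compose[OF S bounded_linear_minus[OF bounded_linear_ident]])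
    qed
  qed
  then show ?thesis by (simp add: B_def)
qed

text \<open>
  The inverse function theorem provides a differentiable inverse with derivative
  \<open>(DH \<circ> G)\<^sup>-\<^sup>1\<close>.  If \<open>G\<close> has order \<open>j\<close>, then so has this derivative, hence \<open>G\<close> has order \<open>j + 1\<close>:
  regularity is bootstrapped up to that of \<open>H\<close>.
\<close>

lemma regular_on_inverse_function:
  fixes H :: "'a::euclidean_space \<Rightarrow> 'a"
  assumes S: "open S" and x0: "x0 \<in> S" and reg: "regular_on l (Suc k) S H"
    and inj: "inj (frechet_derivative H (at x0))"
  obtains U V G where "open U" "U \<subseteq> S" "x0 \<in> U" "open V" "H x0 \<in> V" "homeomorphism U V H G"
    "regular_on l (Suc k) V G" 
    "\<And>y. y \<in> V \<Longrightarrow> (G has_derivative inv (frechet_derivative H (at (G y)))) (at y)"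
proof -
  define f' where "f' = (\<lambda>x. Blinfun (frechet_derivative H (at x)))"
  note dH = regular_on_SucD(1)[OF reg]
  have f': "blinfun_apply (f' x) = frechet_derivative H (at x)" if "x \<in> S" for x
    unfolding f'_def by (rule bounded_linear_Blinfun_apply[OF has_derivative_bounded_linear[OF dH[OF that]]])
  have cont: "continuous_on S f'"
    by (rule continuous_on_blinfun_componentwise)
       (simp add: f' cong: continuous_on_cong, rule regular_on_imp_continuous_on[OF regular_on_SucD(2)[OF reg]])
  obtain g where g: "linear g" "g \<circ> frechet_derivative H (at x0) = id"
    using linear_injective_left_inverse[OF bounded_linear.linear[OF has_derivative_bounded_linear[OF dH[OF x0]]] inj]
    by blast
  have "Blinfun g o\<^sub>L f' x0 = id_blinfun"
    by (rule blinfun_eqI) (use g f'[OF x0] in \<open>simp add: bounded_linear_Blinfun_apply linear_linear o_def fun_eq_iff\<close>)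
  from inverse_function_theorem[OF S _ cont x0 this, of H]
  obtain U V G G' where *: "open U" "U \<subseteq> S" "x0 \<in> U" "open V" "H x0 \<in> V" "homeomorphism U V H G"
    and G: "\<And>y. y \<in> V \<Longrightarrow> (G has_derivative (G' y)) (at y)"
      "\<And>y. y \<in> V \<Longrightarrow> G' y = inv (blinfun_apply (f'(G y)))"
      "\<And>y. y \<in> V \<Longrightarrow> bij (blinfun_apply (f'(G y)))"
    using dH f' by (metis (no_types, lifting))
  have GV: "G ` V \<subseteq> S" using * by (auto simp: homeomorphism_def)
  have dG: "(G has_derivative inv (frechet_derivative H (at (G y)))) (at y)" 
    and bij: "bij (frechet_derivative H (at (G y)))" if "y \<in> V" for y
    using G[OF that] f'[of "G y"] GV that by auto
  have lin: "bounded_linear (frechet_derivative H (at (G y)))" if "y \<in> V" for y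
    using dH GV that by (blast intro: has_derivative_bounded_linear)
  have step: "regular_on m j V (\<lambda>y. inv (frechet_derivative H (at (G y))) v)"
    if "regular_on m j V G" "\<And>w. regular_on m j S (\<lambda>x. frechet_derivative H (at x) w)" for m j v
    by (rule regular_on_inverse_family[OF *(4) lin bij], assumption+)
       (rule regular_on_compose[OF S *(4) GV that(2,1)])
  have DH: "regular_on l k S (\<lambda>x. frechet_derivative H (at x) w)" for w
    by (rule regular_on_SucD(2)[OF reg])
  have "continuous_on V G" using *(6) by (simp add: homeomorphism_def)
  then have cont': "continuous_on V (\<lambda>y. inv (frechet_derivative H (at (G y))) v)" for v
    using step[of False 0 v] regular_on_imp_continuous_on[OF DH] by (simp add: regular_on_0)
  have "regular_on l j V G" if "j \<le> Suc k" for j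
    using that
  proof (induction j)
    case 0
    then show ?case
      using differentiable_imp_locally_lipschitz[OF *(4) dG cont'] \<open>continuous_on V G\<close>
      by (simp add: regular_on_0)
  next
    case (Suc j)
    show ?case
      by (rule regular_on_SucI[OF *(4) dG step], assumption)
         (use Suc regular_on_le[OF S _ DH] in auto)
  qed
  then have "regular_on l (Suc k) V G" by blast
  then show thesis using that * dG by blast
qed

section \<open>Submanifolds: tangent spaces and nearest points\<close>

lemma closest_point_subspace:
  fixes S :: "'a::euclidean_space set"
  assumes S: "subspace S"
  shows closest_point_subspace_in: "closest_point S x \<in> S"
    and closest_point_subspace_orthogonal: "w \<in> S \<Longrightarrow> (x - closest_point S x) \<bullet> w = 0"
    and closest_point_subspace_unique:
      "y \<in> S \<Longrightarrow> (\<And>w. w \<in> S \<Longrightarrow> (x - y) \<bullet> w = 0) \<Longrightarrow> closest_point S x = y"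
proof -
  have ne: "S \<noteq> {}" using subspace_0[OF S] by blast
  have 1: "closest_point S x \<in> S" for x
    by (rule closest_point_in_set[OF closed_subspace[OF S] ne])
  have 2: "(x - closest_point S x) \<bullet> w = 0" if "w \<in> S" for w x
  proof -
    note d = closest_point_dot[OF subspace_imp_convex[OF S] closed_subspace[OF S], of _ x]
    have "(x - closest_point S x) \<bullet> (closest_point S x + w - closest_point S x) \<le> 0"
      by (rule d) (use 1 that subspace_add[OF S] in blast)
    moreover have "(x - closest_point S x) \<bullet> (closest_point S x - w - closest_point S x) \<le> 0"
      by (rule d) (use 1 that subspace_diff[OF S] in blast)
    ultimately show ?thesis by (simp add: inner_diff_right)
  qed
  show "closest_point S x \<in> S" by (rule 1)
  show "w \<in> S \<Longrightarrow> (x - closest_point S x) \<bullet> w = 0" by (rule 2)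
  assume y: "y \<in> S" "\<And>w. w \<in> S \<Longrightarrow> (x - y) \<bullet> w = 0"
  let ?z = "closest_point S x"
  have "(?z - y) \<bullet> (?z - y) = (x - y) \<bullet> (?z - y) - (x - ?z) \<bullet> (?z - y)"
    by (simp add: inner_diff_left)
  also have "\<dots> = 0" using y 2[of "?z - y" x] 1[of x] subspace_diff[OF S] by simp
  finally show "closest_point S x = y" by simp
qed

lemma linear_closest_point_subspace:
  fixes S :: "'a::euclidean_space set"
  assumes S: "subspace S"
  shows "linear (closest_point S)"
proof (rule linearI)
  note p = closest_point_subspace_in[OF S] closest_point_subspace_orthogonal[OF S]
  show "closest_point S (x + y) = closest_point S x + closest_point S y" for x y
  proof (rule closest_point_subspace_unique[OF S subspace_add[OF S p(1) p(1)]])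
    fix w assume "w \<in> S"
    from p(2)[OF this, of x] p(2)[OF this, of y]
    show "(x + y - (closest_point S x + closest_point S y)) \<bullet> w = 0"
      by (simp add: inner_diff_left inner_add_left)
  qed
  show "closest_point S (r *\<^sub>R x) = r *\<^sub>R closest_point S x" for r x
  proof (rule closest_point_subspace_unique[OF S subspace_scale[OF S p(1)]])
    fix w assume "w \<in> S"
    from p(2)[OF this, of x] show "(r *\<^sub>R x - r *\<^sub>R closest_point S x) \<bullet> w = 0"
      by (simp add: inner_diff_left)
  qed
qed

lemma adjoint_basis_expansion:
  fixes f :: "'a::euclidean_space \<Rightarrow> 'b::euclidean_space"
  assumes "linear f"
  shows "adjoint f v = (\<Sum>i\<in>Basis. (f i \<bullet> v) *\<^sub>R i)"
  using euclidean_representation[of "adjoint f v"] adjoint_clauses(2)[OF assms]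
  by (simp add: inner_commute)

text \<open>
  Along a curve in \<open>M\<close> through the nearest point \<open>z\<close>, the squared distance to \<open>x\<close> has a local minimum
  at \<open>z\<close>, so its derivative vanishes.
\<close>

lemma nearest_point_orthogonal_tangent:
  fixes M :: "'a::euclidean_space set"
  assumes near: "\<forall>w\<in>M. dist x z \<le> dist x w" and \<tau>: "\<tau> \<in> tangent_space M z"
  shows "(x - z) \<bullet> \<tau> = 0"
proof -
  obtain c :: "real \<Rightarrow> 'a" and e where c: "e > 0" "c ` {-e<..<e} \<subseteq> M" "c 0 = z"
    "(c has_vector_derivative \<tau>) (at 0)"
    using \<tau> unfolding tangent_space_def by blast
  let ?f = "\<lambda>t. (x - c t) \<bullet> (x - c t)"
  have "(?f has_derivative (\<lambda>h. (x - c 0) \<bullet> - (h *\<^sub>R \<tau>) + - (h *\<^sub>R \<tau>) \<bullet> (x - c 0))) (at 0)"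
    using c(4) unfolding has_vector_derivative_def
    by (auto intro!: derivative_eq_intros)
  then have "(?f has_real_derivative - 2 * ((x - z) \<bullet> \<tau>)) (at 0)"
    unfolding has_field_derivative_def c(3)
    by (rule has_derivative_eq_rhs) (auto simp: fun_eq_iff inner_commute)
  moreover have "\<forall>t. \<bar>0 - t\<bar> < e \<longrightarrow> ?f 0 \<le> ?f t"
  proof (intro allI impI)
    fix t assume "\<bar>0 - t\<bar> < e"
    then have "t \<in> {-e<..<e}" by (auto simp: abs_less_iff)
    then have "dist x z \<le> dist x (c t)" using near c(2) by blast
    then show "?f 0 \<le> ?f t"
      unfolding power2_norm_eq_inner[symmetric] dist_norm c(3) by (simp add: power_mono)
  qed
  ultimately have "- 2 * ((x - z) \<bullet> \<tau>) = 0" using DERIV_local_min[OF _ c(1)] by blast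
  then show ?thesis by simp
qed

text \<open>
  A local defining function \<open>g\<close> of a submanifold, with values in the subspace \<open>W\<close>.  Maps on \<open>W\<close> are
  extended to the whole space by adding the projection onto the complement of \<open>W\<close>; thus no type
  for \<open>W\<close> is needed.
\<close>

locale defining_function =
  fixes V W :: "'a::euclidean_space set" and g :: "'a \<Rightarrow> 'a" and l :: bool and k :: nat
  assumes open_V: "open V" and subspace_W: "subspace W" and g_in_W: "g ` V \<subseteq> W"
    and regular_g: "regular_on l (Suc k) V g"
    and range_D: "\<And>y. y \<in> V \<Longrightarrow> range (frechet_derivative g (at y)) = W"
begin

abbreviation D :: "'a \<Rightarrow> 'a \<Rightarrow> 'a" where "D y \<equiv> frechet_derivative g (at y)"

text \<open>
  The Gram operator \<open>D D\<^sup>*\<close> on \<open>W\<close>, extended by the identity on the orthogonal complement of \<open>W\<close>.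
  Full rank of \<open>D\<close> makes it invertible.
\<close>

definition gram :: "'a \<Rightarrow> 'a \<Rightarrow> 'a" where
  "gram y v = D y (adjoint (D y) v) + (v - closest_point W v)"

lemma has_derivative_g: "y \<in> V \<Longrightarrow> (g has_derivative D y) (at y)"
  by (rule regular_on_SucD(1)[OF regular_g])

lemma linear_D: "y \<in> V \<Longrightarrow> linear (D y)"
  by (rule bounded_linear.linear[OF has_derivative_bounded_linear[OF has_derivative_g]])

lemma bounded_linear_D: "y \<in> V \<Longrightarrow> bounded_linear (D y)"
  by (rule has_derivative_bounded_linear[OF has_derivative_g])

lemma bounded_linear_adjoint_D: "y \<in> V \<Longrightarrow> bounded_linear (adjoint (D y))"
  using adjoint_linear[OF linear_D] linear_linear by blast

lemma regular_D: "regular_on l k V (\<lambda>y. D y v)"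
  by (rule regular_on_SucD(2)[OF regular_g])

lemma regular_adjoint_D: "regular_on l k V (\<lambda>y. adjoint (D y) v)"
proof -
  have "regular_on l k V (\<lambda>y. \<Sum>i\<in>Basis. (D y i \<bullet> v) *\<^sub>R i)"
    by (intro regular_on_sum regular_on_scaleR regular_on_inner_const regular_D open_V regular_on_const)
       simp
  then show ?thesis
    by (rule regular_on_cong[OF open_V, rotated]) (simp add: adjoint_basis_expansion[OF linear_D])
qed

lemma orthogonal_parts_zero:
  assumes "a \<in> W" "a + (v - closest_point W v) = 0"
  shows "a = 0" "v \<in> W"
proof -
  have "(v - closest_point W v) \<bullet> a = 0"
    by (rule closest_point_subspace_orthogonal[OF subspace_W assms(1)])
  moreover have "a = - (v - closest_point W v)" using assms(2) eq_neg_iff_add_eq_0 by blast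
  ultimately show a: "a = 0" by (metis inner_eq_zero_iff inner_minus_left neg_0_equal_iff_equal)
  have "v = closest_point W v" using assms(2) unfolding a by simp
  then show "v \<in> W" using closest_point_subspace_in[OF subspace_W, of v] by simp
qed

lemma adjoint_D_eq_0:
  assumes y: "y \<in> V" and "v \<in> W" "D y (adjoint (D y) v) = 0"
  shows "v = 0"
proof -
  have "adjoint (D y) v \<bullet> adjoint (D y) v = v \<bullet> D y (adjoint (D y) v)"
    by (rule adjoint_clauses(2)[OF linear_D[OF y]])
  then have 0: "adjoint (D y) v = 0" using assms(3) by simp
  obtain u where "v = D y u" using assms(2) range_D[OF y] by blast
  then have "v \<bullet> v = 0" using adjoint_works[OF linear_D[OF y], of u v] 0 by simp
  then show ?thesis by simp
qed

lemma linear_gram: "y \<in> V \<Longrightarrow> linear (gram y)"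
  unfolding gram_def
  by (intro linear_compose_add linear_compose_sub linear_ident linear_closest_point_subspace
      subspace_W linear_compose[OF adjoint_linear, unfolded o_def] linear_D)

lemma bij_gram:
  assumes y: "y \<in> V"
  shows "bij (gram y)"
proof -
  have "inj (gram y)"
    unfolding linear_injective_0[OF linear_gram[OF y]]
  proof (intro allI impI)
    fix v assume "gram y v = 0"
    then have e: "D y (adjoint (D y) v) + (v - closest_point W v) = 0" by (simp add: gram_def)
    have "D y (adjoint (D y) v) \<in> W" using range_D[OF y] by blast
    from orthogonal_parts_zero[OF this e] adjoint_D_eq_0[OF y] show "v = 0" by blast
  qed
  then show ?thesis
    using linear_injective_imp_surjective[OF linear_gram[OF y]] by (simp add: bij_def)
qed

lemma regular_inv_gram: "regular_on l k V (\<lambda>y. inv (gram y) v)"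
proof (rule regular_on_inverse_family[OF open_V _ bij_gram])
  show "y \<in> V \<Longrightarrow> bounded_linear (gram y)" for y using linear_gram linear_linear by blast
  show "regular_on l k V (\<lambda>y. gram y v)" for v
    unfolding gram_def
    by (intro regular_on_add[OF open_V] regular_on_const regular_on_apply[OF open_V _ regular_D regular_adjoint_D])
       (rule bounded_linear_D)
qed

lemma linear_inv_gram: "y \<in> V \<Longrightarrow> linear (inv (gram y))"
  using bij_gram linear_gram bij_is_inj inj_linear_imp_inv_linear by blast

lemma bounded_linear_inv_gram: "y \<in> V \<Longrightarrow> bounded_linear (inv (gram y))"
  using linear_inv_gram linear_linear by blast

text \<open>
  The normal component of \<open>v\<close> with respect to the kernel of \<open>D\<close> is \<open>D\<^sup>* \<Lambda> v\<close>, with Lagrange multiplier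
  \<open>\<Lambda> v = (D D\<^sup>*)\<^sup>-\<^sup>1 D v\<close> in \<open>W\<close>.
\<close>

lemma multiplier:
  assumes y: "y \<in> V"
  defines "\<Lambda> \<equiv> \<lambda>v. inv (gram y) (D y v)"
  shows multiplier_in: "\<Lambda> v \<in> W"
    and closest_point_kernel: "closest_point {u. D y u = 0} v = v - adjoint (D y) (\<Lambda> v)"
proof -
  have "gram y (\<Lambda> v) = D y v"
    using bij_gram[OF y] by (simp add: \<Lambda>_def bij_is_surj surj_f_inv_f)
  then have e: "D y (adjoint (D y) (\<Lambda> v) - v) + (\<Lambda> v - closest_point W (\<Lambda> v)) = 0"
    by (simp add: gram_def linear_diff[OF linear_D[OF y]] algebra_simps)
  have "D y (adjoint (D y) (\<Lambda> v) - v) \<in> W" using range_D[OF y] by blast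
  note * = orthogonal_parts_zero[OF this e]
  show "\<Lambda> v \<in> W" by (rule *(2))
  show "closest_point {u. D y u = 0} v = v - adjoint (D y) (\<Lambda> v)"
  proof (rule closest_point_subspace_unique[OF linear_subspace_kernel[OF linear_D[OF y]]])
    show "v - adjoint (D y) (\<Lambda> v) \<in> {u. D y u = 0}"
      using *(1) by (simp add: linear_diff[OF linear_D[OF y]])
    fix w assume "w \<in> {u. D y u = 0}"
    then show "(v - (v - adjoint (D y) (\<Lambda> v))) \<bullet> w = 0"
      using adjoint_clauses(2)[OF linear_D[OF y], of "\<Lambda> v" w] by simp
  qed
qed

text \<open>
  The projection onto the tangent space depends regularly on the base point, with one order less
  than the defining function.  All later arguments use the submanifold through this projection.
\<close>

lemma regular_tangent_projection: "regular_on l k V (\<lambda>y. closest_point {u. D y u = 0} v)"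
proof -
  have 1: "regular_on l k V (\<lambda>y. inv (gram y) (D y v))"
    by (rule regular_on_apply[OF open_V _ regular_inv_gram regular_D])
       (rule bounded_linear_inv_gram)
  have "regular_on l k V (\<lambda>y. v - adjoint (D y) (inv (gram y) (D y v)))"
    by (rule regular_on_diff[OF open_V regular_on_const regular_on_apply[OF open_V _ regular_adjoint_D 1]])
       (rule bounded_linear_adjoint_D)
  then show ?thesis
    by (rule regular_on_cong[OF open_V, rotated]) (simp add: closest_point_kernel)
qed

text \<open>
  A point \<open>x\<close> has the foot point \<open>z\<close> and multiplier \<open>v\<close> if and only if \<open>x = z + D\<^sup>* v\<close> and \<open>g z = 0\<close>.  This
  system is \<open>normal_form (z, v) = (x, 0)\<close>; since \<open>g z\<close> lies in \<open>W\<close>, the term \<open>v - P\<^sub>W v\<close> forces \<open>v\<close> into \<open>W\<close> and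
  makes the system square.
\<close>

definition normal_form :: "'a \<times> 'a \<Rightarrow> 'a \<times> 'a" where
  "normal_form = (\<lambda>(z, v). (z + adjoint (D z) v, g z + (v - closest_point W v)))"

lemma regular_fst_comp: "regular_on l j V f \<Longrightarrow> regular_on l j (V \<times> UNIV) (\<lambda>p. f (fst p))"
  by (rule regular_on_compose[OF open_V open_Times[OF open_V open_UNIV] _ _
        regular_on_bounded_linear[OF open_Times[OF open_V open_UNIV] bounded_linear_fst]]) auto

lemma regular_normal_form: "regular_on l k (V \<times> UNIV) normal_form"
proof -
  have o: "open (V \<times> (UNIV :: 'a set))" using open_V by (simp add: open_Times)
  have s: "regular_on l k (V \<times> UNIV) (snd :: 'a \<times> 'a \<Rightarrow> 'a)"
    by (rule regular_on_bounded_linear[OF o bounded_linear_snd])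
  have f: "regular_on l k (V \<times> UNIV) (fst :: 'a \<times> 'a \<Rightarrow> 'a)"
    by (rule regular_on_bounded_linear[OF o bounded_linear_fst])
  have c: "bounded_linear (closest_point W)"
    using linear_closest_point_subspace[OF subspace_W] linear_linear by blast
  have a: "regular_on l k (V \<times> UNIV) (\<lambda>p. adjoint (D (fst p)) (snd p))"
    by (rule regular_on_apply[OF o _ regular_fst_comp[OF regular_adjoint_D] s])
       (auto intro: bounded_linear_adjoint_D)
  show ?thesis unfolding normal_form_def case_prod_beta
    by (intro regular_on_Pair[OF o] regular_on_add[OF o] regular_on_diff[OF o] s f a
        regular_on_bounded_linear_compose[OF o c s] regular_fst_comp regular_on_lower[OF open_V regular_g])
qed

lemma has_derivative_normal_form:
  assumes y: "y \<in> V" and k: "k \<noteq> 0"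
  shows "(normal_form has_derivative
     (\<lambda>(a, b). (a + adjoint (D y) b, D y a + (b - closest_point W b)))) (at (y, 0))"
proof -
  obtain j where j: "k = Suc j" using k not0_implies_Suc by blast
  have "((\<lambda>p. \<Sum>i\<in>Basis. (D (fst p) i \<bullet> snd p) *\<^sub>R i) has_derivative
      (\<lambda>q. \<Sum>i\<in>Basis. (D y i \<bullet> snd q) *\<^sub>R i)) (at (y, 0))"
  proof (intro has_derivative_sum has_derivative_scaleR_left)
    fix i :: 'a
    have "((\<lambda>z. D z i) has_derivative frechet_derivative (\<lambda>z. D z i) (at y)) (at (fst (y, 0::'a)))"
      using regular_on_SucD(1)[OF regular_D[unfolded j] y] by simp
    from has_derivative_compose[OF has_derivative_fst[OF has_derivative_ident] this]
    have "((\<lambda>p. D (fst p) i) has_derivative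
        (\<lambda>q. frechet_derivative (\<lambda>z. D z i) (at y) (fst q))) (at (y, 0::'a))" .
    from has_derivative_inner[OF this has_derivative_snd[OF has_derivative_ident]]
    show "((\<lambda>p. D (fst p) i \<bullet> snd p) has_derivative (\<lambda>q. D y i \<bullet> snd q)) (at (y, 0))" by simp
  qed
  then have "((\<lambda>p. adjoint (D (fst p)) (snd p)) has_derivative (\<lambda>q. adjoint (D y) (snd q))) (at (y, 0))"
    unfolding adjoint_basis_expansion[OF linear_D[OF y], symmetric]
    by (rule has_derivative_transform_within_open[of _ _ _ _ "V \<times> UNIV"])
       (use y open_V in \<open>auto simp: adjoint_basis_expansion[OF linear_D] open_Times\<close>)
  note a = this
  have c: "bounded_linear (closest_point W)"
    using linear_closest_point_subspace[OF subspace_W] linear_linear by blast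
  have "((\<lambda>p. g (fst p)) has_derivative (\<lambda>q. D y (fst q))) (at (y, 0::'a))"
    by (rule has_derivative_compose[OF has_derivative_fst[OF has_derivative_ident]])
       (use has_derivative_g[OF y] in simp)
  then show ?thesis unfolding normal_form_def case_prod_beta
    by (intro has_derivative_Pair has_derivative_add has_derivative_diff a
        bounded_linear.has_derivative[OF c] has_derivative_fst has_derivative_snd has_derivative_ident)
qed

text \<open>
  At \<open>(y, 0)\<close> the derivative of the normal form is injective: its kernel satisfies
  \<open>D D\<^sup>* b = 0\<close>, hence \<open>b = 0\<close>.  The inverse fixes \<open>(v, 0)\<close> to first order for tangent \<open>v\<close>, which provides
  curves with prescribed velocity.
\<close>

lemma normal_form_local_inverse:
  assumes y: "y \<in> V" and k: "k \<noteq> 0"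
  obtains U X G where "open U" "U \<subseteq> V \<times> UNIV" "(y, 0) \<in> U" "open X" "(y, g y) \<in> X"
    "homeomorphism U X normal_form G" "regular_on l k X G"
    "\<And>v. D y v = 0 \<Longrightarrow> \<exists>G'. (G has_derivative G') (at (y, g y)) \<and> G' (v, 0) = (v, 0)"
proof -
  have o: "open (V \<times> (UNIV :: 'a set))" using open_V by (simp add: open_Times)
  let ?L = "\<lambda>(a, b). (a + adjoint (D y) b, D y a + (b - closest_point W b))"
  have L: "frechet_derivative normal_form (at (y, 0)) = ?L"
    using frechet_derivative_at[OF has_derivative_normal_form[OF y k]] by simp
  have linL: "linear ?L"
    using has_derivative_bounded_linear[OF has_derivative_normal_form[OF y k]] bounded_linear.linear by blast
  have inj: "inj ?L"
    unfolding linear_injective_0[OF linL]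
  proof (intro allI impI)
    fix p assume p: "?L p = 0"
    obtain a b where ab: "p = (a, b)" by fastforce
    have 1: "a + adjoint (D y) b = 0" and 2: "D y a + (b - closest_point W b) = 0"
      using p unfolding ab by (auto simp: zero_prod_def)
    have "D y a \<in> W" using range_D[OF y] by blast
    note * = orthogonal_parts_zero[OF this 2]
    have "D y (adjoint (D y) b) = D y (a + adjoint (D y) b)"
      using *(1) by (simp add: linear_add[OF linear_D[OF y]])
    also have "\<dots> = 0" unfolding 1 by (rule linear_0[OF linear_D[OF y]])
    finally have "b = 0" by (rule adjoint_D_eq_0[OF y *(2)])
    then show "p = 0" using 1 ab linear_0[OF adjoint_linear[OF linear_D[OF y]]] by (simp add: zero_prod_def)
  qed
  obtain j where j: "k = Suc j" using k not0_implies_Suc by blast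
  have y0: "(y, 0) \<in> V \<times> UNIV" using y by simp
  have nf: "normal_form (y, 0) = (y, g y)"
    using linear_0[OF adjoint_linear[OF linear_D[OF y]]]
      linear_0[OF linear_closest_point_subspace[OF subspace_W]] by (simp add: normal_form_def)
  obtain U X G where *: "open U" "U \<subseteq> V \<times> UNIV" "(y, 0) \<in> U" "open X" "normal_form (y, 0) \<in> X"
    "homeomorphism U X normal_form G" "regular_on l (Suc j) X G"
    "\<And>p. p \<in> X \<Longrightarrow> (G has_derivative inv (frechet_derivative normal_form (at (G p)))) (at p)"
    by (rule regular_on_inverse_function[OF o y0 regular_normal_form[unfolded j]])
       (use inj L in auto)
  have G0: "G (y, g y) = (y, 0)" using homeomorphism_apply1[OF *(6,3)] nf by simp
  have "\<exists>G'. (G has_derivative G') (at (y, g y)) \<and> G' (v, 0) = (v, 0)" if v: "D y v = 0" for v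
  proof -
    have "?L (v, 0) = (v, 0)"
      using v linear_0[OF adjoint_linear[OF linear_D[OF y]]]
        linear_0[OF linear_closest_point_subspace[OF subspace_W]] by simp
    then have "inv ?L (v, 0) = (v, 0)" using inv_f_f[OF inj, of "(v, 0)"] by simp
    then show ?thesis using *(8)[OF *(5)] unfolding nf G0 L by blast
  qed
  then show thesis using that *(1-7) unfolding nf j[symmetric] by blast
qed

lemma normal_form_zero_snd:
  assumes "normal_form (z, v) = (x, 0)" "z \<in> V"
  shows "g z = 0"
proof (rule orthogonal_parts_zero(1))
  show "g z \<in> W" using g_in_W assms(2) by blast
  show "g z + (v - closest_point W v) = 0" using assms(1) by (simp add: normal_form_def)
qed

text \<open>
  The definition of the tangent space by curves gives the inclusion into the kernel by
  differentiating \<open>g (c t) = 0\<close>.  Conversely, the foot point of \<open>y + t v\<close> under the inverse of the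
  normal form is a curve in \<open>M\<close> with velocity \<open>v\<close>.
\<close>

lemma tangent_space_eq_kernel:
  assumes M: "M \<inter> V = {z \<in> V. g z = 0}" and y: "y \<in> M" "y \<in> V" and k: "k \<noteq> 0"
  shows "tangent_space M y = {u. D y u = 0}"
proof (intro set_eqI iffI)
  fix v assume "v \<in> tangent_space M y"
  then obtain c :: "real \<Rightarrow> 'a" and e where c: "e > 0" "c ` {-e<..<e} \<subseteq> M" "c 0 = y"
    "(c has_vector_derivative v) (at 0)"
    unfolding tangent_space_def by blast
  have "(g has_derivative D y) (at (c 0))" using has_derivative_g[OF y(2)] c(3) by simp
  from has_derivative_compose[OF c(4)[unfolded has_vector_derivative_def] this]
  have d: "((\<lambda>t. g (c t)) has_derivative (\<lambda>h. D y (h *\<^sub>R v))) (at 0)" .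
  have "isCont c 0" using c(4) has_vector_derivative_continuous by blast
  then have "\<forall>\<^sub>F t in nhds 0. c t \<in> V"
    using open_V y(2) c(3) unfolding isCont_def tendsto_at_iff_tendsto_nhds
    by (auto elim!: topological_tendstoD)
  moreover have "\<forall>\<^sub>F t in nhds 0. t \<in> {-e<..<e}"
    using c(1) by (intro eventually_nhds_in_open) auto
  ultimately have "\<forall>\<^sub>F t in nhds 0. g (c t) = 0"
    by eventually_elim (use M c(2) in blast)
  then obtain S where S: "open S" "0 \<in> S" "\<And>t. t \<in> S \<Longrightarrow> g (c t) = 0"
    unfolding eventually_nhds by blast
  have "((\<lambda>t. 0) has_derivative (\<lambda>h. D y (h *\<^sub>R v))) (at 0)"
    by (rule has_derivative_transform_within_open[OF d S(1,2)]) (use S(3) in auto)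
  then have "(\<lambda>h::real. D y (h *\<^sub>R v)) = (\<lambda>h. 0)"
    using has_derivative_unique[OF _ has_derivative_const] by blast
  from fun_cong[OF this, of 1] show "v \<in> {u. D y u = 0}" by simp
next
  fix v assume v: "v \<in> {u. D y u = 0}"
  obtain U X G where *: "open U" "U \<subseteq> V \<times> UNIV" "(y, 0) \<in> U" "open X" "(y, g y) \<in> X"
    "homeomorphism U X normal_form G" "regular_on l k X G"
    "\<And>v. D y v = 0 \<Longrightarrow> \<exists>G'. (G has_derivative G') (at (y, g y)) \<and> G' (v, 0) = (v, 0)"
    using normal_form_local_inverse[OF y(2) k] by metis
  have gy: "g y = 0" using M y by blast
  have nf0: "normal_form (y, 0) = (y, 0)"
    using linear_0[OF adjoint_linear[OF linear_D[OF y(2)]]] gy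
      linear_0[OF linear_closest_point_subspace[OF subspace_W]] by (simp add: normal_form_def)
  have G0: "G (y, 0) = (y, 0)" using homeomorphism_apply1[OF *(6,3)] nf0 by simp
  define a where "a = (\<lambda>t::real. (y + t *\<^sub>R v, 0 :: 'a))"
  define c where "c = (\<lambda>t. fst (G (a t)))"
  have ca: "continuous_on UNIV a" unfolding a_def by (intro continuous_intros)
  have "open (a -` X)" by (rule continuous_open_vimage) (use ca *(4) in \<open>auto simp: continuous_on_eq_continuous_at\<close>)
  moreover have "0 \<in> a -` X" using *(5) gy by (simp add: a_def)
  ultimately obtain e where e: "e > 0" "ball 0 e \<subseteq> a -` X" using open_contains_ball by blast
  have eX: "a t \<in> X" if "t \<in> {-e<..<e}" for t using that subsetD[OF e(2), of t] by (auto simp: dist_real_def)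
  have "c t \<in> M" if t: "t \<in> {-e<..<e}" for t
  proof -
    have nf: "normal_form (G (a t)) = a t" using homeomorphism_apply2[OF *(6) eX[OF t]] .
    have "G (a t) \<in> U" using *(6) eX[OF t] by (auto simp: homeomorphism_def)
    then have "fst (G (a t)) \<in> V" using *(2) by (metis mem_Times_iff subsetD)
    moreover have "g (fst (G (a t))) = 0"
      by (rule normal_form_zero_snd[of _ "snd (G (a t))" "y + t *\<^sub>R v"]) (use nf calculation in \<open>auto simp: a_def\<close>)
    ultimately show ?thesis using M by (auto simp: c_def)
  qed
  moreover have "Ck_on 1 {-e<..<e} c"
  proof -
    have o: "open {-e<..<e}" by simp
    have "regular_on l k {-e<..<e} a"
      unfolding a_def
      by (intro regular_on_Pair[OF o] regular_on_const regular_on_add[OF o]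
          regular_on_bounded_linear[OF o] bounded_linear_scaleR_left)
    then have "regular_on l k {-e<..<e} (\<lambda>t. G (a t))"
      using regular_on_compose[OF *(4) o _ *(7), of a] eX by blast
    then have "regular_on l k {-e<..<e} c" unfolding c_def
      by (rule regular_on_bounded_linear_compose[OF o bounded_linear_fst])
    then have "regular_on l 1 {-e<..<e} c" by (rule regular_on_le[OF o, rotated]) (use k in simp)
    then have "regular_on False 1 {-e<..<e} c" 
      using regular_on_forget_lipschitz[OF o] by (cases l) auto
    then show ?thesis by (simp add: regular_on_def)
  qed
  moreover have "c 0 = y" using G0 by (simp add: c_def a_def)
  moreover have "(c has_vector_derivative v) (at 0)"
  proof -
    obtain G' where G': "(G has_derivative G') (at (y, g y))" "G' (v, 0) = (v, 0)" using *(8) v by blast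
    have "(a has_derivative (\<lambda>h. (h *\<^sub>R v, 0))) (at 0)"
      unfolding a_def by (auto intro!: derivative_eq_intros)
    from has_derivative_compose[OF this, of G G'] G'(1) gy
    have "((\<lambda>t. G (a t)) has_derivative (\<lambda>h. G' (h *\<^sub>R v, 0))) (at 0)" by (simp add: a_def)
    from has_derivative_fst[OF this]
    have "(c has_derivative (\<lambda>h. fst (G' (h *\<^sub>R v, 0)))) (at 0)" by (simp add: c_def)
    moreover have "G' (h *\<^sub>R v, 0) = (h *\<^sub>R v, 0)" for h
      using linear_scale[OF bounded_linear.linear[OF has_derivative_bounded_linear[OF G'(1)]], of h "(v, 0)"] G'(2)
      by simp
    ultimately show ?thesis by (simp add: has_vector_derivative_def)
  qed
  ultimately show "v \<in> tangent_space M y" unfolding tangent_space_def using e(1) by blast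
qed

text \<open>
  Nearest points near \<open>y\<close> solve the normal-form system with a small multiplier, so they coincide
  with the first component of its smooth local inverse.  The map \<open>P\<close> is arbitrary: any selection of
  nearest points is regular, on every open set on which nearest points exist.
\<close>

lemma regular_nearest_point:
  assumes M: "M \<inter> V = {z \<in> V. g z = 0}" and y: "y \<in> M" "y \<in> V" and k: "k \<noteq> 0"
  obtains \<epsilon> where "\<epsilon> > 0"
    "\<And>S P. \<lbrakk>open S; S \<subseteq> ball y \<epsilon>; \<And>x. x \<in> S \<Longrightarrow> P x \<in> M \<and> (\<forall>w\<in>M. dist x (P x) \<le> dist x w)\<rbrakk>
       \<Longrightarrow> regular_on l k S P"
proof -
  obtain U X G where *: "open U" "U \<subseteq> V \<times> UNIV" "(y, 0) \<in> U" "open X" "(y, g y) \<in> X"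
    "homeomorphism U X normal_form G" "regular_on l k X G"
    using normal_form_local_inverse[OF y(2) k] by metis
  have o: "open (V \<times> (UNIV :: 'a set))" using open_V by (simp add: open_Times)
  \<comment> \<open>\<open>m (z, x)\<close> pairs \<open>z\<close> with the multiplier of \<open>x - z\<close>.  It is continuous and equals \<open>(y, 0)\<close> at \<open>(y, y)\<close>, so it
    takes values in \<open>U\<close> if both \<open>z\<close> and \<open>x\<close> are close to \<open>y\<close>.\<close>
  define m where "m = (\<lambda>p. (fst p, inv (gram (fst p)) (D (fst p) (snd p - fst p))))"
  have "regular_on l k (V \<times> UNIV) m"
    unfolding m_def
    by (intro regular_on_Pair[OF o] regular_on_bounded_linear[OF o bounded_linear_fst]
        regular_on_apply[OF o _ regular_fst_comp[OF regular_inv_gram]]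
        regular_on_apply[OF o _ regular_fst_comp[OF regular_D]]
        regular_on_bounded_linear[OF o bounded_linear_sub[OF bounded_linear_snd bounded_linear_fst]])
       (auto intro: bounded_linear_D bounded_linear_inv_gram)
  then have cm: "continuous_on (V \<times> UNIV) m" by (rule regular_on_imp_continuous_on)
  have "open (m -` U \<inter> V \<times> UNIV)"
    using continuous_on_open_vimage[OF o] cm *(1) by blast
  moreover have "m (y, y) = (y, 0)"
    using linear_0[OF linear_D[OF y(2)]] linear_0[OF linear_inv_gram[OF y(2)]] by (simp add: m_def)
  then have "(y, y) \<in> m -` U \<inter> V \<times> UNIV" using *(3) y by simp
  ultimately obtain A B where AB: "open A" "open B" "y \<in> A" "y \<in> B" "A \<times> B \<subseteq> m -` U \<inter> V \<times> UNIV"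
    using open_prod_elim by (metis mem_Sigma_iff)
  obtain e1 e2 where e: "e1 > 0" "ball y e1 \<subseteq> A" "e2 > 0" "ball y e2 \<subseteq> B"
    using AB open_contains_ball by metis
  define \<epsilon> where "\<epsilon> = min (e1 / 2) e2"
  have "regular_on l k S P" if S: "open S" "S \<subseteq> ball y \<epsilon>" and
      P: "\<And>x. x \<in> S \<Longrightarrow> P x \<in> M \<and> (\<forall>w\<in>M. dist x (P x) \<le> dist x w)" for S P
  proof -
    have main: "P x = fst (G (x, 0)) \<and> (x, 0) \<in> X" if x: "x \<in> S" for x
    proof -
      let ?z = "P x"
      have near: "?z \<in> M" "\<forall>w\<in>M. dist x ?z \<le> dist x w" using P[OF x] by auto
      have xy: "dist y x < e1 / 2" "dist y x < e2" using S(2) x by (auto simp: \<epsilon>_def)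
      have "dist y ?z \<le> dist y x + dist x ?z" by (rule dist_triangle)
      also have "dist x ?z \<le> dist x y" using near(2) y(1) by blast
      finally have "dist y ?z < e1" using xy by (simp add: dist_commute)
      then have "?z \<in> A" "x \<in> B" using subsetD[OF e(2), of ?z] subsetD[OF e(4), of x] xy by auto
      then have "(?z, x) \<in> m -` U \<inter> V \<times> UNIV" using AB(5) by blast
      then have zV: "?z \<in> V" and mU: "m (?z, x) \<in> U" by auto
      define v where "v = inv (gram ?z) (D ?z (x - ?z))"
      have m: "m (?z, x) = (?z, v)" by (simp add: m_def v_def)
      have ker: "{u. D ?z u = 0} = tangent_space M ?z"
        using tangent_space_eq_kernel[OF M near(1) zV k] by simp
      have "closest_point {u. D ?z u = 0} (x - ?z) = 0"
        by (rule closest_point_subspace_unique[OF linear_subspace_kernel[OF linear_D[OF zV]]])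
           (use nearest_point_orthogonal_tangent[OF near(2)] linear_0[OF linear_D[OF zV]] ker in auto)
      then have "adjoint (D ?z) v = x - ?z"
        using closest_point_kernel[OF zV, of "x - ?z"] by (simp add: v_def)
      moreover have "closest_point W v = v"
        using multiplier_in[OF zV, of "x - ?z"] by (intro closest_point_self) (simp add: v_def)
      moreover have "g ?z = 0" using M near(1) zV by blast
      ultimately have nf: "normal_form (?z, v) = (x, 0)" by (simp add: normal_form_def)
      have "G (x, 0) = (?z, v)" using homeomorphism_apply1[OF *(6), of "(?z, v)"] mU nf m by simp
      moreover have "(x, 0) \<in> X"
        using *(6) mU nf m by (metis homeomorphism_image1 imageI)
      ultimately show ?thesis by simp
    qed
    have "regular_on l k S (\<lambda>x. fst (G (x, 0)))"
      by (rule regular_on_bounded_linear_compose[OF S(1) bounded_linear_fst])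
         (rule regular_on_compose[OF *(4) S(1) _ *(7) regular_on_bounded_linear[OF S(1)
             bounded_linear_Pair[OF bounded_linear_ident bounded_linear_zero]]], use main in auto)
    then show ?thesis
      by (rule regular_on_cong[OF S(1), rotated]) (use main in simp)
  qed
  then show thesis using that[of \<epsilon>] e by (simp add: \<epsilon>_def)
qed

end

section \<open>Smoothness of the Newton step\<close>

text \<open>
  On a set that is not closed, \<^const>\<open>closest_point\<close> need not be a nearest point; the predicate
  guarantees that it is one, without closedness.
\<close>

lemma projection_definedD:
  assumes "projection_defined D x"
  shows "closest_point D x \<in> D" "\<forall>w\<in>D. dist x (closest_point D x) \<le> dist x w"
proof -
  have "closest_point D x \<in> D \<and> (\<forall>w\<in>D. dist x (closest_point D x) \<le> dist x w)"
    unfolding closest_point_def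
    by (rule someI_ex) (use assms in \<open>auto simp: projection_defined_def\<close>)
  then show "closest_point D x \<in> D" "\<forall>w\<in>D. dist x (closest_point D x) \<le> dist x w" by auto
qed

lemma closest_point_eqI_orthogonal:
  fixes D :: "'a::euclidean_space set"
  assumes y: "y \<in> D" and orth: "\<And>w. w \<in> D \<Longrightarrow> (z - y) \<bullet> (w - y) = 0"
  shows "closest_point D z = y"
  unfolding closest_point_def
proof (rule some_equality)
  have pyth: "(norm (z - w))\<^sup>2 = (norm (z - y))\<^sup>2 + (norm (w - y))\<^sup>2" if "w \<in> D" for w
  proof -
    have "z - w = (z - y) - (w - y)" by simp
    then show ?thesis using orth[OF that]
      by (simp add: power2_norm_eq_inner inner_diff_left inner_diff_right inner_commute)
  qed
  show "y \<in> D \<and> (\<forall>w\<in>D. dist z y \<le> dist z w)"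
    unfolding dist_norm
  proof (intro conjI y ballI)
    fix w assume "w \<in> D"
    show "norm (z - y) \<le> norm (z - w)"
      by (rule power2_le_imp_le) (use pyth[OF \<open>w \<in> D\<close>] in simp_all)
  qed
  fix x assume x: "x \<in> D \<and> (\<forall>w\<in>D. dist z x \<le> dist z w)"
  then have "(norm (z - x))\<^sup>2 \<le> (norm (z - y))\<^sup>2"
    using y by (simp add: dist_norm power_mono)
  then have "(norm (x - y))\<^sup>2 \<le> 0" using pyth[of x] x by simp
  then show "x = y" by simp
qed

lemma linear_normal_part:
  fixes T :: "'a::euclidean_space set"
  shows "subspace T \<Longrightarrow> linear (\<lambda>v. v - closest_point T v)"
  by (intro linear_compose_sub linear_ident linear_closest_point_subspace)

text \<open>
  For the orthogonal projection \<open>P\<close> onto \<open>L\<close> and the normal projection \<open>R\<close> of \<open>T\<close>, this is the operator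
  \<open>R P R\<close> on the orthogonal complement of \<open>T\<close>, extended by the identity on \<open>T\<close>.  It is invertible when
  \<open>L + T\<close> is the whole space.
\<close>

definition transverse_gram :: "'a::euclidean_space set \<Rightarrow> 'a set \<Rightarrow> 'a \<Rightarrow> 'a" where
  "transverse_gram L T v =
     (let n = closest_point L (v - closest_point T v) in n - closest_point T n) + closest_point T v"

lemma linear_transverse_gram:
  fixes L T :: "'a::euclidean_space set"
  assumes "subspace L" "subspace T"
  shows "linear (transverse_gram L T)"
proof -
  have "linear (\<lambda>v. (\<lambda>n. n - closest_point T n) (closest_point L ((\<lambda>v. v - closest_point T v) v)) + closest_point T v)"
    using linear_compose[OF linear_compose[OF linear_normal_part[OF assms(2)]
        linear_closest_point_subspace[OF assms(1)]] linear_normal_part[OF assms(2)]]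
    by (intro linear_compose_add linear_closest_point_subspace assms(2)) (simp add: o_def)
  then show ?thesis by (simp add: transverse_gram_def[abs_def] Let_def)
qed

text \<open>
  A vector in the kernel is orthogonal to \<open>T\<close>, and its projection onto \<open>L\<close> vanishes.  Being orthogonal
  to both \<open>L\<close> and \<open>T\<close>, it is zero.
\<close>

lemma inj_transverse_gram:
  fixes L T :: "'a::euclidean_space set"
  assumes L: "subspace L" and T: "subspace T" and trans: "\<And>x. \<exists>u\<in>L. \<exists>v\<in>T. x = u + v"
  shows "inj (transverse_gram L T)"
  unfolding linear_injective_0[OF linear_transverse_gram[OF L T]]
proof (intro allI impI)
  fix v assume v: "transverse_gram L T v = 0"
  define r where "r = v - closest_point T v"
  define n where "n = closest_point L r"
  have e: "(n - closest_point T n) + closest_point T v = 0"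
    using v by (simp add: transverse_gram_def Let_def r_def n_def)
  have "(n - closest_point T n) \<bullet> closest_point T v = 0"
    by (rule closest_point_subspace_orthogonal[OF T closest_point_subspace_in[OF T]])
  moreover have "n - closest_point T n = - closest_point T v" using e eq_neg_iff_add_eq_0 by blast
  ultimately have v0: "closest_point T v = 0" by simp
  then have rv: "r = v" and nT: "n = closest_point T n" using e by (auto simp: r_def)
  have "n \<in> T" using nT closest_point_subspace_in[OF T, of n] by simp
  then have "v \<bullet> n = 0" using closest_point_subspace_orthogonal[OF T, of n v] v0 by simp
  moreover have "n \<bullet> n = v \<bullet> n"
    using closest_point_subspace_orthogonal[OF L closest_point_subspace_in[OF L], of v v]
    by (simp add: n_def rv inner_diff_left)
  ultimately have n0: "n = 0" by simp
  have vL: "v \<bullet> u = 0" if "u \<in> L" for u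
    using closest_point_subspace_orthogonal[OF L that, of v] n0 by (simp add: n_def rv)
  have vT: "v \<bullet> u = 0" if "u \<in> T" for u
    using closest_point_subspace_orthogonal[OF T that, of v] v0 by simp
  obtain a b where "a \<in> L" "b \<in> T" "v = a + b" using trans by blast
  then have "v \<bullet> v = 0" using vL[of a] vT[of b] by (metis add.right_neutral inner_add_right)
  then show "v = 0" by simp
qed

text \<open>
  The Newton step projects \<open>z\<close> onto the intersection of two affine subspaces.  Its first-order
  conditions are a linear system whose multiplier \<open>\<mu>\<close> is obtained by inverting \<open>transverse_gram\<close>; the
  explicit formula is what makes the dependence on \<open>z\<close> and \<open>T\<close> regular.
\<close>

lemma closest_point_affine_section:
  fixes L T :: "'a::euclidean_space set" and a z :: 'a
  assumes L: "subspace L" and T: "subspace T" and bij: "bij (transverse_gram L T)"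
  defines "\<mu> \<equiv> inv (transverse_gram L T)
     (((z - a) - closest_point L (z - a)) - closest_point T ((z - a) - closest_point L (z - a)))"
  shows "closest_point ((\<lambda>v. a + v) ` L \<inter> (\<lambda>v. z + v) ` T) z =
     a + closest_point L (z - a) + closest_point L (\<mu> - closest_point T \<mu>)"
    (is "closest_point ?D z = ?y")
proof (rule closest_point_eqI_orthogonal)
  define q where "q = (z - a) - closest_point L (z - a)"
  define r where "r = \<mu> - closest_point T \<mu>"
  define n where "n = closest_point L r"
  have e: "(n - closest_point T n) + closest_point T \<mu> = q - closest_point T q"
  proof -
    have "transverse_gram L T \<mu> = q - closest_point T q"
      unfolding \<mu>_def q_def using bij by (simp add: bij_is_surj surj_f_inv_f)
    then show ?thesis by (simp add: transverse_gram_def Let_def n_def r_def)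
  qed
  have orT: "(x - closest_point T x) \<bullet> w = 0" if "w \<in> T" for x w
    by (rule closest_point_subspace_orthogonal[OF T that])
  have inT: "closest_point T x \<in> T" for x by (rule closest_point_subspace_in[OF T])
  have "closest_point T \<mu> \<bullet> closest_point T \<mu> = 
      (q - closest_point T q) \<bullet> closest_point T \<mu> - (n - closest_point T n) \<bullet> closest_point T \<mu>"
    unfolding e[symmetric] by (simp add: inner_add_left inner_diff_left)
  also have "\<dots> = 0" using orT[OF inT] by simp
  finally have \<mu>0: "closest_point T \<mu> = 0" by simp
  have "n - q = closest_point T n - closest_point T q" using e \<mu>0 by (simp add: algebra_simps)
  then have nq: "n - q \<in> T" using subspace_diff[OF T inT inT] by metis
  have y: "?y = z + (n - q)" by (simp add: n_def q_def r_def)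
  have yL: "?y = a + (closest_point L (z - a) + n)" by (simp add: n_def r_def)
  show "?y \<in> ?D"
  proof
    show "?y \<in> (\<lambda>v. a + v) ` L" unfolding yL n_def
      by (rule imageI, rule subspace_add[OF L]) (rule closest_point_subspace_in[OF L])+
    show "?y \<in> (\<lambda>v. z + v) ` T" unfolding y using nq by (rule imageI)
  qed
  fix w assume "w \<in> ?D"
  then obtain u v where u: "u \<in> L" "w = a + u" and v: "v \<in> T" "w = z + v" by blast
  have wL: "w - ?y \<in> L"
  proof -
    have "w - ?y = u - (closest_point L (z - a) + n)" unfolding yL u(2) by simp
    moreover have "closest_point L (z - a) + n \<in> L" unfolding n_def
      by (rule subspace_add[OF L]) (rule closest_point_subspace_in[OF L])+
    ultimately show ?thesis using subspace_diff[OF L u(1)] by metis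
  qed
  have wT: "w - ?y \<in> T"
  proof -
    have "w - ?y = v - (n - q)" unfolding y v(2) by simp
    then show ?thesis using subspace_diff[OF T v(1) nq] by simp
  qed
  define d where "d = w - ?y"
  have "z - ?y = q + (r - n) - r" unfolding y by simp
  moreover have "q \<bullet> d = 0"
    unfolding q_def d_def by (rule closest_point_subspace_orthogonal[OF L wL])
  moreover have "(r - n) \<bullet> d = 0"
    unfolding n_def d_def by (rule closest_point_subspace_orthogonal[OF L wL])
  moreover have "r \<bullet> d = 0" unfolding r_def d_def by (rule orT[OF wT])
  ultimately have "(z - ?y) \<bullet> d = 0" by (simp only: inner_add_left inner_diff_left)
  then show "(z - ?y) \<bullet> (w - ?y) = 0" by (simp only: d_def)
qed

text \<open>
  The component of \<open>c t - c 0\<close> orthogonal to \<open>L\<close> is constant along every curve in \<open>M\<close>.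
\<close>

lemma affine_tangent_space_subset:
  fixes M :: "'a::euclidean_space set"
  assumes L: "subspace L" and M: "M = (\<lambda>v. a + v) ` L" and y: "y \<in> M"
  shows "tangent_space M y \<subseteq> L"
proof
  fix v assume "v \<in> tangent_space M y"
  then obtain c :: "real \<Rightarrow> 'a" and e where c: "e > 0" "c ` {-e<..<e} \<subseteq> M" "c 0 = y"
    "(c has_vector_derivative v) (at 0)"
    unfolding tangent_space_def by blast
  define w where "w = v - closest_point L v"
  have w: "u \<bullet> w = 0" if "u \<in> L" for u
    using closest_point_subspace_orthogonal[OF L that, of v] by (simp add: w_def inner_commute)
  have zero: "(c t - c 0) \<bullet> w = 0" if "t \<in> {-e<..<e}" for t
  proof -
    have "c t \<in> M" "c 0 \<in> M" using c(1,2) that by auto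
    then obtain p q where "p \<in> L" "c t = a + p" "q \<in> L" "c 0 = a + q" unfolding M by blast
    then show ?thesis by (simp add: inner_diff_left w)
  qed
  have "((\<lambda>t. (c t - c 0) \<bullet> w) has_derivative (\<lambda>h. (h *\<^sub>R v) \<bullet> w)) (at 0)"
    using c(4) unfolding has_vector_derivative_def by (auto intro!: derivative_eq_intros)
  then have "((\<lambda>t. 0) has_derivative (\<lambda>h. (h *\<^sub>R v) \<bullet> w)) (at (0::real))"
    by (rule has_derivative_transform_within_open[of _ _ _ _ "{-e<..<e}"]) (use c(1) zero in auto)
  then have "(\<lambda>h::real. (h *\<^sub>R v) \<bullet> w) = (\<lambda>h. 0)"
    using has_derivative_unique[OF _ has_derivative_const] by blast
  from fun_cong[OF this, of 1] have "v \<bullet> w = 0" by simp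
  moreover have "closest_point L v \<bullet> w = 0" by (rule w[OF closest_point_subspace_in[OF L]])
  ultimately have "w \<bullet> w = 0" by (metis diff_zero inner_diff_left w_def)
  then show "v \<in> L" using closest_point_subspace_in[OF L, of v] by (simp add: w_def)
qed

text \<open>
  The Newton map is the nearest-point map of \<open>M2\<close> followed by the projection formula
  \<open>closest_point_affine_section\<close> for \<open>L\<close> the direction of \<open>M1\<close> and \<open>T\<close> the tangent space of \<open>M2\<close>.
  Transversality at \<open>xbar\<close> makes the operator in this formula invertible there, hence nearby.
\<close>

lemma regular_newton_slra:
  fixes M1 M2 :: "'a::euclidean_space set"
  assumes k: "k \<noteq> 0" and df: "defining_function V W g l k" and M2: "M2 \<inter> V = {z \<in> V. g z = 0}"
    and M1: "affine M1" and xbar: "xbar \<in> M1" "xbar \<in> M2" "xbar \<in> V"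
    and trans: "transversal_at M1 M2 xbar"
    and r0: "r0 > 0" "\<And>x. x \<in> ball xbar r0 \<Longrightarrow> projection_defined M2 x"
  obtains r where "r > 0" "regular_on l k (ball xbar r) (newton_slra M1 M2)"
proof -
  interpret defining_function V W g l k by fact
  define L where "L = (\<lambda>v. - xbar + v) ` M1"
  have L: "subspace L" unfolding L_def using affine_diffs_subspace[OF M1 xbar(1)] by simp
  have M1L: "M1 = (\<lambda>v. xbar + v) ` L" by (auto simp: L_def image_image)
  define T where "T = (\<lambda>y. {u. D y u = 0})"
  have T: "subspace (T y)" if "y \<in> V" for y
    unfolding T_def by (rule linear_subspace_kernel[OF linear_D[OF that]])
  have TM2: "tangent_space M2 y = T y" if "y \<in> M2" "y \<in> V" for y
    unfolding T_def by (rule tangent_space_eq_kernel[OF M2 that k])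
  have regT: "regular_on l k V (\<lambda>y. closest_point (T y) v)" for v
    unfolding T_def by (rule regular_tangent_projection)
  have blT: "bounded_linear (closest_point (T y))" if "y \<in> V" for y
    using linear_closest_point_subspace[OF T[OF that]] linear_linear by blast
  have blL: "bounded_linear (closest_point L)"
    using linear_closest_point_subspace[OF L] linear_linear by blast
  have regTf: "regular_on l k V (\<lambda>y. f y - closest_point (T y) (f y))"
    if "regular_on l k V f" for f :: "'a \<Rightarrow> 'a"
    by (rule regular_on_diff[OF open_V that regular_on_apply[OF open_V blT regT that]])
  have regG: "regular_on l k V (\<lambda>y. transverse_gram L (T y) v)" for v
    unfolding transverse_gram_def Let_def
    by (intro regular_on_add[OF open_V] regT regTf regular_on_bounded_linear_compose[OF open_V blL] regular_on_const)
  have blG: "bounded_linear (transverse_gram L (T y))" if "y \<in> V" for y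
    using linear_transverse_gram[OF L T[OF that]] linear_linear by blast
  have "\<exists>u\<in>L. \<exists>v\<in>T xbar. x = u + v" for x
  proof -
    have "x \<in> {u + v | u v. u \<in> tangent_space M1 xbar \<and> v \<in> tangent_space M2 xbar}"
      using trans unfolding transversal_at_def by blast
    then show ?thesis
      using affine_tangent_space_subset[OF L M1L xbar(1)] TM2[OF xbar(2,3)] by blast
  qed
  then have "inj (transverse_gram L (T xbar))" by (intro inj_transverse_gram L T xbar(3))
  from invertible_family_bounded_below[OF blG this xbar(3) regular_on_imp_continuous_on[OF regG]]
  obtain c e where c: "c > 0" "e > 0"
    "\<And>y u. y \<in> V \<inter> cball xbar e \<Longrightarrow> c * norm u \<le> norm (transverse_gram L (T y) u)" by metis
  define V0 where "V0 = V \<inter> ball xbar e"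
  have V0: "open V0" "V0 \<subseteq> V" "xbar \<in> V0" using open_V xbar(3) c(2) by (auto simp: V0_def)
  have bijG: "bij (transverse_gram L (T y))" if y: "y \<in> V0" for y
  proof -
    have yV: "y \<in> V" using y V0 by blast
    have "inj (transverse_gram L (T y))"
      unfolding linear_injective_0[OF linear_transverse_gram[OF L T[OF yV]]]
    proof (intro allI impI)
      fix u assume "transverse_gram L (T y) u = 0"
      then have "c * norm u \<le> 0" using c(3)[of y u] y by (simp add: V0_def)
      then show "u = 0" using c(1) by (simp add: mult_le_0_iff)
    qed
    then show ?thesis
      using linear_injective_imp_surjective[OF linear_transverse_gram[OF L T[OF yV]]] by (simp add: bij_def)
  qed
  define \<mu> where "\<mu> = (\<lambda>z. inv (transverse_gram L (T z))
     (((z - xbar) - closest_point L (z - xbar)) - closest_point (T z) ((z - xbar) - closest_point L (z - xbar))))"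
  define E where "E = (\<lambda>z. xbar + closest_point L (z - xbar) + closest_point L (\<mu> z - closest_point (T z) (\<mu> z)))"
  have regI: "regular_on l k V0 (\<lambda>z. inv (transverse_gram L (T z)) v)" for v
    by (rule regular_on_inverse_family[OF V0(1) _ bijG])
       (use blG V0(2) regular_on_subset[OF V0(2) regG] in auto)
  have blI: "bounded_linear (inv (transverse_gram L (T z)))" if "z \<in> V0" for z
    using inj_linear_imp_inv_bounded_linear[OF blG bij_is_inj[OF bijG[OF that]]] that V0(2) by blast
  have regTf0: "regular_on l k V0 (\<lambda>y. f y - closest_point (T y) (f y))"
    if "regular_on l k V0 f" for f :: "'a \<Rightarrow> 'a"
    by (rule regular_on_diff[OF V0(1) that regular_on_apply[OF V0(1) _ regular_on_subset[OF V0(2) regT] that]])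
       (use blT V0(2) in blast)
  have regd: "regular_on l k V0 (\<lambda>z. z - xbar)"
    by (rule regular_on_diff[OF V0(1) regular_on_bounded_linear[OF V0(1) bounded_linear_ident] regular_on_const])
  have reg\<mu>: "regular_on l k V0 \<mu>"
    unfolding \<mu>_def
    by (intro regular_on_apply[OF V0(1) blI regI] regTf0 regular_on_diff[OF V0(1) regd]
        regular_on_bounded_linear_compose[OF V0(1) blL] regd)
  have regE: "regular_on l k V0 E"
    unfolding E_def
    by (intro regular_on_add[OF V0(1)] regular_on_const regular_on_bounded_linear_compose[OF V0(1) blL]
        regTf0 reg\<mu> regd)
  obtain \<epsilon> where \<epsilon>: "\<epsilon> > 0"
    "\<And>S P. \<lbrakk>open S; S \<subseteq> ball xbar \<epsilon>; \<And>x. x \<in> S \<Longrightarrow> P x \<in> M2 \<and> (\<forall>w\<in>M2. dist x (P x) \<le> dist x w)\<rbrakk>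
       \<Longrightarrow> regular_on l k S P"
    using regular_nearest_point[OF M2 xbar(2,3) k] by metis
  obtain e1 where e1: "e1 > 0" "ball xbar e1 \<subseteq> V0" using V0 open_contains_ball by blast
  define r where "r = min (min \<epsilon> r0) (e1 / 2)"
  have r: "r > 0" using \<epsilon> r0 e1 by (simp add: r_def)
  let ?P = "closest_point M2"
  have P: "?P x \<in> M2" "\<forall>w\<in>M2. dist x (?P x) \<le> dist x w" if "x \<in> ball xbar r" for x
    using projection_definedD[OF r0(2), of x] that by (auto simp: r_def)
  have PV: "?P x \<in> V0" if "x \<in> ball xbar r" for x
  proof -
    have "dist xbar (?P x) \<le> dist xbar x + dist x (?P x)" by (rule dist_triangle)
    also have "dist x (?P x) \<le> dist x xbar" using P(2)[OF that] xbar(2) by blast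
    finally have "dist xbar (?P x) < e1" using that by (simp add: dist_commute r_def)
    then show ?thesis using e1(2) by auto
  qed
  have "regular_on l k (ball xbar r) ?P" 
    by (rule \<epsilon>(2)) (use P in \<open>auto simp: r_def\<close>)
  then have "regular_on l k (ball xbar r) (\<lambda>x. E (?P x))"
    using regular_on_compose[OF V0(1) open_ball _ regE] PV by blast
  then have "regular_on l k (ball xbar r) (newton_slra M1 M2)"
  proof (rule regular_on_cong[OF open_ball, rotated])
    fix x assume x: "x \<in> ball xbar r"
    let ?z = "?P x"
    have z: "?z \<in> V0" "?z \<in> V" using PV[OF x] V0(2) by auto
    have "newton_target M1 M2 ?z = (\<lambda>v. xbar + v) ` L \<inter> (\<lambda>v. ?z + v) ` T ?z"
      unfolding newton_target_def TM2[OF P(1)[OF x] z(2)] M1L[symmetric] ..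
    then show "E ?z = newton_slra M1 M2 x"
      unfolding newton_slra_def Let_def E_def \<mu>_def
      using closest_point_affine_section[OF L T[OF z(2)] bijG[OF z(1)], where a = xbar and z = ?z] by simp
  qed
  then show thesis using that r by blast
qed

section \<open>Smooth limits of superattracting iterations\<close>

text \<open>
  The constant of \<open>perturbed_projection_recursion\<close>.  It multiplies \<open>N + R\<close> linearly, so the
  estimates are homogeneous in the initial vector, as operator-norm bounds require.
\<close>

definition growth_const :: "real \<Rightarrow> real" where
  "growth_const C = (2 * (C + 2)\<^sup>2 + 1) * ((2 * C + 2) * exp (4 * (C + 2)\<^sup>2))"

lemma growth_const_ge_1: "C \<ge> 0 \<Longrightarrow> growth_const C \<ge> 1"
proof -
  assume C: "C \<ge> 0"
  have "1 * (1 * 1) \<le> (2 * (C + 2)\<^sup>2 + 1) * ((2 * C + 2) * exp (4 * (C + 2)\<^sup>2))"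
    using C by (intro mult_mono) auto
  then show ?thesis by (simp add: growth_const_def)
qed

text \<open>
  If the operators converge geometrically to an idempotent \<open>P\<close>, then \<open>u (Suc k)\<close> is fixed by \<open>P\<close> up to a
  geometrically small error, so the next step changes it by a geometrically small multiple of its
  size.  The sizes therefore stay bounded (a convergent product) and the steps are summable.  The
  derivatives of the iterates of a map satisfy such recursions.
\<close>

lemma perturbed_projection_recursion:
  fixes P :: "'a::real_normed_vector \<Rightarrow> 'a" and A :: "nat \<Rightarrow> 'a \<Rightarrow> 'a" and u r :: "nat \<Rightarrow> 'a"
  assumes C: "C \<ge> 0" and R: "R \<ge> 0" and linP: "linear P" and P: "\<And>x. norm (P x) \<le> C * norm x"
    and idem: "\<And>x. P (P x) = P x"
    and A: "\<And>k x. norm (A k x - P x) \<le> C / 2 ^ k * norm x"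
    and r: "\<And>k. norm (r k) \<le> R / 2 ^ k"
    and u: "\<And>k. u (Suc k) = A k (u k) + r k" and N: "norm (u 0) \<le> N"
  shows "norm (u k) \<le> growth_const C * (N + R)"
    and "norm (u (Suc (Suc k)) - u (Suc k)) \<le> growth_const C * (N + R) / 2 ^ k"
proof -
  \<comment> \<open>\<open>m k\<close> bounds two consecutive terms; it grows by the factor \<open>1 + 2 K / 2 ^ k\<close> at most, and the product
    of these factors is at most \<open>exp (4 K)\<close>.\<close>
  define K where "K = (C + 2)\<^sup>2"
  define m where "m = (\<lambda>k. max (norm (u k)) (norm (u (Suc k))) + R)"
  define U0 where "U0 = (2 * C + 2) * (N + R) * exp (4 * K)"
  have N0: "N \<ge> 0" using N norm_ge_zero order_trans by blast
  have K: "K \<ge> 1" "C * (C + 1) + C \<le> K" "C + 2 \<le> K" using C by (auto simp: K_def power2_eq_square algebra_simps)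
  have m0: "m k \<ge> 0" "norm (u k) \<le> m k" "norm (u (Suc k)) \<le> m k" "R \<le> m k" for k
    using R order_trans[OF norm_ge_zero max.cobounded1[of "norm (u k)" "norm (u (Suc k))"]]
    by (auto simp: m_def)
  have diff: "norm (u (Suc (Suc k)) - u (Suc k)) \<le> 2 * K / 2 ^ k * m k" for k
  proof -
    let ?d = "A k (u k) - P (u k)"
    have "u (Suc (Suc k)) - u (Suc k) =
        (A (Suc k) (u (Suc k)) - P (u (Suc k))) + r (Suc k) + (P (u (Suc k)) - u (Suc k))"
      by (simp add: u[of "Suc k"])
    also have "P (u (Suc k)) - u (Suc k) = (P ?d - ?d) + (P (r k) - r k)"
      by (simp add: u[of k] linear_add[OF linP] linear_diff[OF linP] idem)
    finally have e: "u (Suc (Suc k)) - u (Suc k) =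
        (A (Suc k) (u (Suc k)) - P (u (Suc k))) + r (Suc k) + ((P ?d - ?d) + (P (r k) - r k))" .
    have C2: "C / 2 ^ Suc k \<le> C / 2 ^ k" "R / 2 ^ Suc k \<le> R / 2 ^ k"
      using C R by (auto intro!: divide_left_mono)
    have 1: "norm (A (Suc k) (u (Suc k)) - P (u (Suc k))) \<le> C / 2 ^ k * m k"
      by (rule order_trans[OF A], rule mult_mono[OF C2(1) m0(3)]) (use C in auto)
    have 2: "norm (r (Suc k)) \<le> 1 / 2 ^ k * m k"
      using order_trans[OF r C2(2)] m0(4)[of k] by (auto simp: field_simps intro: order_trans)
    have d: "norm ?d \<le> C / 2 ^ k * m k"
      by (rule order_trans[OF A], rule mult_left_mono[OF m0(2)]) (use C in simp)
    have rk: "norm (r k) \<le> 1 / 2 ^ k * m k"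
      using r[of k] m0(4)[of k] by (auto simp: field_simps intro: order_trans)
    have P1: "norm (P x - x) \<le> (C + 1) * norm x" for x
      using norm_triangle_ineq4[of "P x" x] P[of x] by (simp add: algebra_simps)
    have 3: "norm (P ?d - ?d) \<le> (C + 1) * (C / 2 ^ k * m k)"
      by (rule order_trans[OF P1 mult_left_mono[OF d]]) (use C in simp)
    have 4: "norm (P (r k) - r k) \<le> (C + 1) * (1 / 2 ^ k * m k)"
      by (rule order_trans[OF P1 mult_left_mono[OF rk]]) (use C in simp)
    have "norm (u (Suc (Suc k)) - u (Suc k)) \<le>
        C / 2 ^ k * m k + 1 / 2 ^ k * m k + ((C + 1) * (C / 2 ^ k * m k) + (C + 1) * (1 / 2 ^ k * m k))"
      unfolding e by (intro norm_triangle_mono 1 2 3 4)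
    also have "\<dots> = ((C * (C + 1) + C) + (C + 2)) / 2 ^ k * m k" by (simp add: field_simps)
    also have "\<dots> \<le> (2 * K) / 2 ^ k * m k"
      using K m0(1)[of k] by (intro mult_right_mono divide_right_mono) auto
    finally show ?thesis .
  qed
  have step: "m (Suc k) \<le> m k * exp (2 * K / 2 ^ k)" for k
  proof -
    define t where "t = 2 * K / 2 ^ k * m k"
    have "norm (u (Suc (Suc k))) \<le> norm (u (Suc k)) + t"
      using diff[of k] norm_triangle_sub[of "u (Suc (Suc k))" "u (Suc k)"] unfolding t_def by linarith
    moreover have "0 \<le> t" using K m0(1)[of k] by (simp add: t_def)
    ultimately have "m (Suc k) \<le> m k + t" unfolding m_def by linarith
    then have "m (Suc k) \<le> m k + 2 * K / 2 ^ k * m k" by (simp only: t_def)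
    also have "\<dots> = m k * (1 + 2 * K / 2 ^ k)" by (simp add: algebra_simps)
    also have "\<dots> \<le> m k * exp (2 * K / 2 ^ k)"
      using m0(1)[of k] by (intro mult_left_mono exp_ge_add_one_self) auto
    finally show ?thesis .
  qed
  have mb: "m k \<le> m 0 * exp (4 * K * (1 - 1 / 2 ^ k))" for k
  proof (induction k)
    case (Suc k)
    have "m (Suc k) \<le> (m 0 * exp (4 * K * (1 - 1 / 2 ^ k))) * exp (2 * K / 2 ^ k)"
      by (rule order_trans[OF step mult_right_mono[OF Suc]]) simp
    also have "\<dots> = m 0 * exp (4 * K * (1 - 1 / 2 ^ k) + 2 * K / 2 ^ k)" by (simp add: exp_add)
    also have "4 * K * (1 - 1 / 2 ^ k) + 2 * K / 2 ^ k = 4 * K * (1 - 1 / 2 ^ Suc k)"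
      by (simp add: field_simps)
    finally show ?case .
  qed simp
  have "m 0 \<le> (2 * C + 2) * (N + R)"
  proof -
    have "norm (u (Suc 0)) \<le> norm (A 0 (u 0) - P (u 0)) + norm (P (u 0)) + norm (r 0)"
      using norm_triangle_ineq[of "A 0 (u 0)" "r 0"] norm_triangle_sub[of "A 0 (u 0)" "P (u 0)"]
      by (simp add: u[of 0])
    also have "\<dots> \<le> C * N + C * N + R"
      using A[of 0 "u 0"] P[of "u 0"] r[of 0] mult_left_mono[OF N C] by simp
    finally have "norm (u (Suc 0)) \<le> C * N + C * N + R" .
    moreover have "0 \<le> C * N" "0 \<le> C * R" using C N0 R by auto
    ultimately show ?thesis using N N0 R by (simp add: m_def algebra_simps)
  qed
  moreover have "exp (4 * K * (1 - 1 / 2 ^ k)) \<le> exp (4 * K)" for k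
    using K by (simp add: mult_left_le)
  ultimately have mU: "m k \<le> U0" for k
    unfolding U0_def using mb[of k] C N0 R by (meson exp_ge_zero m0(1) mult_mono order_trans)
  have U0: "U0 \<ge> 0" using m0(1)[of 0] mU[of 0] by simp
  have g: "growth_const C * (N + R) = (2 * K + 1) * U0"
    by (simp add: growth_const_def U0_def K_def mult_ac)
  have "norm (u k) \<le> U0" using m0(2)[of k] mU[of k] by simp
  also have "\<dots> \<le> (2 * K + 1) * U0" using U0 K by (simp add: mult_le_cancel_right1)
  finally show "norm (u k) \<le> growth_const C * (N + R)" unfolding g .
  have "2 * K / 2 ^ k * m k \<le> (2 * K + 1) / 2 ^ k * U0"
    using K mU[of k] m0(1)[of k] by (intro mult_mono divide_right_mono) auto
  with diff[of k] show "norm (u (Suc (Suc k)) - u (Suc k)) \<le> growth_const C * (N + R) / 2 ^ k"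
    unfolding g by simp
qed

lemma geometric_steps_converge:
  fixes x :: "nat \<Rightarrow> 'a::banach"
  assumes b: "\<And>k. norm (x k) \<le> U" and d: "\<And>k. norm (x (Suc (Suc k)) - x (Suc k)) \<le> U / 2 ^ k"
  obtains y where "x \<longlonglongrightarrow> y" "\<And>k. norm (x k - y) \<le> 4 * U / 2 ^ k" "norm y \<le> U"
proof -
  have U: "U \<ge> 0" using b[of 0] norm_ge_zero order_trans by blast
  have tele: "norm (x (Suc (k + n)) - x (Suc k)) \<le> 2 * U / 2 ^ k - 2 * U / 2 ^ (k + n)" for k n
  proof (induction n)
    case (Suc n)
    have "norm (x (Suc (k + Suc n)) - x (Suc k)) \<le>
        norm (x (Suc (Suc (k + n))) - x (Suc (k + n))) + norm (x (Suc (k + n)) - x (Suc k))"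
      using norm_triangle_ineq[of "x (Suc (Suc (k + n))) - x (Suc (k + n))" "x (Suc (k + n)) - x (Suc k)"] by simp
    also have "\<dots> \<le> U / 2 ^ (k + n) + (2 * U / 2 ^ k - 2 * U / 2 ^ (k + n))"
      by (intro add_mono d Suc)
    also have "\<dots> = 2 * U / 2 ^ k - 2 * U / 2 ^ (k + Suc n)" by (simp add: field_simps)
    finally show ?case .
  qed simp
  have tele': "norm (x (Suc (k + n)) - x (Suc k)) \<le> 2 * U / 2 ^ k" for k n
    by (rule order_trans[OF tele]) (use U in simp)
  have "Cauchy (\<lambda>k. x (Suc k))"
  proof (rule metric_CauchyI)
    fix e :: real assume e: "e > 0"
    have "(\<lambda>k. 4 * U * (1 / 2) ^ k) \<longlonglongrightarrow> 4 * U * 0"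
      by (intro tendsto_mult_left LIMSEQ_power_zero) simp
    then have "\<forall>\<^sub>F k in sequentially. 4 * U * (1 / 2) ^ k < e"
      using e by (intro order_tendstoD) auto
    then obtain k where k: "4 * U * (1 / 2) ^ k < e" by (auto simp: eventually_sequentially)
    have near: "norm (x (Suc n) - x (Suc k)) \<le> 2 * U / 2 ^ k" if "n \<ge> k" for n
      using tele'[of k "n - k"] that by simp
    show "\<exists>M. \<forall>m\<ge>M. \<forall>n\<ge>M. dist (x (Suc m)) (x (Suc n)) < e"
    proof (intro exI allI impI)
      fix m n assume "m \<ge> k" "n \<ge> k"
      then have "dist (x (Suc m)) (x (Suc n)) \<le> 2 * U / 2 ^ k + 2 * U / 2 ^ k"
        using dist_triangle2[of "x (Suc m)" "x (Suc n)" "x (Suc k)"] near[of m] near[of n]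
        unfolding dist_norm by linarith
      also have "\<dots> < e" using k by (simp add: power_divide)
      finally show "dist (x (Suc m)) (x (Suc n)) < e" .
    qed
  qed
  then obtain y where y: "(\<lambda>k. x (Suc k)) \<longlonglongrightarrow> y" using Cauchy_convergent convergent_def by blast
  then have xy: "x \<longlonglongrightarrow> y" by (rule LIMSEQ_imp_Suc)
  have yU: "norm y \<le> U" by (rule Lim_norm_ubound[OF _ xy]) (use b in auto)
  have "norm (x k - y) \<le> 4 * U / 2 ^ k" for k
  proof (cases k)
    case 0
    then show ?thesis using norm_triangle_ineq4[of "x 0" y] b[of 0] yU U by simp
  next
    case (Suc j)
    have "(\<lambda>n. x (Suc (j + n)) - x (Suc j)) \<longlonglongrightarrow> y - x (Suc j)"
      using LIMSEQ_ignore_initial_segment[OF y, of j]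
      by (intro tendsto_diff tendsto_const) (simp add: add.commute)
    then have "norm (y - x (Suc j)) \<le> 2 * U / 2 ^ j"
      by (rule Lim_norm_ubound[rotated]) (use tele' in auto)
    then show ?thesis using Suc by (simp add: norm_minus_commute)
  qed
  then show thesis using that xy yU by blast
qed

lemma has_derivative_linear_family_apply:
  fixes F :: "'t::real_normed_vector \<Rightarrow> 'a::euclidean_space \<Rightarrow> 'b::real_normed_vector"
  assumes T: "open T" "t0 \<in> T" and lin: "\<And>t. t \<in> T \<Longrightarrow> bounded_linear (F t)"
    and F: "\<And>v. ((\<lambda>t. F t v) has_derivative F' v) (at t0)" and u: "(u has_derivative u') (at t0)"
    and lin': "\<And>h. bounded_linear (\<lambda>v. F' v h)"
  shows "((\<lambda>t. F t (u t)) has_derivative (\<lambda>h. F' (u t0) h + F t0 (u' h))) (at t0)"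
proof -
  have "((\<lambda>t. \<Sum>i\<in>Basis. (u t \<bullet> i) *\<^sub>R F t i) has_derivative
     (\<lambda>h. \<Sum>i\<in>Basis. (u t0 \<bullet> i) *\<^sub>R F' i h + (u' h \<bullet> i) *\<^sub>R F t0 i)) (at t0)"
    by (intro has_derivative_sum has_derivative_scaleR F has_derivative_inner_left u)
  moreover have "(\<Sum>i\<in>Basis. (u t0 \<bullet> i) *\<^sub>R F' i h + (u' h \<bullet> i) *\<^sub>R F t0 i) = F' (u t0) h + F t0 (u' h)" for h
    using bounded_linear_basis_expansion[OF lin', of "u t0" h]
      bounded_linear_basis_expansion[OF lin[OF T(2)], of "u' h"]
    by (simp add: sum.distrib)
  ultimately have "((\<lambda>t. \<Sum>i\<in>Basis. (u t \<bullet> i) *\<^sub>R F t i) has_derivative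
     (\<lambda>h. F' (u t0) h + F t0 (u' h))) (at t0)" by simp
  then show ?thesis
    by (rule has_derivative_transform_within_open[OF _ T])
       (use bounded_linear_basis_expansion[OF lin] in simp)
qed

text \<open>
  An iteration whose orbits converge geometrically to fixed points \<open>\<pi> y\<close>, where the first derivative \<open>A\<close>
  is idempotent and the second derivative \<open>b\<close>, in directions in the range of \<open>A\<close>, is
  annihilated by \<open>A\<close>: the fixed-point set curves only in directions that the iteration kills.
  The second derivative is taken as a bilinear family \<open>b y v w\<close>, with derivative direction \<open>w\<close>.
\<close>

locale attracting_fixed_points =
  fixes f :: "'a::euclidean_space \<Rightarrow> 'a" and A :: "'a \<Rightarrow> 'a \<Rightarrow> 'a" and b :: "'a \<Rightarrow> 'a \<Rightarrow> 'a \<Rightarrow> 'a"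
    and B S :: "'a set" and \<pi> :: "'a \<Rightarrow> 'a" and C \<Theta> :: real
  assumes open_B: "open B" and open_S: "open S" and convex_S: "convex S"
    and regular_f: "regular_on True 2 B f"
    and derivative_f: "\<And>y. y \<in> B \<Longrightarrow> (f has_derivative A y) (at y)"
    and derivative_A: "\<And>y v. y \<in> B \<Longrightarrow> ((\<lambda>z. A z v) has_derivative b y v) (at y)"
    and linear_b: "\<And>y w. y \<in> B \<Longrightarrow> linear (\<lambda>v. b y v w)"
    and C: "C \<ge> 0" and \<Theta>: "\<Theta> \<ge> 0"
    and A_bound: "\<And>y v. y \<in> B \<Longrightarrow> norm (A y v) \<le> C * norm v"
    and A_lipschitz: "\<And>y z v. y \<in> B \<Longrightarrow> z \<in> B \<Longrightarrow> norm (A y v - A z v) \<le> C * norm (y - z) * norm v"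
    and b_bound: "\<And>y v w. y \<in> B \<Longrightarrow> norm (b y v w) \<le> C * norm v * norm w"
    and b_lipschitz: "\<And>y z v w. y \<in> B \<Longrightarrow> z \<in> B \<Longrightarrow>
      norm (b y v w - b z v w) \<le> C * norm (y - z) * norm v * norm w"
    and orbit: "\<And>y k. y \<in> S \<Longrightarrow> (f ^^ k) y \<in> B" and limit_in: "\<And>y. y \<in> S \<Longrightarrow> \<pi> y \<in> B"
    and rate: "\<And>y k. y \<in> S \<Longrightarrow> norm ((f ^^ k) y - \<pi> y) \<le> \<Theta> / 2 ^ k"
    and idempotent: "\<And>y v. y \<in> S \<Longrightarrow> A (\<pi> y) (A (\<pi> y) v) = A (\<pi> y) v"
    and curvature_normal: "\<And>y v w. y \<in> S \<Longrightarrow> A (\<pi> y) (b (\<pi> y) (A (\<pi> y) v) (A (\<pi> y) w)) = 0"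
begin

text \<open>
  \<open>D1\<close> and \<open>D2\<close> are the first and second derivatives of the iterates of \<open>f\<close>; the recursions are the chain
  rule applied to \<open>f \<circ> f ^^ k\<close>.
\<close>

primrec D1 :: "nat \<Rightarrow> 'a \<Rightarrow> 'a \<Rightarrow> 'a" where
  "D1 0 y v = v"
| "D1 (Suc k) y v = A ((f ^^ k) y) (D1 k y v)"

primrec D2 :: "nat \<Rightarrow> 'a \<Rightarrow> 'a \<Rightarrow> 'a \<Rightarrow> 'a" where
  "D2 0 y v w = 0"
| "D2 (Suc k) y v w = A ((f ^^ k) y) (D2 k y v w) + b ((f ^^ k) y) (D1 k y v) (D1 k y w)"

lemma linear_A: "y \<in> B \<Longrightarrow> linear (A y)"
  using derivative_f has_derivative_bounded_linear bounded_linear.linear by blast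

lemma linear_b2: "y \<in> B \<Longrightarrow> linear (b y v)"
  using derivative_A has_derivative_bounded_linear bounded_linear.linear by blast

lemma regular_iterate: "regular_on True 2 S (f ^^ k)"
proof (induction k)
  case 0
  then show ?case using regular_on_bounded_linear[OF open_S bounded_linear_ident] by (simp add: id_def)
next
  case (Suc k)
  have "regular_on True 2 S (\<lambda>y. f ((f ^^ k) y))"
    by (rule regular_on_compose[OF open_B open_S _ regular_f Suc]) (use orbit in auto)
  then show ?case by (simp add: o_def)
qed

lemma has_derivative_iterate: "y \<in> S \<Longrightarrow> ((f ^^ k) has_derivative D1 k y) (at y)"
proof (induction k)
  case 0
  then show ?case by (simp add: id_def[symmetric])
next
  case (Suc k)
  show ?case using has_derivative_compose[OF Suc.IH[OF Suc.prems] derivative_f[OF orbit[OF Suc.prems]]]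
    by (simp add: o_def)
qed

lemma has_derivative_D1: "y \<in> S \<Longrightarrow> ((\<lambda>y. D1 k y v) has_derivative D2 k y v) (at y)"
proof (induction k)
  case 0
  then show ?case by simp
next
  case (Suc k)
  let ?Y = "\<lambda>y. (f ^^ k) y"
  note y = Suc.prems
  have Yy: "?Y y \<in> B" by (rule orbit[OF y])
  have "((\<lambda>y. A (?Y y) (D1 k y v)) has_derivative
      (\<lambda>w. b (?Y y) (D1 k y v) (D1 k y w) + A (?Y y) (D2 k y v w))) (at y)"
    by (rule has_derivative_linear_family_apply[OF open_S y _
          has_derivative_compose[OF has_derivative_iterate[OF y] derivative_A[OF Yy]] Suc.IH[OF y]])
       (use linear_b[OF Yy] linear_A[OF orbit] in \<open>auto simp: linear_linear\<close>)
  moreover have "(\<lambda>w. b (?Y y) (D1 k y v) (D1 k y w) + A (?Y y) (D2 k y v w)) = D2 (Suc k) y v"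
    by (rule ext) (simp add: add.commute)
  ultimately show ?case by (simp only: D1.simps)
qed

definition C' :: real where "C' = C * (1 + \<Theta>)"

lemma C': "C' \<ge> 0" "C \<le> C'" "C * \<Theta> \<le> C'"
  using C \<Theta> by (auto simp: C'_def algebra_simps)

lemma perturbation:
  assumes y: "y \<in> S"
  shows "norm (A (\<pi> y) v) \<le> C' * norm v" "norm (A ((f ^^ k) y) v - A (\<pi> y) v) \<le> C' / 2 ^ k * norm v"
proof -
  show "norm (A (\<pi> y) v) \<le> C' * norm v"
    using A_bound[OF limit_in[OF y], of v] mult_right_mono[OF C'(2), of "norm v"] by simp
  have "norm (A ((f ^^ k) y) v - A (\<pi> y) v) \<le> C * norm ((f ^^ k) y - \<pi> y) * norm v"
    by (rule A_lipschitz[OF orbit[OF y] limit_in[OF y]])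
  also have "\<dots> \<le> C * (\<Theta> / 2 ^ k) * norm v"
    using rate[OF y] C by (intro mult_right_mono mult_left_mono) auto
  also have "\<dots> \<le> C' / 2 ^ k * norm v"
    using C'(3) by (auto intro!: mult_right_mono divide_right_mono)
  finally show "norm (A ((f ^^ k) y) v - A (\<pi> y) v) \<le> C' / 2 ^ k * norm v" .
qed

definition \<kappa> :: real where "\<kappa> = growth_const C'"

text \<open>
  The first derivatives satisfy the perturbed recursion without source term.  The limit is fixed
  by \<open>A (\<pi> y)\<close>, which is needed to apply \<open>curvature_normal\<close> to the second derivatives.
\<close>

lemma D1_limit:
  assumes y: "y \<in> S"
  obtains v' where "(\<lambda>k. D1 k y v) \<longlonglongrightarrow> v'" "\<And>k. norm (D1 k y v) \<le> \<kappa> * norm v"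
    "\<And>k. norm (D1 k y v - v') \<le> 4 * (\<kappa> * norm v) / 2 ^ k" "norm v' \<le> \<kappa> * norm v" "A (\<pi> y) v' = v'"
proof -
  have rec: "norm (D1 k y v) \<le> \<kappa> * norm v"
    "norm (D1 (Suc (Suc k)) y v - D1 (Suc k) y v) \<le> \<kappa> * norm v / 2 ^ k" for k
    using perturbed_projection_recursion[of C' 0 "A (\<pi> y)" "\<lambda>k. A ((f ^^ k) y)" "\<lambda>_. 0" "\<lambda>k. D1 k y v" "norm v" k]
      C'(1) linear_A[OF limit_in[OF y]] perturbation[OF y] idempotent[OF y]
    by (auto simp: \<kappa>_def)
  obtain v' where v': "(\<lambda>k. D1 k y v) \<longlonglongrightarrow> v'"
    "\<And>k. norm (D1 k y v - v') \<le> 4 * (\<kappa> * norm v) / 2 ^ k" "norm v' \<le> \<kappa> * norm v"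
    using geometric_steps_converge[of "\<lambda>k. D1 k y v", OF rec] by metis
  have "A (\<pi> y) v' = v'"
  proof -
    let ?P = "A (\<pi> y)"
    note blP = linear_conv_bounded_linear[THEN iffD1, OF linear_A[OF limit_in[OF y]]]
    have "(\<lambda>k. D1 (Suc k) y v - ?P (D1 k y v)) \<longlonglongrightarrow> v' - ?P v'"
      by (intro tendsto_diff bounded_linear.tendsto[OF blP] v'(1) LIMSEQ_Suc[OF v'(1)])
    moreover have "(\<lambda>k. D1 (Suc k) y v - ?P (D1 k y v)) \<longlonglongrightarrow> 0"
    proof (rule Lim_null_comparison)
      have "norm (D1 (Suc k) y v - ?P (D1 k y v)) \<le> C' * (\<kappa> * norm v) * (1 / 2) ^ k" for k
      proof -
        have "norm (D1 (Suc k) y v - ?P (D1 k y v)) \<le> C' / 2 ^ k * norm (D1 k y v)"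
          using perturbation(2)[OF y] by simp
        also have "\<dots> \<le> C' / 2 ^ k * (\<kappa> * norm v)"
          using rec(1)[of k] C'(1) by (intro mult_left_mono) auto
        finally show ?thesis by (simp add: power_divide)
      qed
      then show "\<forall>\<^sub>F k in sequentially. norm (D1 (Suc k) y v - ?P (D1 k y v)) \<le> C' * (\<kappa> * norm v) * (1 / 2) ^ k"
        by simp
      show "(\<lambda>k. C' * (\<kappa> * norm v) * (1 / 2) ^ k) \<longlonglongrightarrow> 0"
        by (rule tendsto_mult_right_zero) (rule LIMSEQ_power_zero, simp)
    qed
    ultimately show ?thesis using LIMSEQ_unique by fastforce
  qed
  with v' rec(1) show thesis using that by blast
qed

definition \<kappa>2 :: real where "\<kappa>2 = 4 * (\<kappa> * ((C' * C + C * (\<Theta> + 8)) * \<kappa> * \<kappa> + C * \<kappa> * \<kappa>) + C * \<kappa> * \<kappa>)"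

text \<open>
  The second derivatives satisfy the recursion with a source term \<open>b (D1 v) (D1 w)\<close> that tends to a
  vector \<open>c\<close>.  A source with \<open>A (\<pi> y) c \<noteq> 0\<close> would make them grow linearly in \<open>k\<close>; here
  \<open>A (\<pi> y) c = 0\<close>, and after subtracting \<open>c\<close> the source is geometrically small.
\<close>

lemma D2_limit:
  assumes y: "y \<in> S"
  obtains s where "(\<lambda>k. D2 k y v w) \<longlonglongrightarrow> s"
    "\<And>k. norm (D2 k y v w - s) \<le> \<kappa>2 * norm v * norm w / 2 ^ k"
proof -
  let ?P = "A (\<pi> y)" and ?Y = "\<lambda>k. (f ^^ k) y"
  obtain v' where v': "\<And>k. norm (D1 k y v) \<le> \<kappa> * norm v"
    "\<And>k. norm (D1 k y v - v') \<le> 4 * (\<kappa> * norm v) / 2 ^ k" "norm v' \<le> \<kappa> * norm v" "?P v' = v'"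
    using D1_limit[OF y, of v] by metis
  obtain w' where w': "\<And>k. norm (D1 k y w) \<le> \<kappa> * norm w"
    "\<And>k. norm (D1 k y w - w') \<le> 4 * (\<kappa> * norm w) / 2 ^ k" "norm w' \<le> \<kappa> * norm w" "?P w' = w'"
    using D1_limit[OF y, of w] by metis
  define Q where "Q = \<kappa> * norm v * (\<kappa> * norm w)"
  have \<kappa>: "\<kappa> \<ge> 0" using growth_const_ge_1[OF C'(1)] by (simp add: \<kappa>_def)
  have Q: "Q \<ge> 0" using \<kappa> by (simp add: Q_def)
  define c where "c = b (\<pi> y) v' w'"
  have Pc: "?P c = 0" using curvature_normal[OF y, of v' w'] v'(4) w'(4) by (simp add: c_def)
  have cQ: "norm c \<le> C * Q"
  proof -
    have "norm c \<le> C * norm v' * norm w'" unfolding c_def by (rule b_bound[OF limit_in[OF y]])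
    also have "\<dots> \<le> C * (\<kappa> * norm v) * (\<kappa> * norm w)"
      using C v'(3) w'(3) \<kappa> by (intro mult_mono) auto
    finally show ?thesis by (simp add: Q_def mult_ac)
  qed
  define ck where "ck = (\<lambda>k. b (?Y k) (D1 k y v) (D1 k y w))"
  have ck: "norm (ck k - c) \<le> C * (\<Theta> + 8) * Q / 2 ^ k" for k
  proof -
    have e: "ck k - c = (b (?Y k) (D1 k y v) (D1 k y w) - b (\<pi> y) (D1 k y v) (D1 k y w))
        + (b (\<pi> y) (D1 k y v - v') (D1 k y w) + b (\<pi> y) v' (D1 k y w - w'))"
      using linear_diff[OF linear_b[OF limit_in[OF y]]] linear_diff[OF linear_b2[OF limit_in[OF y]]]
      by (simp add: ck_def c_def)
    have 1: "norm (b (?Y k) (D1 k y v) (D1 k y w) - b (\<pi> y) (D1 k y v) (D1 k y w))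
        \<le> C * (\<Theta> / 2 ^ k) * (\<kappa> * norm v) * (\<kappa> * norm w)"
      by (rule order_trans[OF b_lipschitz[OF orbit[OF y] limit_in[OF y]]])
         (use C \<Theta> \<kappa> rate[OF y] v'(1) w'(1) in \<open>intro mult_mono; simp\<close>)
    have 2: "norm (b (\<pi> y) (D1 k y v - v') (D1 k y w)) \<le> C * (4 * (\<kappa> * norm v) / 2 ^ k) * (\<kappa> * norm w)"
      by (rule order_trans[OF b_bound[OF limit_in[OF y]]])
         (use C \<kappa> v'(2) w'(1) in \<open>intro mult_mono; simp\<close>)
    have 3: "norm (b (\<pi> y) v' (D1 k y w - w')) \<le> C * (\<kappa> * norm v) * (4 * (\<kappa> * norm w) / 2 ^ k)"
      by (rule order_trans[OF b_bound[OF limit_in[OF y]]])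
         (use C \<kappa> v'(3) w'(2) in \<open>intro mult_mono; simp\<close>)
    have "norm (ck k - c) \<le> C * (\<Theta> / 2 ^ k) * (\<kappa> * norm v) * (\<kappa> * norm w) +
       (C * (4 * (\<kappa> * norm v) / 2 ^ k) * (\<kappa> * norm w) + C * (\<kappa> * norm v) * (4 * (\<kappa> * norm w) / 2 ^ k))"
      unfolding e by (intro norm_triangle_mono 1 2 3)
    also have "\<dots> = C * (\<Theta> + 8) * Q / 2 ^ k" by (simp add: Q_def field_simps)
    finally show ?thesis .
  qed
  \<comment> \<open>\<open>P c = 0\<close> makes \<open>A\<^sub>k c = (A\<^sub>k - P) c\<close> geometrically small, so \<open>D2 - c\<close> has a small source \<open>r\<close>.\<close>
  define u where "u = (\<lambda>k. D2 k y v w - c)"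
  define r where "r = (\<lambda>k. A (?Y k) c + (ck k - c))"
  define R where "R = (C' * C + C * (\<Theta> + 8)) * Q"
  have R: "R \<ge> 0" using C'(1) C \<Theta> Q by (simp add: R_def)
  have rk: "norm (r k) \<le> R / 2 ^ k" for k
  proof -
    have "norm (A (?Y k) c) \<le> C' / 2 ^ k * norm c"
      using perturbation(2)[OF y, of k c] Pc by simp
    also have "\<dots> \<le> C' / 2 ^ k * (C * Q)" using cQ C'(1) by (intro mult_left_mono) auto
    finally have "norm (r k) \<le> C' / 2 ^ k * (C * Q) + C * (\<Theta> + 8) * Q / 2 ^ k"
      unfolding r_def by (intro norm_triangle_mono ck)
    also have "\<dots> = R / 2 ^ k" by (simp add: R_def field_simps)
    finally show ?thesis .
  qed
  have uk: "u (Suc k) = A (?Y k) (u k) + r k" for k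
    using linear_diff[OF linear_A[OF orbit[OF y]]] by (simp add: u_def r_def ck_def)
  have u0: "norm (u 0) \<le> C * Q" using cQ by (simp add: u_def)
  note rec = perturbed_projection_recursion[OF C'(1) R linear_A[OF limit_in[OF y]]
      perturbation(1)[OF y] idempotent[OF y] perturbation(2)[OF y] rk uk u0]
  define T where "T = \<kappa> * (C * Q + R)"
  obtain s where s: "u \<longlonglongrightarrow> s" "\<And>k. norm (u k - s) \<le> 4 * T / 2 ^ k"
    using geometric_steps_converge[of u T] rec unfolding T_def \<kappa>_def by metis
  have "norm (D2 k y v w - (s + c)) \<le> \<kappa>2 * norm v * norm w / 2 ^ k" for k
  proof -
    have "D2 k y v w - (s + c) = u k - s" by (simp add: u_def)
    moreover have "4 * T \<le> \<kappa>2 * norm v * norm w"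
    proof -
      have "\<kappa>2 * norm v * norm w = 4 * T + 4 * (C * Q)"
        by (simp add: T_def \<kappa>2_def R_def Q_def algebra_simps)
      then show ?thesis using C Q by simp
    qed
    ultimately show ?thesis using s(2)[of k] by (metis divide_right_mono order_trans zero_le_numeral zero_le_power)
  qed
  moreover have "(\<lambda>k. D2 k y v w) \<longlonglongrightarrow> s + c"
    using tendsto_add[OF s(1) tendsto_const[of c]] by (simp add: u_def)
  ultimately show thesis using that by blast
qed

lemma geometric_small:
  assumes "e > 0"
  shows "\<forall>\<^sub>F n in sequentially. (c::real) / 2 ^ n \<le> e"
proof -
  have "(\<lambda>n. c * (1 / 2) ^ n) \<longlonglongrightarrow> c * 0" by (intro tendsto_mult_left LIMSEQ_power_zero) simp
  then have "\<forall>\<^sub>F n in sequentially. c * (1 / 2) ^ n < e" using assms by (intro order_tendstoD) auto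
  then show ?thesis by (rule eventually_mono) (simp add: power_divide)
qed

text \<open>
  The first two derivatives of the iterates converge uniformly on \<open>S\<close>, so limit and
  differentiation may be interchanged twice.
\<close>

theorem limit_twice_differentiable: "regular_on False 2 S \<pi>"
proof -
  define V where "V = (\<lambda>y v. lim (\<lambda>k. D1 k y v))"
  define W where "W = (\<lambda>y v w. lim (\<lambda>k. D2 k y v w))"
  have V: "(\<lambda>k. D1 k y v) \<longlonglongrightarrow> V y v" "norm (D1 k y v - V y v) \<le> 4 * \<kappa> / 2 ^ k * norm v"
    if y: "y \<in> S" for y v k
  proof -
    obtain v' where v': "(\<lambda>k. D1 k y v) \<longlonglongrightarrow> v'" "\<And>k. norm (D1 k y v - v') \<le> 4 * (\<kappa> * norm v) / 2 ^ k"
      using D1_limit[OF y, of v] by metis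
    then have "V y v = v'" by (simp add: V_def limI)
    then show "(\<lambda>k. D1 k y v) \<longlonglongrightarrow> V y v" "norm (D1 k y v - V y v) \<le> 4 * \<kappa> / 2 ^ k * norm v"
      using v' by (auto simp: mult_ac)
  qed
  have W: "(\<lambda>k. D2 k y v w) \<longlonglongrightarrow> W y v w" "norm (D2 k y v w - W y v w) \<le> \<kappa>2 * norm v / 2 ^ k * norm w"
    if y: "y \<in> S" for y v w k
  proof -
    obtain s where s: "(\<lambda>k. D2 k y v w) \<longlonglongrightarrow> s" "\<And>k. norm (D2 k y v w - s) \<le> \<kappa>2 * norm v * norm w / 2 ^ k"
      using D2_limit[OF y, of v w] by metis
    then have "W y v w = s" by (simp add: W_def limI)
    then show "(\<lambda>k. D2 k y v w) \<longlonglongrightarrow> W y v w" "norm (D2 k y v w - W y v w) \<le> \<kappa>2 * norm v / 2 ^ k * norm w"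
      using s by (auto simp: mult_ac)
  qed
  have lim: "(\<lambda>k. (f ^^ k) y) \<longlonglongrightarrow> \<pi> y" if "y \<in> S" for y
  proof (rule LIM_zero_cancel, rule Lim_null_comparison)
    show "\<forall>\<^sub>F k in sequentially. norm ((f ^^ k) y - \<pi> y) \<le> \<Theta> * (1 / 2) ^ k"
      using rate[OF that] by (simp add: power_divide)
    show "(\<lambda>k. \<Theta> * (1 / 2) ^ k) \<longlonglongrightarrow> 0"
      by (rule tendsto_mult_right_zero) (rule LIMSEQ_power_zero, simp)
  qed
  have d\<pi>: "(\<pi> has_derivative V y) (at y)" if y: "y \<in> S" for y
  proof -
    have "\<exists>g. \<forall>x\<in>S. (\<lambda>n. (f ^^ n) x) \<longlonglongrightarrow> g x \<and> (g has_derivative V x) (at x within S)"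
    proof (rule has_derivative_sequence[where f = "\<lambda>n. f ^^ n" and f' = D1 and g' = V, OF convex_S _ _ y lim[OF y]])
      show "((f ^^ n) has_derivative D1 n x) (at x within S)" if "x \<in> S" for n x
        by (rule has_derivative_at_withinI[OF has_derivative_iterate[OF that]])
      fix e :: real assume "e > 0"
      from geometric_small[OF this, of "4 * \<kappa>"]
      show "\<forall>\<^sub>F n in sequentially. \<forall>x\<in>S. \<forall>h. norm (D1 n x h - V x h) \<le> e * norm h"
        by eventually_elim (use V(2) in \<open>meson mult_right_mono norm_ge_zero order_trans\<close>)
    qed
    then obtain g where g: "\<And>x. x \<in> S \<Longrightarrow> (\<lambda>n. (f ^^ n) x) \<longlonglongrightarrow> g x"
      "\<And>x. x \<in> S \<Longrightarrow> (g has_derivative V x) (at x within S)" by blast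
    have "(g has_derivative V y) (at y)" using g(2)[OF y] at_within_open[OF y open_S] by simp
    then show ?thesis
      by (rule has_derivative_transform_within_open[OF _ open_S y])
         (use LIMSEQ_unique[OF g(1) lim] in blast)
  qed
  have dV: "((\<lambda>y. V y v) has_derivative W y v) (at y)" if y: "y \<in> S" for y v
  proof -
    have "\<exists>g. \<forall>x\<in>S. (\<lambda>n. D1 n x v) \<longlonglongrightarrow> g x \<and> (g has_derivative W x v) (at x within S)"
    proof (rule has_derivative_sequence[where f = "\<lambda>n x. D1 n x v" and f' = "\<lambda>n x. D2 n x v" and g' = "\<lambda>x. W x v",
          OF convex_S _ _ y V(1)[OF y]])
      show "((\<lambda>x. D1 n x v) has_derivative D2 n x v) (at x within S)" if "x \<in> S" for n x
        by (rule has_derivative_at_withinI[OF has_derivative_D1[OF that]])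
      fix e :: real assume "e > 0"
      from geometric_small[OF this, of "\<kappa>2 * norm v"]
      show "\<forall>\<^sub>F n in sequentially. \<forall>x\<in>S. \<forall>h. norm (D2 n x v h - W x v h) \<le> e * norm h"
        by eventually_elim (use W(2) in \<open>meson mult_right_mono norm_ge_zero order_trans\<close>)
    qed
    then obtain g where g: "\<And>x. x \<in> S \<Longrightarrow> (\<lambda>n. D1 n x v) \<longlonglongrightarrow> g x"
      "\<And>x. x \<in> S \<Longrightarrow> (g has_derivative W x v) (at x within S)" by blast
    have "(g has_derivative W y v) (at y)" using g(2)[OF y] at_within_open[OF y open_S] by simp
    then show ?thesis
      by (rule has_derivative_transform_within_open[OF _ open_S y])
         (use LIMSEQ_unique[OF g(1) V(1)] in blast)
  qed
  have cW: "continuous_on S (\<lambda>y. W y v w)" for v w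
  proof (rule uniform_limit_theorem)
    have "regular_on True 0 S (\<lambda>y. D2 n y v w)" for n
    proof -
      have "regular_on True 1 S (\<lambda>y. frechet_derivative (f ^^ n) (at y) v)"
        using regular_on_SucD(2)[of True 1 S "f ^^ n"] regular_iterate[of n] by (simp add: numeral_2_eq_2)
      then have "regular_on True (Suc 0) S (\<lambda>y. D1 n y v)"
        unfolding One_nat_def
        by (rule regular_on_cong[OF open_S, rotated])
           (simp add: frechet_derivative_at[OF has_derivative_iterate, symmetric])
      from regular_on_SucD(2)[OF this]
      show ?thesis
        by (rule regular_on_cong[OF open_S, rotated])
           (simp add: frechet_derivative_at[OF has_derivative_D1, symmetric])
    qed
    then show "\<forall>\<^sub>F n in sequentially. continuous_on S (\<lambda>y. D2 n y v w)"
      by (intro always_eventually allI) (rule regular_on_imp_continuous_on)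
    show "uniform_limit S (\<lambda>n y. D2 n y v w) (\<lambda>y. W y v w) sequentially"
    proof (rule uniform_limitI)
      fix e :: real assume e: "e > 0"
      then have "e / 2 > 0" by simp
      from geometric_small[OF this, of "\<kappa>2 * norm v * norm w"]
      show "\<forall>\<^sub>F n in sequentially. \<forall>x\<in>S. dist (D2 n x v w) (W x v w) < e"
      proof eventually_elim
        case (elim n)
        show ?case
        proof
          fix x assume "x \<in> S"
          then have "dist (D2 n x v w) (W x v w) \<le> \<kappa>2 * norm v * norm w / 2 ^ n"
            using W(2)[of x n v w] by (simp add: dist_norm)
          also have "\<dots> \<le> e / 2" by (rule elim)
          also have "\<dots> < e" using e by simp
          finally show "dist (D2 n x v w) (W x v w) < e" .
        qed
      qed
    qed
  qed simp
  show ?thesis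
    unfolding numeral_2_eq_2
    by (rule regular_on_SucI[OF open_S d\<pi>], assumption)
       (rule regular_on_SucI[OF open_S dV], assumption, simp add: regular_on_0 cW)
qed

end

lemma finite_family_lipschitz_ball:
  fixes h :: "'i \<Rightarrow> 'a::metric_space \<Rightarrow> 'b::real_normed_vector"
  assumes "finite I" "open S" "x0 \<in> S" "\<And>i. i \<in> I \<Longrightarrow> locally_lipschitz S (h i)"
  shows "\<exists>\<rho>>0. \<exists>L\<ge>0. ball x0 \<rho> \<subseteq> S \<and>
    (\<forall>i\<in>I. (\<forall>y\<in>ball x0 \<rho>. norm (h i y) \<le> L) \<and>
       (\<forall>y\<in>ball x0 \<rho>. \<forall>z\<in>ball x0 \<rho>. norm (h i y - h i z) \<le> L * dist y z))"
  using assms(1,4)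
proof (induction I)
  case empty
  then show ?case using assms(2,3) open_contains_ball by fastforce
next
  case (insert i I)
  obtain \<rho>1 L1 where 1: "\<rho>1 > 0" "L1 \<ge> 0" "ball x0 \<rho>1 \<subseteq> S"
    "\<And>i y. i \<in> I \<Longrightarrow> y \<in> ball x0 \<rho>1 \<Longrightarrow> norm (h i y) \<le> L1"
    "\<And>i y z. i \<in> I \<Longrightarrow> y \<in> ball x0 \<rho>1 \<Longrightarrow> z \<in> ball x0 \<rho>1 \<Longrightarrow> norm (h i y - h i z) \<le> L1 * dist y z"
    using insert.IH insert.prems by (metis insert_iff)
  obtain e L2 where 2: "e > 0" "L2-lipschitz_on (S \<inter> cball x0 e) (h i)"
    using insert.prems assms(3) unfolding locally_lipschitz_def by blast
  have L2: "L2 \<ge> 0" using 2(2) lipschitz_on_nonneg by blast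
  define \<rho> where "\<rho> = min \<rho>1 e"
  define L where "L = max L1 (L2 + norm (h i x0) + L2 * e)"
  have L: "L1 \<le> L" "L2 \<le> L" "norm (h i x0) + L2 * e \<le> L"
    using L2 2(1) by (auto simp: L_def le_max_iff_disj)
  have lip: "norm (h i y - h i z) \<le> L2 * dist y z" if "y \<in> ball x0 \<rho>" "z \<in> ball x0 \<rho>" for y z
  proof -
    have "y \<in> S \<inter> cball x0 e" "z \<in> S \<inter> cball x0 e"
      using that subsetD[OF 1(3), of y] subsetD[OF 1(3), of z] by (auto simp: \<rho>_def)
    from lipschitz_onD[OF 2(2) this] show ?thesis by (simp add: dist_norm[of "h i y"])
  qed
  have bd: "norm (h i y) \<le> L" if y: "y \<in> ball x0 \<rho>" for y
  proof -
    have "norm (h i y) \<le> norm (h i x0) + norm (h i y - h i x0)"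
      using norm_triangle_sub by blast
    also have "norm (h i y - h i x0) \<le> L2 * dist y x0"
      by (rule lip[OF y]) (use 1 2 in \<open>simp add: \<rho>_def\<close>)
    also have "L2 * dist y x0 \<le> L2 * e"
      using y L2 by (intro mult_left_mono) (auto simp: \<rho>_def dist_commute)
    finally show ?thesis using L(3) by simp
  qed
  have lipL: "norm (h j y - h j z) \<le> L * dist y z"
    if "j \<in> insert i I" "y \<in> ball x0 \<rho>" "z \<in> ball x0 \<rho>" for j y z
  proof (cases "j = i")
    case True
    then show ?thesis using lip[OF that(2,3)] mult_right_mono[OF L(2), of "dist y z"] by simp
  next
    case False
    then have "norm (h j y - h j z) \<le> L1 * dist y z" using 1(5)[of j y z] that by (auto simp: \<rho>_def)
    then show ?thesis using mult_right_mono[OF L(1), of "dist y z"] by simp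
  qed
  have bdL: "norm (h j y) \<le> L" if "j \<in> insert i I" "y \<in> ball x0 \<rho>" for j y
  proof (cases "j = i")
    case True
    then show ?thesis using bd that by simp
  next
    case False
    then have "norm (h j y) \<le> L1" using 1(4)[of j y] that by (auto simp: \<rho>_def)
    then show ?thesis using L(1) by simp
  qed
  have "\<rho> > 0" "L \<ge> 0" "ball x0 \<rho> \<subseteq> S" using 1 2 by (auto simp: \<rho>_def L_def le_max_iff_disj)
  then show ?case using lipL bdL by blast
qed

lemma regular_derivative_bounds:
  fixes f :: "'a::euclidean_space \<Rightarrow> 'a"
  assumes S: "open S" and x0: "x0 \<in> S" and reg: "regular_on True 2 S f"
  obtains \<rho> C A b where "\<rho> > 0" "ball x0 \<rho> \<subseteq> S" "C \<ge> 0"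
    "\<And>y. y \<in> ball x0 \<rho> \<Longrightarrow> (f has_derivative A y) (at y)"
    "\<And>y v. y \<in> ball x0 \<rho> \<Longrightarrow> ((\<lambda>z. A z v) has_derivative b y v) (at y)"
    "\<And>y w. y \<in> ball x0 \<rho> \<Longrightarrow> linear (\<lambda>v. b y v w)"
    "\<And>y v. y \<in> ball x0 \<rho> \<Longrightarrow> norm (A y v) \<le> C * norm v"
    "\<And>y z v. y \<in> ball x0 \<rho> \<Longrightarrow> z \<in> ball x0 \<rho> \<Longrightarrow> norm (A y v - A z v) \<le> C * norm (y - z) * norm v"
    "\<And>y v w. y \<in> ball x0 \<rho> \<Longrightarrow> norm (b y v w) \<le> C * norm v * norm w"
    "\<And>y z v w. y \<in> ball x0 \<rho> \<Longrightarrow> z \<in> ball x0 \<rho> \<Longrightarrow>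
       norm (b y v w - b z v w) \<le> C * norm (y - z) * norm v * norm w"
proof -
  define A where "A = (\<lambda>y. frechet_derivative f (at y))"
  define a where "a = (\<lambda>i y. frechet_derivative (\<lambda>z. A z i) (at y))"
  define b where "b = (\<lambda>y v w. \<Sum>i\<in>Basis. (v \<bullet> i) *\<^sub>R a i y w)"
  note reg' = reg[unfolded numeral_2_eq_2]
  have A: "(f has_derivative A y) (at y)" if "y \<in> S" for y
    unfolding A_def by (rule regular_on_SucD(1)[OF reg' that])
  have regA: "regular_on True (Suc 0) S (\<lambda>y. A y v)" for v
    unfolding A_def by (rule regular_on_SucD(2)[OF reg'])
  have blA: "bounded_linear (A y)" if "y \<in> S" for y using A[OF that] has_derivative_bounded_linear by blast
  have da: "((\<lambda>z. A z i) has_derivative a i y) (at y)" if "y \<in> S" for i y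
    unfolding a_def by (rule regular_on_SucD(1)[OF regA that])
  have db: "((\<lambda>z. A z v) has_derivative b y v) (at y)" if y: "y \<in> S" for v y
  proof -
    have "((\<lambda>z. \<Sum>i\<in>Basis. (v \<bullet> i) *\<^sub>R A z i) has_derivative b y v) (at y)"
      unfolding b_def using da[OF y] by (intro has_derivative_sum has_derivative_scaleR_right)
    then show ?thesis
      by (rule has_derivative_transform_within_open[OF _ S y])
         (use bounded_linear_basis_expansion[OF blA] in simp)
  qed
  have blb1: "bounded_linear (\<lambda>v. b y v w)" for y w
    unfolding b_def by (intro bounded_linear_sum bounded_linear_scaleR_const bounded_linear_inner_left)
  have blb2: "bounded_linear (b y v)" if "y \<in> S" for y v
    using db[OF that] has_derivative_bounded_linear by blast
  have bi: "b y i w = a i y w" if "i \<in> Basis" for y i w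
    unfolding b_def using that by (simp add: inner_Basis if_distrib[of "\<lambda>c. c *\<^sub>R _"] cong: if_cong)
  have ll1: "locally_lipschitz S (\<lambda>y. A y i)" for i
    using regular_on_lower[OF S regA[of i]] by (simp add: regular_on_0)
  obtain \<rho>1 L1 where 1: "\<rho>1 > 0" "L1 \<ge> 0" "ball x0 \<rho>1 \<subseteq> S"
    "\<And>i y. i \<in> Basis \<Longrightarrow> y \<in> ball x0 \<rho>1 \<Longrightarrow> norm (A y i) \<le> L1"
    "\<And>i y z. i \<in> Basis \<Longrightarrow> y \<in> ball x0 \<rho>1 \<Longrightarrow> z \<in> ball x0 \<rho>1 \<Longrightarrow> norm (A y i - A z i) \<le> L1 * dist y z"
    using finite_family_lipschitz_ball[OF finite_Basis S x0, of "\<lambda>i y. A y i", OF ll1] by metis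
  have ll2: "locally_lipschitz S (\<lambda>y. a (fst p) y (snd p))" for p
    using regular_on_SucD(2)[OF regA[of "fst p"]] by (simp add: regular_on_0 a_def)
  obtain \<rho>2 L2 where 2: "\<rho>2 > 0" "L2 \<ge> 0" "ball x0 \<rho>2 \<subseteq> S"
    "\<And>p y. p \<in> Basis \<times> Basis \<Longrightarrow> y \<in> ball x0 \<rho>2 \<Longrightarrow> norm (a (fst p) y (snd p)) \<le> L2"
    "\<And>p y z. p \<in> Basis \<times> Basis \<Longrightarrow> y \<in> ball x0 \<rho>2 \<Longrightarrow> z \<in> ball x0 \<rho>2 \<Longrightarrow>
        norm (a (fst p) y (snd p) - a (fst p) z (snd p)) \<le> L2 * dist y z"
    using finite_family_lipschitz_ball[OF finite_cartesian_product[OF finite_Basis finite_Basis] S x0,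
        of "\<lambda>p y. a (fst p) y (snd p)", OF ll2] by metis
  define d where "d = real DIM('a)"
  have d: "d \<ge> 1" using DIM_positive[where 'a = 'a] unfolding d_def by linarith
  define \<rho> where "\<rho> = min \<rho>1 \<rho>2"
  define C where "C = d * L1 + d * (d * L2)"
  have C: "d * L1 \<le> C" "d * (d * L2) \<le> C" "C \<ge> 0" using 1 2 d by (auto simp: C_def)
  have yS: "y \<in> S" if "y \<in> ball x0 \<rho>" for y using that 1(3) by (auto simp: \<rho>_def)
  have Ab: "norm (A y v) \<le> C * norm v" if y: "y \<in> ball x0 \<rho>" for y v
  proof -
    have "norm (A y v) \<le> d * L1 * norm v"
      unfolding d_def by (rule norm_le_basis_bound[OF blA[OF yS[OF y]]]) (use 1(4) y in \<open>simp add: \<rho>_def\<close>)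
    then show ?thesis using mult_right_mono[OF C(1), of "norm v"] by simp
  qed
  have Al: "norm (A y v - A z v) \<le> C * norm (y - z) * norm v"
    if y: "y \<in> ball x0 \<rho>" and z: "z \<in> ball x0 \<rho>" for y z v
  proof -
    have "norm (A y v - A z v) \<le> d * (L1 * dist y z) * norm v"
      unfolding d_def
      by (rule norm_le_basis_bound[OF bounded_linear_sub[OF blA[OF yS[OF y]] blA[OF yS[OF z]]]])
         (use 1(5) y z in \<open>simp add: \<rho>_def\<close>)
    also have "\<dots> = d * L1 * (norm (y - z) * norm v)" by (simp add: dist_norm)
    also have "\<dots> \<le> C * (norm (y - z) * norm v)" using C(1) by (intro mult_right_mono) auto
    finally show ?thesis by (simp add: mult_ac)
  qed
  have bb: "norm (b y v w) \<le> C * norm v * norm w" if y: "y \<in> ball x0 \<rho>" for y v w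
  proof -
    have "norm (b y v w) \<le> d * (d * L2 * norm v) * norm w"
      unfolding d_def
    proof (rule norm_le_basis_bound[OF blb2[OF yS[OF y]]])
      fix j :: 'a assume j: "j \<in> Basis"
      show "norm (b y v j) \<le> real DIM('a) * L2 * norm v"
        by (rule norm_le_basis_bound[OF blb1]) (use 2(4)[of "(_, j)" y] j y bi in \<open>simp add: \<rho>_def\<close>)
    qed
    also have "\<dots> = d * (d * L2) * (norm v * norm w)" by simp
    also have "\<dots> \<le> C * (norm v * norm w)" using C(2) by (intro mult_right_mono) auto
    finally show ?thesis by (simp add: mult_ac)
  qed
  have bl: "norm (b y v w - b z v w) \<le> C * norm (y - z) * norm v * norm w"
    if y: "y \<in> ball x0 \<rho>" and z: "z \<in> ball x0 \<rho>" for y z v w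
  proof -
    have "norm (b y v w - b z v w) \<le> d * (d * (L2 * dist y z) * norm v) * norm w"
      unfolding d_def
    proof (rule norm_le_basis_bound[OF bounded_linear_sub[OF blb2[OF yS[OF y]] blb2[OF yS[OF z]]]])
      fix j :: 'a assume j: "j \<in> Basis"
      show "norm (b y v j - b z v j) \<le> real DIM('a) * (L2 * dist y z) * norm v"
        by (rule norm_le_basis_bound[OF bounded_linear_sub[OF blb1 blb1]])
           (use 2(5)[of "(_, j)" y z] j y z bi in \<open>simp add: \<rho>_def\<close>)
    qed
    also have "\<dots> = d * (d * L2) * (norm (y - z) * norm v * norm w)" by (simp add: dist_norm)
    also have "\<dots> \<le> C * (norm (y - z) * norm v * norm w)" using C(2) by (intro mult_right_mono) auto
    finally show ?thesis by (simp add: mult_ac)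
  qed
  show thesis
    by (rule that[of \<rho> C A b])
       (use 1(1,3) 2(1) C(3) A[OF yS] db[OF yS] bounded_linear.linear[OF blb1] Ab Al bb bl in \<open>auto simp: \<rho>_def\<close>)
qed

lemma isCont_eventually_in_open:
  assumes "isCont c x" "open B" "c x \<in> B"
  shows "\<forall>\<^sub>F t in nhds x. c t \<in> B"
  using assms unfolding isCont_def tendsto_at_iff_tendsto_nhds by (rule topological_tendstoD)

lemma quadratic_has_vector_derivative_0:
  fixes h :: "real \<Rightarrow> 'a::real_normed_vector"
  assumes "e > 0" "\<And>t. \<bar>t\<bar> < e \<Longrightarrow> norm (h t) \<le> K * t\<^sup>2"
  shows "(h has_vector_derivative 0) (at 0)"
proof -
  have h0: "h 0 = 0" using assms(2)[of 0] assms(1) by simp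
  have "((\<lambda>t. norm (h t) / norm t) \<longlongrightarrow> 0) (at 0)"
  proof (rule Lim_null_comparison)
    show "\<forall>\<^sub>F t in at 0. norm (norm (h t) / norm t) \<le> K * \<bar>t\<bar>"
      unfolding eventually_at
    proof (intro exI[of _ e] conjI assms(1) ballI impI)
      fix t :: real assume t: "t \<noteq> 0 \<and> dist t 0 < e"
      then have "norm (h t) \<le> K * \<bar>t\<bar> * \<bar>t\<bar>" using assms(2)[of t] by (simp add: power2_eq_square)
      then show "norm (norm (h t) / norm t) \<le> K * \<bar>t\<bar>" using t by (simp add: field_simps)
    qed
    show "((\<lambda>t. K * \<bar>t\<bar>) \<longlongrightarrow> 0) (at 0)" by (auto intro!: tendsto_eq_intros)
  qed
  then show ?thesis
    unfolding has_vector_derivative_def has_derivative_at using h0 by simp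
qed

text \<open>
  The abstract assumptions of \<open>attracting_fixed_points\<close> follow from quadratic convergence.  The
  nearest points \<open>P (m + t w)\<close> form a curve of fixed points which agrees with \<open>f (m + t w)\<close> up to
  \<open>O(t\<^sup>2)\<close>, so its velocity is \<open>A m w\<close>.  Differentiating \<open>f = id\<close> along this curve shows that \<open>A m\<close> is
  idempotent.  Differentiating the idempotency \<open>A A = A\<close> along the curve gives
  \<open>b (A v) (A w) + A (b v (A w)) = b v (A w)\<close>; replacing \<open>v\<close> by \<open>A v\<close> leaves \<open>A (b (A v) (A w)) = 0\<close>.  This
  needs neither charts of \<open>M\<close> nor symmetry of the second derivative.
\<close>

lemma quadratic_iteration_limit:
  fixes f P :: "'a::euclidean_space \<Rightarrow> 'a" and M :: "'a set"
  assumes r0: "r0 > 0" and reg: "regular_on True 2 (ball xbar r0) f" and xbar: "xbar \<in> M"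
    and near: "\<And>x. x \<in> ball xbar r0 \<Longrightarrow> P x \<in> M \<and> (\<forall>w\<in>M. dist x (P x) \<le> dist x w)"
    and fP: "\<And>x. x \<in> ball xbar r0 \<Longrightarrow> norm (f x - P x) \<le> \<mu> * (norm (x - P x))\<^sup>2"
    and lim: "\<And>y0. y0 \<in> ball xbar r0 \<Longrightarrow> \<exists>y\<in>M. (\<lambda>k. (f ^^ k) y0) \<longlonglongrightarrow> y \<and>
        (\<forall>k. norm ((f ^^ Suc k) y0 - y) \<le> \<gamma> * (norm ((f ^^ k) y0 - y))\<^sup>2) \<and>
        norm (y - P y0) \<le> \<gamma>' * (norm (y0 - P y0))\<^sup>2"
    and pos: "\<mu> > 0" "\<gamma> > 0" "\<gamma>' > 0"
  obtains \<rho> \<pi> where "\<rho> > 0" "\<rho> \<le> r0" "regular_on False 2 (ball xbar \<rho>) \<pi>"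
    "\<And>y. y \<in> ball xbar \<rho> \<Longrightarrow> (\<lambda>k. (f ^^ k) y) \<longlonglongrightarrow> \<pi> y \<and> \<pi> y \<in> M \<and>
       norm (\<pi> y - P y) \<le> \<gamma>' * (norm (y - P y))\<^sup>2"
proof -
  have x0: "xbar \<in> ball xbar r0" using r0 by simp
  obtain \<rho>0 C A b where AB: "\<rho>0 > 0" "ball xbar \<rho>0 \<subseteq> ball xbar r0" "C \<ge> 0"
    and dA: "\<And>y. y \<in> ball xbar \<rho>0 \<Longrightarrow> (f has_derivative A y) (at y)"
    and db: "\<And>y v. y \<in> ball xbar \<rho>0 \<Longrightarrow> ((\<lambda>z. A z v) has_derivative b y v) (at y)"
    and lb: "\<And>y w. y \<in> ball xbar \<rho>0 \<Longrightarrow> linear (\<lambda>v. b y v w)"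
    and bounds: "\<And>y v. y \<in> ball xbar \<rho>0 \<Longrightarrow> norm (A y v) \<le> C * norm v"
      "\<And>y z v. y \<in> ball xbar \<rho>0 \<Longrightarrow> z \<in> ball xbar \<rho>0 \<Longrightarrow> norm (A y v - A z v) \<le> C * norm (y - z) * norm v"
      "\<And>y v w. y \<in> ball xbar \<rho>0 \<Longrightarrow> norm (b y v w) \<le> C * norm v * norm w"
      "\<And>y z v w. y \<in> ball xbar \<rho>0 \<Longrightarrow> z \<in> ball xbar \<rho>0 \<Longrightarrow>
         norm (b y v w - b z v w) \<le> C * norm (y - z) * norm v * norm w"
    by (rule regular_derivative_bounds[OF open_ball x0 reg], rule that, assumption+)
  let ?B = "ball xbar \<rho>0"
  have Br: "y \<in> ball xbar r0" if "y \<in> ?B" for y using that AB(2) by blast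
  have blA: "bounded_linear (A y)" if "y \<in> ?B" for y using dA[OF that] has_derivative_bounded_linear by blast
  have fix_f: "f m = m" if "m \<in> M" "m \<in> ball xbar r0" for m
  proof -
    have "P m = m" using near[OF that(2)] that(1) by (metis dist_le_zero_iff dist_self)
    then show ?thesis using fP[OF that(2)] by simp
  qed
  have curve: "\<exists>c. (\<forall>\<^sub>F t in nhds 0. c t \<in> M \<inter> ?B) \<and> c 0 = m \<and> (c has_vector_derivative A m w) (at 0)"
    if m: "m \<in> M" "m \<in> ?B" for m w
  proof -
    define x where "x = (\<lambda>t::real. m + t *\<^sub>R w)"
    define c where "c = (\<lambda>t. P (x t))"
    have dx: "(x has_vector_derivative w) (at 0)"
      unfolding x_def has_vector_derivative_def by (auto intro!: derivative_eq_intros)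
    have "isCont x 0" unfolding x_def by (intro continuous_intros)
    then have xB: "\<forall>\<^sub>F t in nhds 0. x t \<in> ?B"
      by (rule isCont_eventually_in_open) (use m(2) in \<open>auto simp: x_def\<close>)
    obtain e where e: "e > 0" "\<And>t. dist t 0 < e \<Longrightarrow> x t \<in> ?B" using xB unfolding eventually_nhds_metric by blast
    have xt: "norm (x t - P (x t)) \<le> \<bar>t\<bar> * norm w" if "dist t 0 < e" for t
    proof -
      have "dist (x t) (P (x t)) \<le> dist (x t) m" using near[OF Br[OF e(2)[OF that]]] m(1) by blast
      then show ?thesis by (simp add: dist_norm x_def)
    qed
    have "((\<lambda>t. P (x t) - f (x t)) has_vector_derivative 0) (at 0)"
    proof (rule quadratic_has_vector_derivative_0[OF e(1)])
      fix t :: real assume "\<bar>t\<bar> < e"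
      then have t: "dist t 0 < e" by (simp add: dist_real_def)
      have "norm (P (x t) - f (x t)) \<le> \<mu> * (norm (x t - P (x t)))\<^sup>2"
        using fP[OF Br[OF e(2)[OF t]]] by (simp add: norm_minus_commute)
      also have "\<dots> \<le> \<mu> * (\<bar>t\<bar> * norm w)\<^sup>2"
        using xt[OF t] pos by (intro mult_left_mono power_mono) auto
      finally show "norm (P (x t) - f (x t)) \<le> (\<mu> * (norm w)\<^sup>2) * t\<^sup>2" by (simp add: power_mult_distrib mult_ac)
    qed
    moreover have "((\<lambda>t. f (x t)) has_vector_derivative A m w) (at 0)"
    proof -
      have "(f has_derivative A m) (at (x 0))" using dA[OF m(2)] by (simp add: x_def)
      from has_derivative_compose[OF dx[unfolded has_vector_derivative_def] this]
      show ?thesis unfolding has_vector_derivative_def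
        using linear_scale[OF bounded_linear.linear[OF blA[OF m(2)]]] by simp
    qed
    ultimately have "((\<lambda>t. (P (x t) - f (x t)) + f (x t)) has_vector_derivative 0 + A m w) (at 0)"
      by (rule has_vector_derivative_add)
    then have dc: "(c has_vector_derivative A m w) (at 0)" by (simp add: c_def)
    have c0: "c 0 = m" using xt[of 0] e(1) by (simp add: c_def x_def)
    have "isCont c 0" using dc has_vector_derivative_continuous by blast
    then have "\<forall>\<^sub>F t in nhds 0. c t \<in> ?B"
      by (rule isCont_eventually_in_open) (use m(2) c0 in auto)
    with xB have "\<forall>\<^sub>F t in nhds 0. c t \<in> M \<inter> ?B"
      by eventually_elim (use near Br in \<open>auto simp: c_def\<close>)
    then show ?thesis using c0 dc by blast
  qed
  have idem: "A m (A m w) = A m w" if m: "m \<in> M" "m \<in> ?B" for m w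
  proof -
    obtain c where c: "\<forall>\<^sub>F t in nhds 0. c t \<in> M \<inter> ?B" "c 0 = m" "(c has_vector_derivative A m w) (at 0)"
      using curve[OF m] by blast
    obtain T where T: "open T" "0 \<in> T" "\<And>t. t \<in> T \<Longrightarrow> c t \<in> M \<inter> ?B"
      using c(1) unfolding eventually_nhds by blast
    have "(f has_derivative A m) (at (c 0))" using dA[OF m(2)] c(2) by simp
    from has_derivative_compose[OF c(3)[unfolded has_vector_derivative_def] this]
    have "((\<lambda>t. f (c t)) has_derivative (\<lambda>h. A m (h *\<^sub>R A m w))) (at 0)" .
    then have "(c has_derivative (\<lambda>h. A m (h *\<^sub>R A m w))) (at 0)"
      by (rule has_derivative_transform_within_open[OF _ T(1,2)]) (use T(3) fix_f Br in blast)
    from has_derivative_unique[OF this c(3)[unfolded has_vector_derivative_def]]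
    have "A m (1 *\<^sub>R A m w) = 1 *\<^sub>R A m w" by metis
    then show ?thesis by simp
  qed
  have curv: "A m (b m (A m v) (A m w)) = 0" if m: "m \<in> M" "m \<in> ?B" for m v w
  proof -
    obtain c where c: "\<forall>\<^sub>F t in nhds 0. c t \<in> M \<inter> ?B" "c 0 = m" "(c has_vector_derivative A m w) (at 0)"
      using curve[OF m] by blast
    obtain T where T: "open T" "0 \<in> T" "\<And>t. t \<in> T \<Longrightarrow> c t \<in> M \<inter> ?B"
      using c(1) unfolding eventually_nhds by blast
    have Ac: "((\<lambda>t. A (c t) u) has_derivative (\<lambda>h. b m u (h *\<^sub>R A m w))) (at 0)" for u
      using has_derivative_compose[OF c(3)[unfolded has_vector_derivative_def], of "\<lambda>z. A z u" "b m u"]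
        db[OF m(2)] c(2) by simp
    let ?v = "A m v"
    have "((\<lambda>t. A (c t) (A (c t) ?v)) has_derivative
        (\<lambda>h. b m (A (c 0) ?v) (h *\<^sub>R A m w) + A (c 0) (b m ?v (h *\<^sub>R A m w)))) (at 0)"
      by (rule has_derivative_linear_family_apply[OF T(1,2) _ Ac Ac])
         (use T(3) blA lb[OF m(2)] in \<open>auto simp: linear_linear\<close>)
    then have "((\<lambda>t. A (c t) ?v) has_derivative
        (\<lambda>h. b m (A (c 0) ?v) (h *\<^sub>R A m w) + A (c 0) (b m ?v (h *\<^sub>R A m w)))) (at 0)"
      by (rule has_derivative_transform_within_open[OF _ T(1,2)]) (use T(3) idem in blast)
    from has_derivative_unique[OF this Ac]
    have "b m (A (c 0) ?v) (1 *\<^sub>R A m w) + A (c 0) (b m ?v (1 *\<^sub>R A m w)) = b m ?v (1 *\<^sub>R A m w)" by metis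
    then show ?thesis using idem[OF m] c(2) by simp
  qed
  \<comment> \<open>\<open>\<gamma> (2 \<epsilon>) \<le> 1/2\<close> turns quadratic into geometric convergence for orbits that start at distance at most
    \<open>2 \<epsilon>\<close> from their limit; such orbits stay within \<open>5 \<epsilon>\<close> of \<open>xbar\<close>.\<close>
  define \<epsilon> where "\<epsilon> = min (min (\<rho>0 / 6) r0) (min (1 / \<gamma>') (1 / (4 * \<gamma>)))"
  have \<epsilon>: "\<epsilon> > 0" "6 * \<epsilon> \<le> \<rho>0" "\<epsilon> \<le> r0" "\<epsilon> \<le> 1 / \<gamma>'" "\<epsilon> \<le> 1 / (4 * \<gamma>)"
    using AB(1) r0 pos by (auto simp: \<epsilon>_def min_le_iff_disj)
  have \<epsilon>': "\<gamma>' * \<epsilon> \<le> 1" "\<gamma> * (2 * \<epsilon>) \<le> 1 / 2"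
    using \<epsilon>(4,5) pos by (auto simp: field_simps)
  let ?S = "ball xbar \<epsilon>"
  have SB: "y \<in> ?B" if "y \<in> ?S" for y using that \<epsilon> by simp
  define \<pi> where "\<pi> = (\<lambda>y0. SOME y. y \<in> M \<and> (\<lambda>k. (f ^^ k) y0) \<longlonglongrightarrow> y \<and>
        (\<forall>k. norm ((f ^^ Suc k) y0 - y) \<le> \<gamma> * (norm ((f ^^ k) y0 - y))\<^sup>2) \<and>
        norm (y - P y0) \<le> \<gamma>' * (norm (y0 - P y0))\<^sup>2)"
  have \<pi>: "\<pi> y0 \<in> M \<and> (\<lambda>k. (f ^^ k) y0) \<longlonglongrightarrow> \<pi> y0 \<and>
        (\<forall>k. norm ((f ^^ Suc k) y0 - \<pi> y0) \<le> \<gamma> * (norm ((f ^^ k) y0 - \<pi> y0))\<^sup>2) \<and>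
        norm (\<pi> y0 - P y0) \<le> \<gamma>' * (norm (y0 - P y0))\<^sup>2" if "y0 \<in> ?S" for y0
    unfolding \<pi>_def by (rule someI_ex) (use lim[OF Br[OF SB[OF that]]] in blast)
  have est: "norm (y - \<pi> y) \<le> 2 * \<epsilon>" "norm (\<pi> y - xbar) \<le> 3 * \<epsilon>" if y: "y \<in> ?S" for y
  proof -
    have yx: "norm (y - xbar) < \<epsilon>" using y by (simp add: dist_norm norm_minus_commute)
    have "dist y (P y) \<le> dist y xbar" using near[OF Br[OF SB[OF y]]] xbar by blast
    then have yP: "norm (y - P y) \<le> \<epsilon>" using yx by (simp add: dist_norm)
    have "norm (\<pi> y - P y) \<le> \<gamma>' * (norm (y - P y))\<^sup>2" using \<pi>[OF y] by blast
    also have "\<dots> \<le> \<gamma>' * \<epsilon>\<^sup>2" using yP pos by (intro mult_left_mono power_mono) auto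
    also have "\<dots> = (\<gamma>' * \<epsilon>) * \<epsilon>" by (simp add: power2_eq_square)
    also have "\<dots> \<le> 1 * \<epsilon>" using \<epsilon>'(1) \<epsilon>(1) by (intro mult_right_mono) auto
    finally have "norm (\<pi> y - P y) \<le> \<epsilon>" by simp
    then show 1: "norm (y - \<pi> y) \<le> 2 * \<epsilon>"
      using yP norm_triangle_ineq4[of "y - P y" "\<pi> y - P y"] by simp
    show "norm (\<pi> y - xbar) \<le> 3 * \<epsilon>"
      using 1 yx norm_triangle_ineq4[of "y - xbar" "y - \<pi> y"] by simp
  qed
  have rate: "norm ((f ^^ k) y - \<pi> y) \<le> 2 * \<epsilon> / 2 ^ k" if y: "y \<in> ?S" for y k
  proof (induction k)
    case 0
    then show ?case using est(1)[OF y] by simp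
  next
    case (Suc k)
    let ?d = "norm ((f ^^ k) y - \<pi> y)"
    have d: "?d \<le> 2 * \<epsilon>" using Suc \<epsilon>(1) by (rule_tac order_trans[OF Suc]) (simp add: field_simps)
    have "norm ((f ^^ Suc k) y - \<pi> y) \<le> \<gamma> * ?d\<^sup>2" using \<pi>[OF y] by blast
    also have "\<dots> = (\<gamma> * ?d) * ?d" by (simp add: power2_eq_square)
    also have "\<dots> \<le> (1 / 2) * ?d"
    proof (rule mult_right_mono)
      show "\<gamma> * ?d \<le> 1 / 2" by (rule order_trans[OF mult_left_mono[OF d] \<epsilon>'(2)]) (use pos in simp)
    qed simp
    also have "\<dots> \<le> (1 / 2) * (2 * \<epsilon> / 2 ^ k)" using Suc by (intro mult_left_mono) auto
    finally show ?case by simp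
  qed
  have \<pi>B: "\<pi> y \<in> ?B" if y: "y \<in> ?S" for y
    using est(2)[OF y] \<epsilon> by (simp add: dist_norm norm_minus_commute)
  have orbit: "(f ^^ k) y \<in> ?B" if y: "y \<in> ?S" for y k
  proof -
    have "2 * \<epsilon> / 2 ^ k \<le> 2 * \<epsilon>" using \<epsilon>(1) by (simp add: field_simps)
    then have "norm ((f ^^ k) y - xbar) \<le> 5 * \<epsilon>"
      using rate[OF y, of k] est(2)[OF y] norm_triangle_ineq[of "(f ^^ k) y - \<pi> y" "\<pi> y - xbar"] by simp
    then show ?thesis using \<epsilon> by (simp add: dist_norm norm_minus_commute)
  qed
  interpret attracting_fixed_points f A b ?B ?S \<pi> C "2 * \<epsilon>"
  proof (rule attracting_fixed_points.intro)
    show "regular_on True 2 ?B f" by (rule regular_on_subset[OF AB(2) reg])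
    show "A (\<pi> y) (A (\<pi> y) v) = A (\<pi> y) v" if "y \<in> ?S" for y v
      using idem \<pi>[OF that] \<pi>B[OF that] by blast
    show "A (\<pi> y) (b (\<pi> y) (A (\<pi> y) v) (A (\<pi> y) w)) = 0" if "y \<in> ?S" for y v w
      using curv \<pi>[OF that] \<pi>B[OF that] by blast
    show "linear (\<lambda>v. b y v w)" if "y \<in> ?B" for y w by (rule lb[OF that])
    show "0 \<le> 2 * \<epsilon>" using \<epsilon>(1) by simp
  qed (rule open_ball convex_ball AB(3) dA db bounds orbit \<pi>B rate; assumption)+
  show thesis
  proof (rule that[OF \<epsilon>(1) _ limit_twice_differentiable])
    show "\<epsilon> \<le> r0" by (rule \<epsilon>(3))
  qed (use \<pi> in blast)
qed

section \<open>Curves that agree with a straight line to second order\<close>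

lemma smallo_dominated:
  fixes a b h g :: "'b \<Rightarrow> real"
  assumes "a \<in> o[F](g)" "b \<in> o[F](g)" "\<forall>\<^sub>F t in F. \<bar>h t\<bar> \<le> \<bar>a t\<bar> + \<bar>b t\<bar>"
  shows "h \<in> o[F](g)"
proof (rule landau_o.smallI)
  fix e :: real assume "e > 0"
  then have e: "e / 2 > 0" by simp
  from landau_o.smallD[OF assms(1) e] landau_o.smallD[OF assms(2) e] assms(3)
  show "\<forall>\<^sub>F t in F. norm (h t) \<le> e * norm (g t)"
    by eventually_elim (simp add: field_simps)
qed

lemma smallo_dominated1:
  fixes a h g :: "'b \<Rightarrow> real"
  assumes "a \<in> o[F](g)" "\<forall>\<^sub>F t in F. \<bar>h t\<bar> \<le> \<bar>a t\<bar>"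
  shows "h \<in> o[F](g)"
proof (rule landau_o.smallI)
  fix e :: real assume "e > 0"
  from landau_o.smallD[OF assms(1) this] assms(2)
  show "\<forall>\<^sub>F t in F. norm (h t) \<le> e * norm (g t)" by eventually_elim simp
qed

lemma closest_point_subspace_norm_le:
  fixes S :: "'a::euclidean_space set"
  assumes S: "subspace S"
  shows "norm (closest_point S v) \<le> norm v"
proof -
  have "closest_point S v \<bullet> closest_point S v = closest_point S v \<bullet> v"
    using closest_point_subspace_orthogonal[OF S closest_point_subspace_in[OF S], of v v]
    by (simp add: inner_diff_left inner_commute[of v])
  then have "norm (closest_point S v) * norm (closest_point S v) = closest_point S v \<bullet> v"
    by (simp add: dot_square_norm power2_eq_square)
  also have "\<dots> \<le> norm (closest_point S v) * norm v" by (rule norm_cauchy_schwarz)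
  finally show ?thesis by (cases "closest_point S v = 0") auto
qed

lemma closest_point_subspace_nested:
  fixes S :: "'a::euclidean_space set"
  assumes S: "subspace S" and T: "subspace T" and ST: "S \<subseteq> T"
  shows "closest_point S (closest_point T v) = closest_point S v"
proof (rule sym, rule closest_point_subspace_unique[OF S closest_point_subspace_in[OF S]])
  fix w assume w: "w \<in> S"
  then have "w \<in> T" using ST by blast
  from closest_point_subspace_orthogonal[OF S w, of "closest_point T v"]
    closest_point_subspace_orthogonal[OF T this, of v]
  show "(v - closest_point S (closest_point T v)) \<bullet> w = 0" by (simp add: inner_diff_left)
qed

lemma tangent_space_mono: "M \<subseteq> D \<Longrightarrow> tangent_space M x \<subseteq> tangent_space D x"
  unfolding tangent_space_def by blast

text \<open>
  The curve \<open>c\<close> satisfies the conditions on second-order retraction curves at \<open>x\<close> in direction \<open>\<eta>\<close>, for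
  tangent space \<open>T\<close>.  For \<open>\<eta> \<noteq> 0\<close> the steps that precede the Newton phase preserve this
  property, and so does the limit map of the Newton phase.
\<close>

definition second_order_curve :: "'a::euclidean_space set \<Rightarrow> 'a \<Rightarrow> 'a \<Rightarrow> (real \<Rightarrow> 'a) \<Rightarrow> bool" where
  "second_order_curve T x \<eta> c \<longleftrightarrow>
     (\<lambda>t. norm (c t - (x + t *\<^sub>R \<eta>))) \<in> o[at 0](\<lambda>t. t) \<and>
     (\<lambda>t. norm (closest_point T (c t - (x + t *\<^sub>R \<eta>)))) \<in> o[at 0](\<lambda>t. t\<^sup>2)"

lemma second_order_curve_tendsto:
  assumes "second_order_curve T x \<eta> c"
  shows "(c \<longlongrightarrow> x) (at 0)"
proof -
  have "\<forall>\<^sub>F t in at 0. norm (norm (c t - (x + t *\<^sub>R \<eta>))) \<le> 1 * norm t"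
    using assms unfolding second_order_curve_def by (intro landau_o.smallD) auto
  then have "\<forall>\<^sub>F t in at 0. norm (c t - (x + t *\<^sub>R \<eta>)) \<le> \<bar>t\<bar>" by simp
  then have "((\<lambda>t. c t - (x + t *\<^sub>R \<eta>)) \<longlongrightarrow> 0) (at 0)"
    by (rule Lim_null_comparison) (auto intro!: tendsto_eq_intros)
  moreover have "((\<lambda>t. x + t *\<^sub>R \<eta>) \<longlongrightarrow> x) (at 0)" by (auto intro!: tendsto_eq_intros)
  ultimately have "((\<lambda>t. c t - (x + t *\<^sub>R \<eta>) + (x + t *\<^sub>R \<eta>)) \<longlongrightarrow> 0 + x) (at 0)"
    by (rule tendsto_add)
  then show ?thesis by simp
qed

lemma second_order_curve_change:
  assumes T: "subspace T" and c: "second_order_curve T x \<eta> c"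
    and d1: "(\<lambda>t. norm (c' t - c t)) \<in> o[at 0](\<lambda>t. t)"
    and d2: "(\<lambda>t. norm (closest_point T (c' t - c t))) \<in> o[at 0](\<lambda>t. t\<^sup>2)"
  shows "second_order_curve T x \<eta> c'"
  unfolding second_order_curve_def
proof
  note c = c[unfolded second_order_curve_def]
  have e: "c' t - (x + t *\<^sub>R \<eta>) = (c t - (x + t *\<^sub>R \<eta>)) + (c' t - c t)" for t by simp
  have 1: "norm (c' t - (x + t *\<^sub>R \<eta>)) \<le> norm (c t - (x + t *\<^sub>R \<eta>)) + norm (c' t - c t)" for t
    unfolding e[of t] by (rule norm_triangle_ineq)
  have 2: "norm (closest_point T (c' t - (x + t *\<^sub>R \<eta>))) \<le>
      norm (closest_point T (c t - (x + t *\<^sub>R \<eta>))) + norm (closest_point T (c' t - c t))" for t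
    unfolding e[of t] linear_add[OF linear_closest_point_subspace[OF T]] by (rule norm_triangle_ineq)
  show "(\<lambda>t. norm (c' t - (x + t *\<^sub>R \<eta>))) \<in> o[at 0](\<lambda>t. t)"
    by (rule smallo_dominated[OF conjunct1[OF c] d1]) (use 1 in simp)
  show "(\<lambda>t. norm (closest_point T (c' t - (x + t *\<^sub>R \<eta>)))) \<in> o[at 0](\<lambda>t. t\<^sup>2)"
    by (rule smallo_dominated[OF conjunct2[OF c] d2]) (use 2 in simp)
qed

text \<open>
  A tangent vector is the velocity of a curve in \<open>D\<close>, so \<open>x + t \<eta>\<close> has distance \<open>o(t)\<close> from \<open>D\<close>.
\<close>

lemma tangent_vector_curve:
  assumes "\<eta> \<in> tangent_space D x"
  obtains \<gamma> where "\<forall>\<^sub>F t in at 0. \<gamma> t \<in> D" "(\<lambda>t. norm (\<gamma> t - (x + t *\<^sub>R \<eta>))) \<in> o[at 0](\<lambda>t. t)"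
proof -
  obtain c :: "real \<Rightarrow> 'a" and e where c: "e > 0" "c ` {-e<..<e} \<subseteq> D" "c 0 = x"
    "(c has_vector_derivative \<eta>) (at 0)"
    using assms unfolding tangent_space_def by blast
  have "\<forall>\<^sub>F t in at 0. c t \<in> D"
    unfolding eventually_at
  proof (intro exI[of _ e] conjI c(1) ballI impI)
    fix t :: real assume "t \<noteq> 0 \<and> dist t 0 < e"
    then have "t \<in> {-e<..<e}" by (auto simp: dist_real_def)
    then show "c t \<in> D" using c(2) by blast
  qed
  moreover have "(\<lambda>t. norm (c t - (x + t *\<^sub>R \<eta>))) \<in> o[at 0](\<lambda>t. t)"
  proof (rule landau_o.smallI)
    fix e :: real assume e: "e > 0"
    obtain d where d: "d > 0" "\<And>y. norm (y - 0) < d \<Longrightarrow>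
        norm (c y - c 0 - (y - 0) *\<^sub>R \<eta>) \<le> e * norm (y - 0)"
      using c(4) e unfolding has_vector_derivative_def has_derivative_at_alt by blast
    show "\<forall>\<^sub>F t in at 0. norm (norm (c t - (x + t *\<^sub>R \<eta>))) \<le> e * norm t"
      unfolding eventually_at
      by (intro exI[of _ d]) (use d c(3) in \<open>auto simp: diff_diff_add\<close>)
  qed
  ultimately show thesis using that by blast
qed

text \<open>
  Let \<open>z\<close> be the nearest point of \<open>c = c t\<close>.  Since \<open>D0\<close> contains a curve with velocity \<open>\<eta>\<close>, the
  distance \<open>c - z\<close> is \<open>o(t)\<close>.  It is normal at \<open>z\<close>, so with the tangent projections \<open>Q\<close> its component tangent
  at \<open>x\<close> is \<open>(Q x - Q z) (c - z)\<close>.  This is \<open>O(t) o(t)\<close> because \<open>Q\<close> is locally Lipschitz.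
\<close>

lemma (in defining_function) second_order_curve_nearest_point:
  assumes D: "D0 \<inter> V = {z \<in> V. g z = 0}" and x: "x \<in> D0" "x \<in> V" and k: "k \<noteq> 0"
    and T: "subspace T" "T \<subseteq> tangent_space D0 x" and \<eta>: "\<eta> \<in> tangent_space D0 x"
    and c: "second_order_curve T x \<eta> c"
    and near: "\<forall>\<^sub>F t in at 0. c' t \<in> D0 \<and> (\<forall>w\<in>D0. dist (c t) (c' t) \<le> dist (c t) w)"
  shows "second_order_curve T x \<eta> c'" "(\<lambda>t. norm (c' t - c t)) \<in> o[at 0](\<lambda>t. t)"
proof -
  let ?ker = "\<lambda>z. {u. D z u = 0}"
  note c1 = conjunct1[OF c[unfolded second_order_curve_def]]
  obtain \<gamma> where \<gamma>: "\<forall>\<^sub>F t in at 0. \<gamma> t \<in> D0" "(\<lambda>t. norm (\<gamma> t - (x + t *\<^sub>R \<eta>))) \<in> o[at 0](\<lambda>t. t)"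
    using tangent_vector_curve[OF \<eta>] by blast
  show d1: "(\<lambda>t. norm (c' t - c t)) \<in> o[at 0](\<lambda>t. t)"
  proof (rule smallo_dominated[OF c1 \<gamma>(2)])
    show "\<forall>\<^sub>F t in at 0. \<bar>norm (c' t - c t)\<bar> \<le>
        \<bar>norm (c t - (x + t *\<^sub>R \<eta>))\<bar> + \<bar>norm (\<gamma> t - (x + t *\<^sub>R \<eta>))\<bar>"
      using near \<gamma>(1)
    proof eventually_elim
      case (elim t)
      then have "dist (c t) (c' t) \<le> dist (c t) (\<gamma> t)" by blast
      also have "\<dots> \<le> dist (c t) (x + t *\<^sub>R \<eta>) + dist (\<gamma> t) (x + t *\<^sub>R \<eta>)" by (rule dist_triangle2)
      finally show ?case by (simp add: dist_norm norm_minus_commute)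
    qed
  qed
  obtain j where j: "k = Suc j" using k not0_implies_Suc by blast
  have ll: "locally_lipschitz V (\<lambda>z. closest_point (?ker z) i)" for i
  proof (rule differentiable_imp_locally_lipschitz[OF open_V])
    note r = regular_tangent_projection[unfolded j, of i]
    show "z \<in> V \<Longrightarrow> ((\<lambda>z. closest_point (?ker z) i) has_derivative
        frechet_derivative (\<lambda>z. closest_point (?ker z) i) (at z)) (at z)" for z
      by (rule regular_on_SucD(1)[OF r])
    show "continuous_on V (\<lambda>z. frechet_derivative (\<lambda>z. closest_point (?ker z) i) (at z) v)" for v
      by (rule regular_on_imp_continuous_on[OF regular_on_SucD(2)[OF r]])
  qed
  obtain \<rho> L where L: "\<rho> > 0" "L \<ge> 0" "ball x \<rho> \<subseteq> V"
    "\<And>i y z. i \<in> Basis \<Longrightarrow> y \<in> ball x \<rho> \<Longrightarrow> z \<in> ball x \<rho> \<Longrightarrow>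
       norm (closest_point (?ker y) i - closest_point (?ker z) i) \<le> L * dist y z"
    using finite_family_lipschitz_ball[OF finite_Basis open_V x(2), of "\<lambda>i z. closest_point (?ker z) i", OF ll]
    by metis
  have sker: "subspace (?ker z)" if "z \<in> V" for z
    by (rule linear_subspace_kernel[OF linear_D[OF that]])
  have blker: "bounded_linear (closest_point (?ker z))" if "z \<in> V" for z
    using linear_closest_point_subspace[OF sker[OF that]] linear_linear by blast
  have Tker: "T \<subseteq> ?ker x" using T(2) tangent_space_eq_kernel[OF D x k] by simp
  have c'x: "(c' \<longlongrightarrow> x) (at 0)"
  proof -
    have "((\<lambda>t. c' t - c t) \<longlongrightarrow> 0) (at 0)"
    proof (rule Lim_null_comparison)
      show "\<forall>\<^sub>F t in at 0. norm (c' t - c t) \<le> \<bar>t\<bar>"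
        using landau_o.smallD[OF d1, of 1] by simp
      show "((\<lambda>t::real. \<bar>t\<bar>) \<longlongrightarrow> 0) (at 0)" by (auto intro!: tendsto_eq_intros)
    qed
    from tendsto_add[OF this second_order_curve_tendsto[OF c]] show ?thesis by simp
  qed
  have "(\<lambda>t. norm (closest_point T (c' t - c t))) \<in> o[at 0](\<lambda>t. t\<^sup>2)"
  proof (rule landau_o.smallI)
    fix e :: real assume e: "e > 0"
    \<comment> \<open>\<open>norm \<eta> + 2\<close> bounds \<open>\<parallel>c' t - x\<parallel> / \<bar>t\<bar>\<close> near \<open>t = 0\<close>.\<close>
    define d where "d = real DIM('a) * L * (norm \<eta> + 2)"
    have d: "d \<ge> 0" using L by (simp add: d_def)
    define e' where "e' = e / (d + 1)"
    have e': "e' > 0" using e d by (simp add: e'_def)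
    have small: "\<forall>\<^sub>F t in at 0. norm (c' t - c t) \<le> e' * \<bar>t\<bar>"
      using landau_o.smallD[OF d1 e'] by simp
    have one: "\<forall>\<^sub>F t in at 0. norm (c' t - c t) \<le> \<bar>t\<bar>" "\<forall>\<^sub>F t in at 0. norm (c t - (x + t *\<^sub>R \<eta>)) \<le> \<bar>t\<bar>"
      using landau_o.smallD[OF d1, of 1] landau_o.smallD[OF c1, of 1] by simp_all
    have inball: "\<forall>\<^sub>F t in at 0. c' t \<in> ball x \<rho>"
      using topological_tendstoD[OF c'x open_ball, of x \<rho>] L(1) by simp
    show "\<forall>\<^sub>F t in at 0. norm (norm (closest_point T (c' t - c t))) \<le> e * norm (t\<^sup>2)"
      using small one inball near
    proof eventually_elim
      case (elim t)
      let ?z = "c' t" and ?v = "c t - c' t"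
      have zV: "?z \<in> V" and xb: "x \<in> ball x \<rho>" using elim L by auto
      have kz: "?ker ?z = tangent_space D0 ?z" using tangent_space_eq_kernel[OF D _ zV k] elim by simp
      have Qz: "closest_point (?ker ?z) ?v = 0"
        by (rule closest_point_subspace_unique[OF sker[OF zV]])
           (use nearest_point_orthogonal_tangent[of D0 "c t" ?z] elim linear_0[OF linear_D[OF zV]] kz in auto)
      have zx: "dist x ?z \<le> (norm \<eta> + 2) * \<bar>t\<bar>"
      proof -
        define p q r where "p = ?z - c t" and "q = c t - (x + t *\<^sub>R \<eta>)" and "r = t *\<^sub>R \<eta>"
        have "?z - x = p + q + r" by (simp add: p_def q_def r_def)
        then have "norm (?z - x) \<le> norm p + norm q + norm r"
          using norm_triangle_ineq[of "p + q" r] norm_triangle_ineq[of p q] by simp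
        moreover have "norm p \<le> \<bar>t\<bar>" "norm q \<le> \<bar>t\<bar>" "norm r = \<bar>t\<bar> * norm \<eta>"
          using elim by (auto simp: p_def q_def r_def)
        ultimately show ?thesis by (simp add: dist_norm norm_minus_commute algebra_simps)
      qed
      have "closest_point T (c' t - c t) = - closest_point T ?v"
        using linear_neg[OF linear_closest_point_subspace[OF T(1)], of ?v] by simp
      then have "norm (closest_point T (c' t - c t)) = norm (closest_point T (closest_point (?ker x) ?v))"
        using closest_point_subspace_nested[OF T(1) sker[OF x(2)] Tker, of ?v] by simp
      also have "\<dots> \<le> norm (closest_point (?ker x) ?v - closest_point (?ker ?z) ?v)"
        using closest_point_subspace_norm_le[OF T(1)] Qz by simp
      also have "\<dots> \<le> real DIM('a) * (L * dist x ?z) * norm ?v"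
        by (rule norm_le_basis_bound[OF bounded_linear_sub[OF blker[OF x(2)] blker[OF zV]]])
           (use L(4) elim xb in blast)
      also have "\<dots> \<le> real DIM('a) * (L * ((norm \<eta> + 2) * \<bar>t\<bar>)) * (e' * \<bar>t\<bar>)"
        using zx elim(1) L(2) e' by (intro mult_mono mult_left_mono) (auto simp: norm_minus_commute)
      also have "\<dots> = (d * e') * t\<^sup>2" by (simp add: d_def power2_eq_square abs_mult_self_eq mult_ac)
      also have "\<dots> \<le> e * t\<^sup>2" using d e by (intro mult_right_mono) (auto simp: e'_def field_simps)
      finally show ?case by simp
    qed
  qed
  then show "second_order_curve T x \<eta> c'" by (rule second_order_curve_change[OF T(1) c d1])
qed

lemma submanifold_defining_function:
  assumes "Ck1_submanifold_at p M x" "p > 0"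
  obtains V W g where "defining_function V W g True (p - 1)" "x \<in> V" "M \<inter> V = {y \<in> V. g y = 0}"
proof -
  obtain V W and g :: "'a \<Rightarrow> 'a" where *: "open V" "x \<in> V" "subspace W" "g ` V \<subseteq> W" "Ck1_on p V g"
    "\<forall>y\<in>V. range (frechet_derivative g (at y)) = W" "M \<inter> V = {y \<in> V. g y = 0}"
    using assms(1) unfolding Ck1_submanifold_at_def by blast
  have "defining_function V W g True (p - 1)"
    by unfold_locales (use * assms(2) in \<open>auto simp: regular_on_def\<close>)
  then show thesis using that * by blast
qed

lemma submanifold_tangent_subspace:
  assumes "Ck1_submanifold_at p M x" "p \<ge> 2"
  obtains V where "open V" "x \<in> V" "\<And>y. y \<in> M \<inter> V \<Longrightarrow> subspace (tangent_space M y)"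
proof -
  obtain V W g where d: "defining_function V W g True (p - 1)" "x \<in> V" "M \<inter> V = {y \<in> V. g y = 0}"
    using submanifold_defining_function[OF assms(1)] assms(2) by auto
  interpret defining_function V W g True "p - 1" by fact
  have "subspace (tangent_space M y)" if "y \<in> M \<inter> V" for y
    using tangent_space_eq_kernel[OF d(3), of y] linear_subspace_kernel[OF linear_D[of y]] that assms(2) by auto
  then show thesis using that open_V d(2) by blast
qed

text \<open>
  A map that is defined (in the sense of \<open>d\<close>) and \<open>C\<^sup>2\<close> near \<open>xbar\<close>, fixes \<open>M\<close>, and preserves second-order
  curves at the points of \<open>M\<close>.  For \<open>xbar\<close> in \<open>M\<close> this gives \<open>h xbar = xbar\<close>, which makes the class closed under
  composition without any control of the neighbourhoods.
\<close>

definition second_order_step ::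
  "'a::euclidean_space set \<Rightarrow> 'a \<Rightarrow> ('a \<Rightarrow> bool) \<Rightarrow> ('a \<Rightarrow> 'a) \<Rightarrow> bool" where
  "second_order_step M xbar d h \<longleftrightarrow>
     (\<exists>B. open B \<and> xbar \<in> B \<and> regular_on False 2 B h \<and> (\<forall>y\<in>B. d y) \<and>
        (\<forall>m\<in>M \<inter> B. h m = m \<and>
           (\<forall>\<eta>\<in>tangent_space M m - {0}. \<forall>c. second_order_curve (tangent_space M m) m \<eta> c \<longrightarrow>
              second_order_curve (tangent_space M m) m \<eta> (\<lambda>t. h (c t)))))"

lemma second_order_step_ident: "second_order_step M xbar (\<lambda>y. True) (\<lambda>y. y)"
  unfolding second_order_step_def
  by (rule exI[of _ UNIV]) (simp add: regular_on_bounded_linear)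

lemma second_order_step_compose:
  assumes xbar: "xbar \<in> M" and h1: "second_order_step M xbar d1 h1" and h2: "second_order_step M xbar d2 h2"
  shows "second_order_step M xbar (\<lambda>y. d1 y \<and> d2 (h1 y)) (\<lambda>y. h2 (h1 y))"
proof -
  obtain B1 where B1: "open B1" "xbar \<in> B1" "regular_on False 2 B1 h1" "\<forall>y\<in>B1. d1 y"
    and m1: "\<And>m. m \<in> M \<inter> B1 \<Longrightarrow> h1 m = m"
      "\<And>m \<eta> c. \<lbrakk>m \<in> M \<inter> B1; \<eta> \<in> tangent_space M m - {0}; second_order_curve (tangent_space M m) m \<eta> c\<rbrakk> \<Longrightarrow>
         second_order_curve (tangent_space M m) m \<eta> (\<lambda>t. h1 (c t))"
    using h1 unfolding second_order_step_def by blast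
  obtain B2 where B2: "open B2" "xbar \<in> B2" "regular_on False 2 B2 h2" "\<forall>y\<in>B2. d2 y"
    and m2: "\<And>m. m \<in> M \<inter> B2 \<Longrightarrow> h2 m = m"
      "\<And>m \<eta> c. \<lbrakk>m \<in> M \<inter> B2; \<eta> \<in> tangent_space M m - {0}; second_order_curve (tangent_space M m) m \<eta> c\<rbrakk> \<Longrightarrow>
         second_order_curve (tangent_space M m) m \<eta> (\<lambda>t. h2 (c t))"
    using h2 unfolding second_order_step_def by blast
  define B where "B = h1 -` B2 \<inter> B1"
  have oB: "open B"
    unfolding B_def using continuous_on_open_vimage[OF B1(1)] regular_on_imp_continuous_on[OF B1(3)] B2(1) by blast
  have "h1 xbar = xbar" using m1(1) xbar B1(2) by blast
  then have xB: "xbar \<in> B" using B1 B2 by (simp add: B_def)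
  have MB: "m \<in> M \<inter> B1" "m \<in> M \<inter> B2" if "m \<in> M \<inter> B" for m
  proof -
    show "m \<in> M \<inter> B1" using that by (simp add: B_def)
    from m1(1)[OF this] show "m \<in> M \<inter> B2" using that by (simp add: B_def)
  qed
  have "regular_on False 2 B (\<lambda>y. h2 (h1 y))"
    by (rule regular_on_compose[OF B2(1) oB _ B2(3) regular_on_subset[OF _ B1(3)]]) (auto simp: B_def)
  moreover have "\<forall>y\<in>B. d1 y \<and> d2 (h1 y)" using B1(4) B2(4) by (simp add: B_def)
  ultimately show ?thesis
    unfolding second_order_step_def using oB xB m1 m2 MB by (intro exI[of _ B]) simp
qed

text \<open>
  \<open>D\<close> may be larger than \<open>M\<close>: the lemma serves the alternating projections, for \<open>D\<close> equal to \<open>M1\<close> and to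
  \<open>M2\<close>, as well as the projection onto \<open>M\<close>.
\<close>

lemma second_order_step_nearest_point:
  fixes M D :: "'a::euclidean_space set"
  assumes D: "Ck1_submanifold_at p D xbar" and p: "p \<ge> 3" and MD: "M \<subseteq> D" and xbar: "xbar \<in> M"
    and V0: "open V0" "xbar \<in> V0" "\<And>m. m \<in> M \<inter> V0 \<Longrightarrow> subspace (tangent_space M m)"
    and B0: "open B0" "xbar \<in> B0" "\<And>y. y \<in> B0 \<Longrightarrow> P y \<in> D \<and> (\<forall>w\<in>D. dist y (P y) \<le> dist y w)"
      "\<And>y. y \<in> B0 \<Longrightarrow> d y"
  shows "second_order_step M xbar d P"
    and "\<exists>B. open B \<and> xbar \<in> B \<and> (\<forall>m\<in>M \<inter> B. \<forall>\<eta>\<in>tangent_space M m. \<forall>c.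
      second_order_curve (tangent_space M m) m \<eta> c \<longrightarrow> (\<lambda>t. norm (P (c t) - c t)) \<in> o[at 0](\<lambda>t. t))"
proof -
  obtain V W g where df: "defining_function V W g True (p - 1)" "xbar \<in> V" "D \<inter> V = {y \<in> V. g y = 0}"
    using submanifold_defining_function[OF D] p by auto
  interpret defining_function V W g True "p - 1" by fact
  have k: "p - 1 \<noteq> 0" using p by simp
  obtain \<epsilon> where \<epsilon>: "\<epsilon> > 0" "\<And>S P. \<lbrakk>open S; S \<subseteq> ball xbar \<epsilon>;
       \<And>x. x \<in> S \<Longrightarrow> P x \<in> D \<and> (\<forall>w\<in>D. dist x (P x) \<le> dist x w)\<rbrakk> \<Longrightarrow> regular_on True (p - 1) S P"
    using regular_nearest_point[OF df(3) _ df(2) k] xbar MD by (metis subsetD)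
  define B where "B = B0 \<inter> V0 \<inter> V \<inter> ball xbar \<epsilon>"
  have B: "open B" "xbar \<in> B" using B0 V0 open_V df(2) \<epsilon>(1) by (auto simp: B_def)
  have "regular_on True (p - 1) B P"
    by (rule \<epsilon>(2)[OF B(1)]) (use B0(3) in \<open>auto simp: B_def\<close>)
  then have "regular_on True 2 B P" by (rule regular_on_le[OF B(1), rotated]) (use p in simp)
  then have reg: "regular_on False 2 B P" by (rule regular_on_forget_lipschitz[OF B(1)])
  have curve: "second_order_curve (tangent_space M m) m \<eta> (\<lambda>t. P (c t))"
    "(\<lambda>t. norm (P (c t) - c t)) \<in> o[at 0](\<lambda>t. t)"
    if m: "m \<in> M \<inter> B" and \<eta>: "\<eta> \<in> tangent_space M m" and c: "second_order_curve (tangent_space M m) m \<eta> c"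
    for m \<eta> c
  proof -
    have "\<forall>\<^sub>F t in at 0. c t \<in> B0"
      using topological_tendstoD[OF second_order_curve_tendsto[OF c] B0(1)] m by (simp add: B_def)
    then have near: "\<forall>\<^sub>F t in at 0. P (c t) \<in> D \<and> (\<forall>w\<in>D. dist (c t) (P (c t)) \<le> dist (c t) w)"
      by (rule eventually_mono) (rule B0(3))
    have mD: "m \<in> D" "m \<in> V" and T: "subspace (tangent_space M m)"
      using m MD V0(3) by (auto simp: B_def)
    note sub = tangent_space_mono[OF MD, of m]
    show "second_order_curve (tangent_space M m) m \<eta> (\<lambda>t. P (c t))"
      "(\<lambda>t. norm (P (c t) - c t)) \<in> o[at 0](\<lambda>t. t)"
      by (rule second_order_curve_nearest_point[OF df(3) mD k T sub subsetD[OF sub \<eta>] c near])+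
  qed
  have "P m = m" if "m \<in> M \<inter> B" for m
  proof -
    have "m \<in> B0" "m \<in> D" using that MD by (auto simp: B_def)
    then have "dist m (P m) \<le> dist m m" using B0(3) by blast
    then show ?thesis by simp
  qed
  then show "second_order_step M xbar d P"
    unfolding second_order_step_def using B reg curve(1) B0(4) by (intro exI[of _ B]) (auto simp: B_def)
  show "\<exists>B. open B \<and> xbar \<in> B \<and> (\<forall>m\<in>M \<inter> B. \<forall>\<eta>\<in>tangent_space M m. \<forall>c.
      second_order_curve (tangent_space M m) m \<eta> c \<longrightarrow> (\<lambda>t. norm (P (c t) - c t)) \<in> o[at 0](\<lambda>t. t))"
    using B curve(2) by blast
qed

lemma square_smallo_ident: "(\<lambda>t. t\<^sup>2) \<in> o[at 0](\<lambda>t::real. t)"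
proof (rule landau_o.smallI)
  fix e :: real assume e: "e > 0"
  show "\<forall>\<^sub>F t in at 0. norm (t\<^sup>2) \<le> e * norm (t::real)"
    unfolding eventually_at
  proof (intro exI[of _ e] conjI e ballI impI)
    fix t :: real assume "t \<noteq> 0 \<and> dist t 0 < e"
    then have "\<bar>t\<bar> * \<bar>t\<bar> \<le> e * \<bar>t\<bar>" by (intro mult_right_mono) (auto simp: dist_real_def)
    then show "norm (t\<^sup>2) \<le> e * norm t" by (simp add: power2_eq_square)
  qed
qed

text \<open>
  Write \<open>u = c t - x = t \<eta> + w\<close> with \<open>w = o(t)\<close>.  As \<open>\<eta>\<close> is tangent and nonzero, the normal part of \<open>u\<close> is
  \<open>o(\<parallel>u\<parallel>)\<close>, so the remainder estimates apply along the filter of pairs \<open>(x, u t)\<close>.  The remainder \<open>R\<^sub>N\<close> has no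
  component in \<open>T\<close>, and \<open>R\<^sub>T = o(t\<^sup>2)\<close>; hence \<open>\<phi>\<close> changes the component in \<open>T\<close> by \<open>o(t\<^sup>2)\<close> only.
\<close>

lemma second_order_curve_decomposition:
  fixes D :: "'a::euclidean_space set"
  assumes dec: "tangent_normal_decomposition p D \<phi> K \<delta>" and \<delta>: "\<delta> > 0"
    and x: "x \<in> K" and TD: "subspace (tangent_space D x)"
    and T: "subspace T" "T \<subseteq> tangent_space D x" and \<eta>: "\<eta> \<in> T" "\<eta> \<noteq> 0"
    and c: "second_order_curve T x \<eta> c"
  shows "second_order_curve T x \<eta> (\<lambda>t. \<phi> (c t))"
proof -
  let ?TD = "tangent_space D x" and ?ND = "normal_space D x"
  note c1 = conjunct1[OF c[unfolded second_order_curve_def]]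
    and c2 = conjunct2[OF c[unfolded second_order_curve_def]]
  obtain RN RT where
    R: "\<And>x u. x \<in> K \<Longrightarrow> u \<in> ball 0 \<delta> \<Longrightarrow>
          RN (x, u) \<in> normal_space D x \<and> RT (x, u) \<in> tangent_space D x \<and>
          \<phi> (x + u) = x + closest_point (tangent_space D x) u + RN (x, u) + RT (x, u)"
    and RO: "\<And>F :: ('a \<times> 'a) filter. (\<forall>\<^sub>F (x, u) in F. x \<in> K \<and> x + u \<in> tube K \<delta>) \<Longrightarrow>
           filterlim snd (nhds 0) F \<Longrightarrow>
           (\<lambda>(x, u). norm (closest_point (normal_space D x) u)) \<in> o[F](\<lambda>(x, u). norm u) \<Longrightarrow>
           (\<lambda>(x, u). norm (RN (x, u))) \<in> O[F](\<lambda>(x, u). (norm u)\<^sup>2) \<and>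
           (\<lambda>(x, u). norm (RT (x, u))) \<in> o[F](\<lambda>(x, u). (norm u)\<^sup>2)"
    using dec unfolding tangent_normal_decomposition_def by blast
  define u where "u = (\<lambda>t. c t - x)"
  define w where "w = (\<lambda>t. c t - (x + t *\<^sub>R \<eta>))"
  have uw: "u t = w t + t *\<^sub>R \<eta>" for t by (simp add: u_def w_def)
  define F where "F = filtermap (\<lambda>t. (x, u t)) (at 0)"
  have u0: "(u \<longlongrightarrow> 0) (at 0)"
    using tendsto_diff[OF second_order_curve_tendsto[OF c] tendsto_const[of x]] by (simp add: u_def)
  have uball: "\<forall>\<^sub>F t in at 0. u t \<in> ball 0 \<delta>"
    by (rule topological_tendstoD[OF u0]) (use \<delta> in auto)
  have F1: "\<forall>\<^sub>F (x, u) in F. x \<in> K \<and> x + u \<in> tube K \<delta>"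
    unfolding F_def eventually_filtermap using uball
  proof eventually_elim
    case (elim t)
    have "infdist (x + u t) K \<le> dist (x + u t) x" by (rule infdist_le[OF x])
    then show ?case using elim x by (simp add: tube_def dist_norm)
  qed
  have F2: "filterlim snd (nhds 0) F"
    unfolding F_def filterlim_filtermap using u0 by simp
  have sN: "subspace ?ND" unfolding normal_space_def by (rule subspace_orthogonal_comp)
  have orth: "a \<bullet> b = 0" if "a \<in> ?ND" "b \<in> ?TD" for a b
    using that unfolding normal_space_def orthogonal_comp_def orthogonal_def by (simp add: inner_commute[of a])
  have Nt: "closest_point ?ND (t *\<^sub>R \<eta>) = 0" for t
  proof (rule closest_point_subspace_unique[OF sN subspace_0[OF sN]])
    fix a assume "a \<in> ?ND"
    moreover have "t *\<^sub>R \<eta> \<in> ?TD" using subspace_scale[OF TD] \<eta>(1) T(2) by blast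
    ultimately have "a \<bullet> (t *\<^sub>R \<eta>) = 0" by (rule orth)
    then show "(t *\<^sub>R \<eta> - 0) \<bullet> a = 0" by (metis diff_zero inner_commute)
  qed
  have w1: "\<forall>\<^sub>F t in at 0. norm (w t) \<le> e * \<bar>t\<bar>" if "e > 0" for e
    using landau_o.smallD[OF c1 that] by (simp add: w_def)
  have ubig: "\<forall>\<^sub>F t in at 0. \<bar>t\<bar> * (norm \<eta> / 2) \<le> norm (u t)"
  proof -
    have "norm \<eta> / 2 > 0" using \<eta>(2) by simp
    from w1[OF this] show ?thesis
    proof eventually_elim
      case (elim t)
      have "\<bar>t\<bar> * norm \<eta> \<le> norm (u t) + norm (w t)"
        using norm_triangle_ineq4[of "u t" "w t"] by (simp add: uw)
      then show ?case using elim by (simp add: algebra_simps)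
    qed
  qed
  have usmall: "\<forall>\<^sub>F t in at 0. norm (u t) \<le> (norm \<eta> + 1) * \<bar>t\<bar>"
    using w1[of 1, simplified]
  proof eventually_elim
    case (elim t)
    then show ?case using norm_triangle_ineq[of "w t" "t *\<^sub>R \<eta>"] by (simp add: uw algebra_simps)
  qed
  have "(\<lambda>t. norm (closest_point ?ND (u t))) \<in> o[at 0](\<lambda>t. norm (u t))"
  proof (rule landau_o.smallI)
    fix e :: real assume e: "e > 0"
    then have "e * (norm \<eta> / 2) > 0" using \<eta>(2) by simp
    from w1[OF this] ubig
    show "\<forall>\<^sub>F t in at 0. norm (norm (closest_point ?ND (u t))) \<le> e * norm (norm (u t))"
    proof eventually_elim
      case (elim t)
      have "closest_point ?ND (u t) = closest_point ?ND (w t)"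
        unfolding uw linear_add[OF linear_closest_point_subspace[OF sN]] Nt by simp
      then have "norm (closest_point ?ND (u t)) \<le> norm (w t)"
        using closest_point_subspace_norm_le[OF sN] by simp
      also have "\<dots> \<le> e * (\<bar>t\<bar> * (norm \<eta> / 2))" using elim(1) by (simp add: mult_ac)
      also have "\<dots> \<le> e * norm (u t)" using elim(2) e by (intro mult_left_mono) auto
      finally show ?case by simp
    qed
  qed
  then have F3: "(\<lambda>(x, u). norm (closest_point (normal_space D x) u)) \<in> o[F](\<lambda>(x, u). norm u)"
    unfolding F_def smallo_def eventually_filtermap by simp
  note RO' = RO[OF F1 F2 F3]
  have RN: "(\<lambda>t. norm (RN (x, u t))) \<in> O[at 0](\<lambda>t. (norm (u t))\<^sup>2)"
    using conjunct1[OF RO'] unfolding F_def bigo_def eventually_filtermap by simp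
  have RT: "(\<lambda>t. norm (RT (x, u t))) \<in> o[at 0](\<lambda>t. (norm (u t))\<^sup>2)"
    using conjunct2[OF RO'] unfolding F_def smallo_def eventually_filtermap by simp
  have u2: "(\<lambda>t. (norm (u t))\<^sup>2) \<in> O[at 0](\<lambda>t. t\<^sup>2)"
  proof (rule bigoI[of _ "(norm \<eta> + 1)\<^sup>2"])
    show "\<forall>\<^sub>F t in at 0. norm ((norm (u t))\<^sup>2) \<le> (norm \<eta> + 1)\<^sup>2 * norm (t\<^sup>2)"
      using usmall
    proof eventually_elim
      case (elim t)
      from power_mono[OF elim, of 2] show ?case by (simp add: power_mult_distrib)
    qed
  qed
  have RN1: "(\<lambda>t. norm (RN (x, u t))) \<in> o[at 0](\<lambda>t. t)"
    by (rule landau_o.big_small_trans[OF landau_o.big_trans[OF RN u2] square_smallo_ident])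
  have RT2: "(\<lambda>t. norm (RT (x, u t))) \<in> o[at 0](\<lambda>t. t\<^sup>2)"
    by (rule landau_o.small_big_trans[OF RT u2])
  have RT1: "(\<lambda>t. norm (RT (x, u t))) \<in> o[at 0](\<lambda>t. t)"
    by (rule landau_o.small_trans[OF RT2 square_smallo_ident])
  have R12: "(\<lambda>t. norm (RN (x, u t)) + norm (RT (x, u t))) \<in> o[at 0](\<lambda>t. t)"
    by (rule sum_in_smallo(1)[OF RN1 RT1])
  have form: "\<phi> (c t) - (x + t *\<^sub>R \<eta>) = closest_point ?TD (w t) + RN (x, u t) + RT (x, u t)"
    if "u t \<in> ball 0 \<delta>" for t
  proof -
    have "t *\<^sub>R \<eta> \<in> ?TD" using subspace_scale[OF TD] \<eta>(1) T(2) by blast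
    then have "closest_point ?TD (u t) = closest_point ?TD (w t) + t *\<^sub>R \<eta>"
      unfolding uw linear_add[OF linear_closest_point_subspace[OF TD]] by (simp add: closest_point_self)
    moreover have "\<phi> (c t) = \<phi> (x + u t)" by (simp add: u_def)
    ultimately show ?thesis using R[OF x that] by simp
  qed
  show ?thesis
    unfolding second_order_curve_def
  proof
    show "(\<lambda>t. norm (\<phi> (c t) - (x + t *\<^sub>R \<eta>))) \<in> o[at 0](\<lambda>t. t)"
    proof (rule smallo_dominated[OF c1 R12])
      show "\<forall>\<^sub>F t in at 0. \<bar>norm (\<phi> (c t) - (x + t *\<^sub>R \<eta>))\<bar> \<le>
          \<bar>norm (c t - (x + t *\<^sub>R \<eta>))\<bar> + \<bar>norm (RN (x, u t)) + norm (RT (x, u t))\<bar>"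
        using uball
      proof eventually_elim
        case (elim t)
        show ?case
          unfolding form[OF elim] w_def[symmetric]
          using norm_triangle_ineq[of "closest_point ?TD (w t) + RN (x, u t)" "RT (x, u t)"]
            norm_triangle_ineq[of "closest_point ?TD (w t)" "RN (x, u t)"]
            closest_point_subspace_norm_le[OF TD, of "w t"]
          by (simp add: w_def)
      qed
    qed
    show "(\<lambda>t. norm (closest_point T (\<phi> (c t) - (x + t *\<^sub>R \<eta>)))) \<in> o[at 0](\<lambda>t. t\<^sup>2)"
    proof (rule smallo_dominated[OF c2 RT2])
      show "\<forall>\<^sub>F t in at 0. \<bar>norm (closest_point T (\<phi> (c t) - (x + t *\<^sub>R \<eta>)))\<bar> \<le>
          \<bar>norm (closest_point T (c t - (x + t *\<^sub>R \<eta>)))\<bar> + \<bar>norm (RT (x, u t))\<bar>"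
        using uball
      proof eventually_elim
        case (elim t)
        have RN0: "closest_point T (RN (x, u t)) = 0"
          by (rule closest_point_subspace_unique[OF T(1) subspace_0[OF T(1)]])
             (use orth R[OF x elim] T(2) in auto)
        have e: "closest_point T (\<phi> (c t) - (x + t *\<^sub>R \<eta>)) = closest_point T (w t) + closest_point T (RT (x, u t))"
          unfolding form[OF elim] linear_add[OF linear_closest_point_subspace[OF T(1)]] RN0
            closest_point_subspace_nested[OF T(1) TD T(2)] by simp
        show ?case unfolding e
          using norm_triangle_ineq[of "closest_point T (w t)" "closest_point T (RT (x, u t))"]
            closest_point_subspace_norm_le[OF T(1), of "RT (x, u t)"]
          by (simp add: w_def)
      qed
    qed
  qed
qed

text \<open>
  The remainder estimates along the principal filter at \<open>(x, 0)\<close> read \<open>\<parallel>R (x, 0)\<parallel> \<le> C 0\<close>.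
\<close>

lemma decomposition_fixes:
  assumes dec: "tangent_normal_decomposition p D \<phi> K \<delta>" and \<delta>: "\<delta> > 0" and x: "x \<in> K"
    and TD: "subspace (tangent_space D x)"
  shows "\<phi> x = x"
proof -
  obtain RN RT where
    R: "\<And>x u. x \<in> K \<Longrightarrow> u \<in> ball 0 \<delta> \<Longrightarrow>
          \<phi> (x + u) = x + closest_point (tangent_space D x) u + RN (x, u) + RT (x, u)"
    and RO: "\<And>F :: ('a \<times> 'a) filter. (\<forall>\<^sub>F (x, u) in F. x \<in> K \<and> x + u \<in> tube K \<delta>) \<Longrightarrow>
           filterlim snd (nhds 0) F \<Longrightarrow>
           (\<lambda>(x, u). norm (closest_point (normal_space D x) u)) \<in> o[F](\<lambda>(x, u). norm u) \<Longrightarrow>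
           (\<lambda>(x, u). norm (RN (x, u) :: 'a)) \<in> O[F](\<lambda>(x, u). (norm u)\<^sup>2) \<and>
           (\<lambda>(x, u). norm (RT (x, u) :: 'a)) \<in> o[F](\<lambda>(x, u). (norm u)\<^sup>2)"
    using dec unfolding tangent_normal_decomposition_def by blast
  define F where "F = principal {(x, 0 :: 'a)}"
  have sN: "subspace (normal_space D x)" unfolding normal_space_def by (rule subspace_orthogonal_comp)
  have "infdist x K = 0" using x by simp
  then have F1: "\<forall>\<^sub>F (x, u) in F. x \<in> K \<and> x + u \<in> tube K \<delta>"
    using x \<delta> by (simp add: F_def eventually_principal tube_def)
  have F2: "filterlim snd (nhds 0) F"
    unfolding F_def filterlim_iff by (auto simp: eventually_principal dest: eventually_nhds_x_imp_x)
  have F3: "(\<lambda>(x, u). norm (closest_point (normal_space D x) u)) \<in> o[F](\<lambda>(x, u). norm u)"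
    unfolding F_def smallo_def using linear_0[OF linear_closest_point_subspace[OF sN]]
    by (simp add: eventually_principal)
  note RO' = RO[OF F1 F2 F3]
  have "RN (x, 0) = 0" using conjunct1[OF RO'] unfolding F_def bigo_def by (auto simp: eventually_principal)
  moreover have "RT (x, 0) = 0"
    using landau_o.smallD[OF conjunct2[OF RO'], of 1] unfolding F_def by (simp add: eventually_principal)
  ultimately show ?thesis
    using R[OF x, of 0] \<delta> linear_0[OF linear_closest_point_subspace[OF TD]] by simp
qed

text \<open>
  \<open>M\<close> is not assumed to be closed, but the points outside the ball are farther from \<open>x\<close> than \<open>a\<close> is.
\<close>

lemma locally_compact_nearest_point:
  fixes M :: "'a::euclidean_space set"
  assumes "compact (M \<inter> cball a e)" "e > 0" "a \<in> M" and x: "x \<in> ball a (e / 2)"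
  shows "closest_point M x \<in> M \<and> (\<forall>w\<in>M. dist x (closest_point M x) \<le> dist x w)"
proof -
  let ?C = "M \<inter> cball a e"
  have ne: "?C \<noteq> {}" using assms(2,3) by auto
  obtain z where z: "z \<in> ?C" "\<And>w. w \<in> ?C \<Longrightarrow> dist x z \<le> dist x w"
    using distance_attains_inf[OF compact_imp_closed[OF assms(1)] ne] by metis
  have "dist x z \<le> dist x w" if w: "w \<in> M" for w
  proof (cases "w \<in> cball a e")
    case True
    then show ?thesis using z(2) w by blast
  next
    case False
    have "dist x z \<le> dist x a" using z(2)[of a] assms(2,3) by simp
    moreover have "dist a w \<le> dist x a + dist x w" using dist_triangle3[of a w x] by (simp add: add.commute)
    ultimately show ?thesis using False x by (auto simp: dist_commute)
  qed
  then have "\<exists>z. z \<in> M \<and> (\<forall>w\<in>M. dist x z \<le> dist x w)" using z(1) by blast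
  then show ?thesis unfolding closest_point_def by (rule someI_ex)
qed

lemma second_order_stepE:
  assumes "second_order_step M xbar d h"
  obtains B where "open B" "xbar \<in> B" "regular_on False 2 B h" "\<And>y. y \<in> B \<Longrightarrow> d y"
    "\<And>m. m \<in> M \<inter> B \<Longrightarrow> h m = m \<and>
      (\<forall>\<eta>\<in>tangent_space M m - {0}. \<forall>c. second_order_curve (tangent_space M m) m \<eta> c \<longrightarrow>
         second_order_curve (tangent_space M m) m \<eta> (\<lambda>t. h (c t)))"
  using assms unfolding second_order_step_def by meson

lemma second_order_step_mono:
  "second_order_step M xbar d h \<Longrightarrow> (\<And>y. d y \<Longrightarrow> d' y) \<Longrightarrow> second_order_step M xbar d' h"
  unfolding second_order_step_def by meson

text \<open>
  This is how the Newton limit \<open>\<pi>\<close> inherits the second-order property from the projection onto \<open>M\<close>: the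
  two differ quadratically in the distance from \<open>M\<close>, and this distance is \<open>o(t)\<close> along second-order
  curves.
\<close>

lemma second_order_step_perturb:
  fixes M :: "'a::euclidean_space set"
  assumes P: "second_order_step M xbar d P"
    and small: "\<exists>B. open B \<and> xbar \<in> B \<and> (\<forall>m\<in>M \<inter> B. \<forall>\<eta>\<in>tangent_space M m. \<forall>c.
      second_order_curve (tangent_space M m) m \<eta> c \<longrightarrow> (\<lambda>t. norm (P (c t) - c t)) \<in> o[at 0](\<lambda>t. t))"
    and V0: "open V0" "xbar \<in> V0" "\<And>m. m \<in> M \<inter> V0 \<Longrightarrow> subspace (tangent_space M m)"
    and \<pi>: "open B0" "xbar \<in> B0" "regular_on False 2 B0 \<pi>"
      "\<And>y. y \<in> B0 \<Longrightarrow> norm (\<pi> y - P y) \<le> C * (norm (y - P y))\<^sup>2"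
  shows "second_order_step M xbar (\<lambda>y. y \<in> B0) \<pi>"
proof -
  obtain B1 where B1: "open B1" "xbar \<in> B1"
    and m1: "\<And>m. m \<in> M \<inter> B1 \<Longrightarrow> P m = m"
      "\<And>m \<eta> c. \<lbrakk>m \<in> M \<inter> B1; \<eta> \<in> tangent_space M m - {0}; second_order_curve (tangent_space M m) m \<eta> c\<rbrakk> \<Longrightarrow>
         second_order_curve (tangent_space M m) m \<eta> (\<lambda>t. P (c t))"
    using P unfolding second_order_step_def by blast
  obtain B2 where B2: "open B2" "xbar \<in> B2"
    and m2: "\<And>m \<eta> c. \<lbrakk>m \<in> M \<inter> B2; \<eta> \<in> tangent_space M m; second_order_curve (tangent_space M m) m \<eta> c\<rbrakk> \<Longrightarrow>
         (\<lambda>t. norm (P (c t) - c t)) \<in> o[at 0](\<lambda>t. t)"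
    using small by blast
  define B where "B = B0 \<inter> B1 \<inter> B2 \<inter> V0"
  have B: "open B" "xbar \<in> B" using B1 B2 V0 \<pi> by (auto simp: B_def)
  have fixed: "\<pi> m = m" if "m \<in> M \<inter> B" for m
    using \<pi>(4)[of m] m1(1)[of m] that by (simp add: B_def)
  have curve: "second_order_curve (tangent_space M m) m \<eta> (\<lambda>t. \<pi> (c t))"
    if m: "m \<in> M \<inter> B" and \<eta>: "\<eta> \<in> tangent_space M m - {0}"
      and c: "second_order_curve (tangent_space M m) m \<eta> c" for m \<eta> c
  proof -
    have T: "subspace (tangent_space M m)" using V0(3) m by (simp add: B_def)
    have PC: "second_order_curve (tangent_space M m) m \<eta> (\<lambda>t. P (c t))"
      by (rule m1(2)[OF _ \<eta> c]) (use m in \<open>simp add: B_def\<close>)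
    have "(\<lambda>t. norm (P (c t) - c t)) \<in> o[at 0](\<lambda>t. t)"
      by (rule m2[OF _ _ c]) (use m \<eta> in \<open>auto simp: B_def\<close>)
    from landau_o.small_power[OF this, of 2]
    have sq: "(\<lambda>t. C * (norm (c t - P (c t)))\<^sup>2) \<in> o[at 0](\<lambda>t. t\<^sup>2)"
      by (cases "C = 0") (simp_all add: norm_minus_commute)
    have inB: "\<forall>\<^sub>F t in at 0. c t \<in> B0"
      by (rule topological_tendstoD[OF second_order_curve_tendsto[OF c] \<pi>(1)]) (use m in \<open>simp add: B_def\<close>)
    have d2: "(\<lambda>t. norm (\<pi> (c t) - P (c t))) \<in> o[at 0](\<lambda>t. t\<^sup>2)"
    proof (rule smallo_dominated1[OF sq])
      show "\<forall>\<^sub>F t in at 0. \<bar>norm (\<pi> (c t) - P (c t))\<bar> \<le> \<bar>C * (norm (c t - P (c t)))\<^sup>2\<bar>"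
        using inB
      proof eventually_elim
        case (elim t)
        from \<pi>(4)[OF this] show ?case unfolding abs_norm_cancel by (rule order_trans[OF _ abs_ge_self])
      qed
    qed
    have d1: "(\<lambda>t. norm (\<pi> (c t) - P (c t))) \<in> o[at 0](\<lambda>t. t)"
      by (rule landau_o.small_trans[OF d2 square_smallo_ident])
    have d3: "(\<lambda>t. norm (closest_point (tangent_space M m) (\<pi> (c t) - P (c t)))) \<in> o[at 0](\<lambda>t. t\<^sup>2)"
      by (rule smallo_dominated1[OF d2]) (simp add: closest_point_subspace_norm_le[OF T])
    show ?thesis by (rule second_order_curve_change[OF T PC d1 d3])
  qed
  have "regular_on False 2 B \<pi>" by (rule regular_on_subset[OF _ \<pi>(3)]) (auto simp: B_def)
  then show ?thesis
    unfolding second_order_step_def using B fixed curve by (intro exI[of _ B]) (auto simp: B_def)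
qed

lemma second_order_step_composition:
  fixes M1 M2 :: "'a::euclidean_space set"
  assumes dec: "decomposition_property p M1 M2 xbar U \<phi>1 \<phi>2 \<Omega> K \<delta>"
    and V0: "open V0" "xbar \<in> V0" "\<And>m. m \<in> M1 \<inter> M2 \<inter> V0 \<Longrightarrow> subspace (tangent_space (M1 \<inter> M2) m)"
    and V1: "open V1" "xbar \<in> V1" "\<And>m. m \<in> M1 \<inter> V1 \<Longrightarrow> subspace (tangent_space M1 m)"
    and V2: "open V2" "xbar \<in> V2" "\<And>m. m \<in> M2 \<inter> V2 \<Longrightarrow> subspace (tangent_space M2 m)"
  shows "second_order_step (M1 \<inter> M2) xbar (composition_defined U \<phi>2) (\<phi>1 \<circ> \<phi>2)"
proof -
  let ?M = "M1 \<inter> M2"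
  note d = dec[unfolded decomposition_property_def]
  have \<delta>: "\<delta> > 0" and \<Omega>: "openin (top_of_set ?M) \<Omega>" "xbar \<in> \<Omega>" "K = ?M \<inter> closure \<Omega>"
    and d1: "tangent_normal_decomposition p M1 \<phi>1 K \<delta>" and d2: "tangent_normal_decomposition p M2 \<phi>2 K \<delta>"
    and reg: "Ck1_on 2 (tube K \<delta>) (\<phi>1 \<circ> \<phi>2)" and def: "\<forall>y\<in>tube K \<delta>. composition_defined U \<phi>2 y"
    using d by blast+
  obtain G where G: "open G" "\<Omega> = ?M \<inter> G" using \<Omega>(1) by (auto simp: openin_open)
  have oT: "open (tube K \<delta>)" unfolding tube_def by (intro open_Collect_less continuous_intros)
  have \<Omega>K: "m \<in> K" if "m \<in> \<Omega>" for m using that \<Omega>(3) G(2) closure_subset[of \<Omega>] by blast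
  define B where "B = tube K \<delta> \<inter> G \<inter> V0 \<inter> V1 \<inter> V2"
  have "infdist xbar K = 0" using \<Omega>K[OF \<Omega>(2)] by simp
  then have B: "open B" "xbar \<in> B"
    using oT G V0 V1 V2 \<Omega>(2) \<delta> by (auto simp: B_def tube_def)
  have "regular_on True 2 (tube K \<delta>) (\<phi>1 \<circ> \<phi>2)" using reg by (simp add: regular_on_def)
  then have "regular_on True 2 B (\<phi>1 \<circ> \<phi>2)"
    by (rule regular_on_subset[rotated]) (auto simp: B_def)
  then have "regular_on False 2 B (\<phi>1 \<circ> \<phi>2)" by (rule regular_on_forget_lipschitz[OF B(1)])
  moreover have "(\<phi>1 \<circ> \<phi>2) m = m \<and> (\<forall>\<eta>\<in>tangent_space ?M m - {0}. \<forall>c.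
      second_order_curve (tangent_space ?M m) m \<eta> c \<longrightarrow>
      second_order_curve (tangent_space ?M m) m \<eta> (\<lambda>t. (\<phi>1 \<circ> \<phi>2) (c t)))" if m: "m \<in> ?M \<inter> B" for m
  proof -
    have mK: "m \<in> K" using m G(2) \<Omega>K by (auto simp: B_def)
    have s: "subspace (tangent_space ?M m)" "subspace (tangent_space M1 m)" "subspace (tangent_space M2 m)"
      using V0(3) V1(3) V2(3) m by (auto simp: B_def)
    have t: "tangent_space ?M m \<subseteq> tangent_space M1 m" "tangent_space ?M m \<subseteq> tangent_space M2 m"
      by (rule tangent_space_mono, blast)+
    show ?thesis
      using decomposition_fixes[OF d1 \<delta> mK s(2)] decomposition_fixes[OF d2 \<delta> mK s(3)]
        second_order_curve_decomposition[OF d1 \<delta> mK s(2) s(1) t(1)]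
        second_order_curve_decomposition[OF d2 \<delta> mK s(3) s(1) t(2)]
      by simp
  qed
  ultimately show ?thesis
    unfolding second_order_step_def using B def by (intro exI[of _ B]) (auto simp: B_def)
qed

section \<open>The hybrid iteration\<close>

lemma second_order_step_hybrid_seq:
  fixes M1 M2 :: "'a::euclidean_space set"
  assumes xbar: "xbar \<in> M1 \<inter> M2" and "n \<le> Suc kI"
    and alt: "second_order_step (M1 \<inter> M2) xbar
      (\<lambda>y. projection_defined M2 y \<and> projection_defined M1 (closest_point M2 y))
      (\<lambda>y. closest_point M1 (closest_point M2 y))"
    and comp: "second_order_step (M1 \<inter> M2) xbar (composition_defined U \<phi>2) (\<phi>1 \<circ> \<phi>2)"
  shows "second_order_step (M1 \<inter> M2) xbar
     (\<lambda>y. \<forall>i<n. hybrid_step_defined M1 M2 U \<phi>2 kA kI i (hybrid_seq M1 M2 \<phi>1 \<phi>2 kA kI y i))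
     (\<lambda>y. hybrid_seq M1 M2 \<phi>1 \<phi>2 kA kI y n)"
  using assms(2)
proof (induction n)
  case 0
  show ?case by (rule second_order_step_mono[of _ _ "\<lambda>y. True"]) (simp_all add: second_order_step_ident)
next
  case (Suc n)
  have "second_order_step (M1 \<inter> M2) xbar (hybrid_step_defined M1 M2 U \<phi>2 kA kI n) (hybrid_step M1 M2 \<phi>1 \<phi>2 kA kI n)"
    using alt comp Suc.prems unfolding hybrid_step_defined_def[abs_def] hybrid_step_def[abs_def]
    by (cases "n \<le> kA") (simp_all add: o_def)
  from second_order_step_compose[OF xbar Suc.IH this] Suc.prems
  have "second_order_step (M1 \<inter> M2) xbar
     (\<lambda>y. (\<forall>i<n. hybrid_step_defined M1 M2 U \<phi>2 kA kI i (hybrid_seq M1 M2 \<phi>1 \<phi>2 kA kI y i)) \<and>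
        hybrid_step_defined M1 M2 U \<phi>2 kA kI n (hybrid_seq M1 M2 \<phi>1 \<phi>2 kA kI y n))
     (\<lambda>y. hybrid_step M1 M2 \<phi>1 \<phi>2 kA kI n (hybrid_seq M1 M2 \<phi>1 \<phi>2 kA kI y n))" by simp
  then have "second_order_step (M1 \<inter> M2) xbar
     (\<lambda>y. \<forall>i<Suc n. hybrid_step_defined M1 M2 U \<phi>2 kA kI i (hybrid_seq M1 M2 \<phi>1 \<phi>2 kA kI y i))
     (\<lambda>y. hybrid_step M1 M2 \<phi>1 \<phi>2 kA kI n (hybrid_seq M1 M2 \<phi>1 \<phi>2 kA kI y n))"
    by (rule second_order_step_mono) (auto simp: less_Suc_eq)
  then show ?case by simp
qed

text \<open>
  From index \<open>kI + 1\<close> on, the hybrid iteration is the Newton iteration.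
\<close>

lemma hybrid_seq_tail:
  "hybrid_seq M1 M2 \<phi>1 \<phi>2 kA kI x0 (Suc kI + j) =
     (newton_slra M1 M2 ^^ j) (hybrid_seq M1 M2 \<phi>1 \<phi>2 kA kI x0 (Suc kI))" if "kA \<le> kI"
  using that by (induction j) (simp_all add: hybrid_step_def)

lemma telescoping_limit:
  fixes X :: "nat \<Rightarrow> 'a::real_normed_vector"
  assumes "X \<longlonglongrightarrow> l"
  shows "summable (\<lambda>i. X (Suc i) - X i)" "X 0 + (\<Sum>i. X (Suc i) - X i) = l"
  using telescope_sums[OF assms] by (auto simp: sums_iff)

text \<open>
  The straight line \<open>x + t \<eta>\<close> is a second-order curve, and \<open>\<psi>0\<close> maps it to the retraction curve.  The
  direction \<open>\<eta> = 0\<close>, which second-order steps exclude, gives a constant curve.  The map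
  \<open>\<psi> (x, \<eta>) = \<psi>0 (x + \<eta>)\<close> is \<open>C\<^sup>2\<close> on an open subset of the product space, so it is its own local
  extension.
\<close>

lemma second_order_retraction_on_tangent_steps:
  fixes M :: "'a::euclidean_space set"
  assumes N: "open N" "regular_on False 2 N \<psi>0" "\<psi>0 ` N \<subseteq> M"
    and r: "r > 0" "ball xbar (2 * r) \<subseteq> N" and \<Omega>: "\<Omega> = M \<inter> ball xbar r"
    and V0: "\<And>m. m \<in> \<Omega> \<Longrightarrow> subspace (tangent_space M m)"
    and m: "\<And>m. m \<in> M \<inter> N \<Longrightarrow> \<psi>0 m = m \<and>
      (\<forall>\<eta>\<in>tangent_space M m - {0}. \<forall>c. second_order_curve (tangent_space M m) m \<eta> c \<longrightarrow>
         second_order_curve (tangent_space M m) m \<eta> (\<lambda>t. \<psi>0 (c t)))"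
    and \<psi>: "\<And>x \<eta>. x + \<eta> \<in> N \<Longrightarrow> \<psi> (x, \<eta>) = \<psi>0 (x + \<eta>)"
  shows "second_order_retraction_on M \<Omega> r \<psi>"
  unfolding second_order_retraction_on_def
proof (intro conjI ballI)
  let ?B = "tangent_bundle_part M \<Omega> r"
  have inN: "x + \<eta> \<in> N" if "x \<in> \<Omega>" "norm \<eta> < r" for x \<eta>
  proof -
    have "norm (xbar - (x + \<eta>)) \<le> norm (xbar - x) + norm \<eta>"
      using norm_triangle_ineq4[of "xbar - x" \<eta>] by (simp add: diff_diff_add)
    then show ?thesis using that r(2) \<Omega> by (auto simp: dist_norm)
  qed
  show "Ck_map_on 2 ?B \<psi>"
    unfolding Ck_map_on_def
  proof
    fix a assume "a \<in> ?B"
    then obtain x \<eta> where a: "a = (x, \<eta>)" "x + \<eta> \<in> N" using inN by (auto simp: tangent_bundle_part_def)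
    let ?s = "\<lambda>q :: 'a \<times> 'a. fst q + snd q"
    have bs: "bounded_linear ?s" by (intro bounded_linear_add bounded_linear_fst bounded_linear_snd)
    have o: "open (?s -` N)"
      by (rule open_vimage[OF N(1)]) (intro continuous_intros)
    have "regular_on False 2 (?s -` N) (\<lambda>q. \<psi>0 (?s q))"
      by (rule regular_on_compose[OF N(1) o _ N(2) regular_on_bounded_linear[OF o bs]]) auto
    then have "regular_on False 2 (?s -` N) \<psi>"
      by (rule regular_on_cong[OF o, rotated]) (use \<psi> in auto)
    then show "\<exists>V g. open V \<and> a \<in> V \<and> Ck_on 2 V g \<and> (\<forall>y\<in>?B \<inter> V. g y = \<psi> y)"
      using o a by (intro exI[of _ "?s -` N"] exI[of _ \<psi>]) (simp add: regular_on_def)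
  qed
  show "\<psi> ` ?B \<subseteq> M"
    using inN \<psi> N(3) by (auto simp: tangent_bundle_part_def)
  fix x \<eta> assume x: "x \<in> \<Omega>" and \<eta>: "\<eta> \<in> tangent_space M x"
  have T: "subspace (tangent_space M x)" by (rule V0[OF x])
  have xN: "x \<in> M \<inter> N" using x inN[OF x, of 0] r(1) \<Omega> by simp
  have "((\<lambda>t. x + t *\<^sub>R \<eta>) \<longlongrightarrow> x) (at 0)" by (auto intro!: tendsto_eq_intros)
  then have "\<forall>\<^sub>F t in at 0. x + t *\<^sub>R \<eta> \<in> N" by (rule topological_tendstoD[OF _ N(1)]) (use xN in simp)
  then have ev: "\<forall>\<^sub>F t in at 0. \<psi> (x, t *\<^sub>R \<eta>) = \<psi>0 (x + t *\<^sub>R \<eta>)" by (rule eventually_mono) (rule \<psi>)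
  have cp0: "closest_point (tangent_space M x) 0 = 0"
    by (rule linear_0[OF linear_closest_point_subspace[OF T]])
  have "second_order_curve (tangent_space M x) x \<eta> (\<lambda>t. \<psi>0 (x + t *\<^sub>R \<eta>))"
  proof (cases "\<eta> = 0")
    case True
    then show ?thesis using m[OF xN] cp0 by (simp add: second_order_curve_def)
  next
    case False
    moreover have "second_order_curve (tangent_space M x) x \<eta> (\<lambda>t. x + t *\<^sub>R \<eta>)"
      using cp0 by (simp add: second_order_curve_def)
    ultimately show ?thesis using m[OF xN] \<eta> by blast
  qed
  then have 1: "(\<lambda>t. norm (\<psi>0 (x + t *\<^sub>R \<eta>) - (x + t *\<^sub>R \<eta>))) \<in> o[at 0](\<lambda>t. t)"
    and 2: "(\<lambda>t. norm (closest_point (tangent_space M x) (\<psi>0 (x + t *\<^sub>R \<eta>) - (x + t *\<^sub>R \<eta>)))) \<in> o[at 0](\<lambda>t. t\<^sup>2)"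
    unfolding second_order_curve_def by auto
  show "(\<lambda>t. norm (\<psi> (x, t *\<^sub>R \<eta>) - (x + t *\<^sub>R \<eta>))) \<in> o[at 0](\<lambda>t. t)"
    by (rule smallo_dominated1[OF 1]) (rule eventually_mono[OF ev], simp)
  show "(\<lambda>t. norm (closest_point (tangent_space M x) (\<psi> (x, t *\<^sub>R \<eta>) - (x + t *\<^sub>R \<eta>)))) \<in> o[at 0](\<lambda>t. t\<^sup>2)"
    by (rule smallo_dominated1[OF 2]) (rule eventually_mono[OF ev], simp)
qed

lemma newton_slra_limit:
  fixes M1 M2 :: "'a::euclidean_space set"
  assumes xbar: "xbar \<in> M1 \<inter> M2" and M1: "affine M1" and M2: "Ck1_submanifold_at 3 M2 xbar"
    and trans: "transversal_at M1 M2 xbar"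
    and wd: "\<exists>r>0. \<forall>x \<in> ball xbar r. newton_slra_defined M1 M2 x"
    and facts: "newton_slra_facts M1 M2 xbar"
    and e: "e > 0" "\<And>x. x \<in> ball xbar e \<Longrightarrow> closest_point (M1 \<inter> M2) x \<in> M1 \<inter> M2 \<and>
        (\<forall>w\<in>M1 \<inter> M2. dist x (closest_point (M1 \<inter> M2) x) \<le> dist x w)"
  obtains \<rho> \<pi> C where "\<rho> > 0" "\<rho> \<le> e" "regular_on False 2 (ball xbar \<rho>) \<pi>"
    "\<And>y. y \<in> ball xbar \<rho> \<Longrightarrow> (\<lambda>k. (newton_slra M1 M2 ^^ k) y) \<longlonglongrightarrow> \<pi> y \<and> \<pi> y \<in> M1 \<inter> M2 \<and>
       norm (\<pi> y - closest_point (M1 \<inter> M2) y) \<le> C * (norm (y - closest_point (M1 \<inter> M2) y))\<^sup>2"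
    "\<And>y k. y \<in> ball xbar \<rho> \<Longrightarrow> newton_slra_defined M1 M2 ((newton_slra M1 M2 ^^ k) y)"
proof -
  obtain V W g where d: "defining_function V W g True (3 - 1)" "xbar \<in> V" "M2 \<inter> V = {y \<in> V. g y = 0}"
    using submanifold_defining_function[OF M2] by auto
  obtain rw where rw: "rw > 0" "\<And>x. x \<in> ball xbar rw \<Longrightarrow> projection_defined M2 x"
    using wd unfolding newton_slra_defined_def by blast
  have nz: "(3::nat) - 1 \<noteq> 0" and xs: "xbar \<in> M1" "xbar \<in> M2" using xbar by auto
  obtain r1 where r1: "r1 > 0" "regular_on True (3 - 1) (ball xbar r1) (newton_slra M1 M2)"
    by (rule regular_newton_slra[OF nz d(1,3) M1 xs d(2) trans rw], assumption, rule that)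
  let ?N = "newton_slra M1 M2" and ?P = "closest_point (M1 \<inter> M2)"
  obtain \<delta>N \<rho>N \<mu> \<mu>' \<gamma> \<gamma>' where F: "\<delta>N > 0 \<and> \<rho>N > 0 \<and> \<mu> > 0 \<and> \<mu>' > 0 \<and> \<gamma> > 0 \<and> \<gamma>' > 0 \<and>
      (\<forall>x \<in> ball xbar \<delta>N. ?N x \<in> ball xbar \<rho>N \<and> norm (?N x - ?P x) \<le> \<mu> * (norm (x - ?P x))\<^sup>2 \<and>
           norm (?P (?N x) - ?P x) \<le> \<mu>' * (norm (x - ?P x))\<^sup>2) \<and>
      (\<forall>y0 \<in> ball xbar \<delta>N. (\<forall>k. newton_slra_defined M1 M2 ((?N ^^ k) y0)) \<and>
           (\<exists>y\<in>M1 \<inter> M2. (\<lambda>k. (?N ^^ k) y0) \<longlonglongrightarrow> y \<and>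
              (\<forall>k. norm ((?N ^^ Suc k) y0 - y) \<le> \<gamma> * (norm ((?N ^^ k) y0 - y))\<^sup>2) \<and>
              norm (y - ?P y0) \<le> \<gamma>' * (norm (y0 - ?P y0))\<^sup>2))"
    using facts unfolding newton_slra_facts_def Let_def by (elim exE) (rule that)
  have pos: "\<delta>N > 0" "\<mu> > 0" "\<gamma> > 0" "\<gamma>' > 0" by (insert F, elim conjE, assumption)+
  note c = conjunct2[OF conjunct2[OF conjunct2[OF conjunct2[OF conjunct2[OF conjunct2[OF F]]]]]]
  have f1: "norm (?N x - ?P x) \<le> \<mu> * (norm (x - ?P x))\<^sup>2" if "x \<in> ball xbar \<delta>N" for x
    by (rule conjunct1[OF conjunct2[OF bspec[OF conjunct1[OF c] that]]])
  have f2: "\<forall>k. newton_slra_defined M1 M2 ((?N ^^ k) y0)" 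
    and f3: "\<exists>y\<in>M1 \<inter> M2. (\<lambda>k. (?N ^^ k) y0) \<longlonglongrightarrow> y \<and>
              (\<forall>k. norm ((?N ^^ Suc k) y0 - y) \<le> \<gamma> * (norm ((?N ^^ k) y0 - y))\<^sup>2) \<and>
              norm (y - ?P y0) \<le> \<gamma>' * (norm (y0 - ?P y0))\<^sup>2" if "y0 \<in> ball xbar \<delta>N" for y0
    by (rule conjunct1[OF bspec[OF conjunct2[OF c] that]], rule conjunct2[OF bspec[OF conjunct2[OF c] that]])
  define r0 where "r0 = min (min r1 \<delta>N) e"
  have r0: "r0 > 0" "r0 \<le> e" using r1 pos e(1) by (auto simp: r0_def)
  have sub: "x \<in> ball xbar r1 \<and> x \<in> ball xbar \<delta>N \<and> x \<in> ball xbar e" if "x \<in> ball xbar r0" for x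
    using that by (simp add: r0_def)
  have reg: "regular_on True 2 (ball xbar r0) (newton_slra M1 M2)"
  proof -
    have "ball xbar r0 \<subseteq> ball xbar r1" using sub by blast
    from regular_on_subset[OF this r1(2)] show ?thesis by simp
  qed
  obtain \<rho> \<pi> where \<rho>: "\<rho> > 0" "\<rho> \<le> r0" "regular_on False 2 (ball xbar \<rho>) \<pi>"
    and lim: "\<And>y. y \<in> ball xbar \<rho> \<Longrightarrow> (\<lambda>k. (newton_slra M1 M2 ^^ k) y) \<longlonglongrightarrow> \<pi> y \<and> \<pi> y \<in> M1 \<inter> M2 \<and>
       norm (\<pi> y - closest_point (M1 \<inter> M2) y) \<le> \<gamma>' * (norm (y - closest_point (M1 \<inter> M2) y))\<^sup>2"
  proof (rule quadratic_iteration_limit[OF r0(1) reg xbar _ _ _ pos(2-4)])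
    show "?P x \<in> M1 \<inter> M2 \<and> (\<forall>w\<in>M1 \<inter> M2. dist x (?P x) \<le> dist x w)" if "x \<in> ball xbar r0" for x
      using sub[OF that] e(2) by blast
    show "norm (?N x - ?P x) \<le> \<mu> * (norm (x - ?P x))\<^sup>2" if "x \<in> ball xbar r0" for x
      using sub[OF that] f1 by blast
    show "\<exists>y\<in>M1 \<inter> M2. (\<lambda>k. (?N ^^ k) y0) \<longlonglongrightarrow> y \<and>
        (\<forall>k. norm ((?N ^^ Suc k) y0 - y) \<le> \<gamma> * (norm ((?N ^^ k) y0 - y))\<^sup>2) \<and>
        norm (y - ?P y0) \<le> \<gamma>' * (norm (y0 - ?P y0))\<^sup>2" if "y0 \<in> ball xbar r0" for y0
      using sub[OF that] f3 by blast
  qed (rule that)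
  show thesis
  proof (rule that[OF \<rho>(1) order_trans[OF \<rho>(2) r0(2)] \<rho>(3) lim])
    show "newton_slra_defined M1 M2 ((newton_slra M1 M2 ^^ k) y)" if "y \<in> ball xbar \<rho>" for y k
      using f2[of y] sub[of y] that \<rho>(2) by auto
  qed
qed

theorem theorem5:
  fixes M1 M2 U \<Omega> K :: "'a::euclidean_space set"
    and \<phi>1 \<phi>2 :: "'a \<Rightarrow> 'a"
    and xbar :: 'a
    and \<delta> :: real
    and p kA kI :: nat
  assumes "p \<ge> 3"
    and "Ck1_submanifold p M1"
    and "Ck1_submanifold p M2"
    and "xbar \<in> M1 \<inter> M2"
    and "\<exists>V. open V \<and> xbar \<in> V \<and> (\<forall>x \<in> M1 \<inter> M2 \<inter> V. clean_intersection_at p M1 M2 x)"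
    and "alternating_framework p M1 M2 xbar U \<phi>1 \<phi>2"
    and "decomposition_property p M1 M2 xbar U \<phi>1 \<phi>2 \<Omega> K \<delta>"
    and "affine M1"
    and "Ck1_submanifold 3 M2"
    and "transversal_at M1 M2 xbar"
    and "\<exists>r>0. \<forall>x \<in> ball xbar r. newton_slra_defined M1 M2 x"
    and "newton_slra_facts M1 M2 xbar"
    and "kA \<le> kI"
  shows "\<exists>\<Omega>' r. openin (top_of_set (M1 \<inter> M2)) \<Omega>' \<and> xbar \<in> \<Omega>' \<and> r > 0 \<and>
           (\<forall>(x, \<eta>) \<in> tangent_bundle_part (M1 \<inter> M2) \<Omega>' r.
              hybrid_map_defined M1 M2 U \<phi>1 \<phi>2 kA kI (x, \<eta>)) \<and>
           second_order_retraction_on (M1 \<inter> M2) \<Omega>' r (hybrid_map M1 M2 \<phi>1 \<phi>2 kA kI)"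
proof -
  let ?M = "M1 \<inter> M2" and ?N = "newton_slra M1 M2" and ?X = "hybrid_seq M1 M2 \<phi>1 \<phi>2 kA kI"
  note xbar = assms(4)
  have sub1: "Ck1_submanifold_at p M1 xbar" and sub2: "Ck1_submanifold_at p M2 xbar"
    and sub23: "Ck1_submanifold_at 3 M2 xbar"
    using assms(2,3,9) xbar by (auto simp: Ck1_submanifold_def)
  have subM: "Ck1_submanifold_at p ?M xbar"
    using assms(5) xbar unfolding clean_intersection_at_def by blast
  have p2: "p \<ge> 2" using assms(1) by simp
  obtain V0 where V0: "open V0" "xbar \<in> V0" "\<And>m. m \<in> ?M \<inter> V0 \<Longrightarrow> subspace (tangent_space ?M m)"
    using submanifold_tangent_subspace[OF subM p2] by blast
  obtain V1 where V1: "open V1" "xbar \<in> V1" "\<And>m. m \<in> M1 \<inter> V1 \<Longrightarrow> subspace (tangent_space M1 m)"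
    using submanifold_tangent_subspace[OF sub1 p2] by blast
  obtain V2 where V2: "open V2" "xbar \<in> V2" "\<And>m. m \<in> M2 \<inter> V2 \<Longrightarrow> subspace (tangent_space M2 m)"
    using submanifold_tangent_subspace[OF sub2 p2] by blast
  have \<Omega>: "openin (top_of_set ?M) \<Omega>" "xbar \<in> \<Omega>" "K = ?M \<inter> closure \<Omega>" "compact K"
    using assms(7) unfolding decomposition_property_def by blast+
  obtain G where G: "open G" "\<Omega> = ?M \<inter> G" using \<Omega>(1) by (auto simp: openin_open)
  obtain e where e: "e > 0" "cball xbar e \<subseteq> G" using G \<Omega>(2) open_contains_cball by blast
  \<comment> \<open>\<open>M\<close> is locally compact at \<open>xbar\<close> because it coincides with the compact set \<open>K\<close> there.\<close>
  have "?M \<inter> cball xbar e = K \<inter> cball xbar e"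
    using e(2) G(2) \<Omega>(3) closure_subset[of \<Omega>] by blast
  then have "compact (?M \<inter> cball xbar e)" using \<Omega>(4) by (simp add: compact_Int_closed)
  note near = locally_compact_nearest_point[OF this e(1) xbar]
  obtain \<rho> \<pi> C where \<rho>: "\<rho> > 0" "\<rho> \<le> e / 2" "regular_on False 2 (ball xbar \<rho>) \<pi>"
    and lim: "\<And>y. y \<in> ball xbar \<rho> \<Longrightarrow> (\<lambda>k. (?N ^^ k) y) \<longlonglongrightarrow> \<pi> y \<and> \<pi> y \<in> ?M \<and>
       norm (\<pi> y - closest_point ?M y) \<le> C * (norm (y - closest_point ?M y))\<^sup>2"
    and Ndef: "\<And>y k. y \<in> ball xbar \<rho> \<Longrightarrow> newton_slra_defined M1 M2 ((?N ^^ k) y)"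
    by (rule newton_slra_limit[OF xbar assms(8) sub23 assms(10,11,12) half_gt_zero[OF e(1)] near])
       (assumption, rule that, assumption+)
  have "xbar \<in> ball xbar (e / 2)" using e(1) by simp
  note PM = second_order_step_nearest_point[OF subM assms(1) order_refl xbar V0 open_ball this near TrueI]
  have limit_step: "second_order_step ?M xbar (\<lambda>y. y \<in> ball xbar \<rho>) \<pi>"
    by (rule second_order_step_perturb[OF PM V0 open_ball _ \<rho>(3)]) (use lim \<rho>(1) in auto)
  obtain rw where rw: "rw > 0" "\<And>x. x \<in> ball xbar rw \<Longrightarrow> projection_defined M2 x"
    using assms(11) unfolding newton_slra_defined_def by blast
  have near2: "closest_point M2 y \<in> M2 \<and> (\<forall>w\<in>M2. dist y (closest_point M2 y) \<le> dist y w)"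
    if "y \<in> ball xbar rw" for y
    using projection_definedD[OF rw(2)[OF that]] by blast
  have P2: "second_order_step ?M xbar (projection_defined M2) (closest_point M2)"
    by (rule second_order_step_nearest_point(1)[OF sub2 assms(1) Int_lower2 xbar V0 open_ball _ near2 rw(2)])
       (use rw(1) in simp_all)
  have M1ne: "closed M1" "M1 \<noteq> {}" "convex M1"
    using assms(8) xbar affine_closed affine_imp_convex by auto
  have P1d: "projection_defined M1 y" for y
    unfolding projection_defined_def
  proof (rule ex1I[of _ "closest_point M1 y"])
    show "closest_point M1 y \<in> M1 \<and> (\<forall>w\<in>M1. dist y (closest_point M1 y) \<le> dist y w)"
      using closest_point_exists[OF M1ne(1,2), of y] by blast
    show "z = closest_point M1 y" if "z \<in> M1 \<and> (\<forall>w\<in>M1. dist y z \<le> dist y w)" for z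
      using closest_point_unique[OF M1ne(3,1)] that by blast
  qed
  have near1: "closest_point M1 y \<in> M1 \<and> (\<forall>w\<in>M1. dist y (closest_point M1 y) \<le> dist y w)" for y
    using projection_definedD[OF P1d] by blast
  have P1: "second_order_step ?M xbar (projection_defined M1) (closest_point M1)"
    by (rule second_order_step_nearest_point(1)[OF sub1 assms(1) Int_lower1 xbar V0 open_UNIV UNIV_I near1 P1d])
  note alt = second_order_step_compose[OF xbar P2 P1]
  note comp = second_order_step_composition[OF assms(7) V0 V1 V2]
  define \<psi>0 where "\<psi>0 = (\<lambda>y. \<pi> (?X y (Suc kI)))"
  have full: "second_order_step ?M xbar
     (\<lambda>y. (\<forall>i<Suc kI. hybrid_step_defined M1 M2 U \<phi>2 kA kI i (?X y i)) \<and> ?X y (Suc kI) \<in> ball xbar \<rho>) \<psi>0"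
    unfolding \<psi>0_def
    by (rule second_order_step_compose[OF xbar second_order_step_hybrid_seq[OF xbar order_refl alt comp] limit_step])
  obtain B where B: "open B" "xbar \<in> B" "regular_on False 2 B \<psi>0"
    and Bd: "\<And>y. y \<in> B \<Longrightarrow> (\<forall>i<Suc kI. hybrid_step_defined M1 M2 U \<phi>2 kA kI i (?X y i)) \<and>
        ?X y (Suc kI) \<in> ball xbar \<rho>"
    and Bm: "\<And>m. m \<in> ?M \<inter> B \<Longrightarrow> \<psi>0 m = m \<and>
      (\<forall>\<eta>\<in>tangent_space ?M m - {0}. \<forall>c. second_order_curve (tangent_space ?M m) m \<eta> c \<longrightarrow>
         second_order_curve (tangent_space ?M m) m \<eta> (\<lambda>t. \<psi>0 (c t)))"
    by (rule second_order_stepE[OF full], rule that, assumption+)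
  have Bdef: "hybrid_step_defined M1 M2 U \<phi>2 kA kI i (?X y i)" if "y \<in> B" "i < Suc kI" for y i
    using Bd that by blast
  have B\<rho>: "?X y (Suc kI) \<in> ball xbar \<rho>" if "y \<in> B" for y using Bd that by blast
  have Xlim: "?X y \<longlonglongrightarrow> \<psi>0 y" if "y \<in> B" for y
  proof -
    have tail: "?X y (j + Suc kI) = (?N ^^ j) (?X y (Suc kI))" for j
      unfolding add.commute[of j] by (rule hybrid_seq_tail[OF assms(13)])
    have "(\<lambda>j. ?X y (j + Suc kI)) \<longlonglongrightarrow> \<psi>0 y"
      unfolding tail \<psi>0_def using lim[OF B\<rho>[OF that]] by blast
    then show ?thesis by (rule LIMSEQ_offset)
  qed
  have map: "hybrid_map M1 M2 \<phi>1 \<phi>2 kA kI (x, \<eta>) = \<psi>0 (x + \<eta>)" if "x + \<eta> \<in> B" for x \<eta>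
    using telescoping_limit(2)[OF Xlim[OF that]] by (simp add: hybrid_map_def)
  have wd: "hybrid_map_defined M1 M2 U \<phi>1 \<phi>2 kA kI (x, \<eta>)" if y: "x + \<eta> \<in> B" for x \<eta>
  proof -
    have "hybrid_step_defined M1 M2 U \<phi>2 kA kI i (?X (x + \<eta>) i)" for i
    proof (cases "i < Suc kI")
      case True
      then show ?thesis by (rule Bdef[OF y])
    next
      case False
      then obtain j where j: "i = Suc kI + j" using le_Suc_ex not_less by blast
      have "newton_slra_defined M1 M2 (?X (x + \<eta>) i)"
        unfolding j hybrid_seq_tail[OF assms(13)] by (rule Ndef[OF B\<rho>[OF y]])
      then show ?thesis using j assms(13) by (simp add: hybrid_step_defined_def)
    qed
    then show ?thesis
      using telescoping_limit(1)[OF Xlim[OF y]] Xlim[OF y] map[OF y]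
      by (simp add: hybrid_map_defined_def)
  qed
  have "open (B \<inter> V0)" "xbar \<in> B \<inter> V0" using B V0 by auto
  then obtain s where s: "s > 0" "ball xbar s \<subseteq> B \<inter> V0" using open_contains_ball by blast
  \<comment> \<open>\<open>x + \<eta>\<close> stays in \<open>ball xbar s\<close> for \<open>x\<close> within \<open>r\<close> of \<open>xbar\<close> and \<open>\<eta>\<close> shorter than \<open>r\<close>.\<close>
  define r where "r = s / 2"
  define \<Omega>' where "\<Omega>' = ?M \<inter> ball xbar r"
  have r: "r > 0" "ball xbar (2 * r) \<subseteq> B" using s by (auto simp: r_def)
  have inB: "x + \<eta> \<in> B" if "x \<in> \<Omega>'" "norm \<eta> < r" for x \<eta>
  proof -
    have "norm (xbar - (x + \<eta>)) \<le> norm (xbar - x) + norm \<eta>"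
      using norm_triangle_ineq4[of "xbar - x" \<eta>] by (simp add: diff_diff_add)
    then show ?thesis using that r(2) by (auto simp: dist_norm \<Omega>'_def)
  qed
  show ?thesis
  proof (intro exI conjI)
    show "openin (top_of_set ?M) \<Omega>'" unfolding \<Omega>'_def by (rule openin_open_Int[OF open_ball])
    show "xbar \<in> \<Omega>'" using xbar r(1) by (simp add: \<Omega>'_def)
    show "r > 0" by (rule r(1))
    show "\<forall>(x, \<eta>)\<in>tangent_bundle_part ?M \<Omega>' r. hybrid_map_defined M1 M2 U \<phi>1 \<phi>2 kA kI (x, \<eta>)"
      using inB wd by (auto simp: tangent_bundle_part_def)
    show "second_order_retraction_on ?M \<Omega>' r (hybrid_map M1 M2 \<phi>1 \<phi>2 kA kI)"
    proof (rule second_order_retraction_on_tangent_steps[OF B(1,3) _ r \<Omega>'_def _ Bm map])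
      show "\<psi>0 ` B \<subseteq> ?M" using lim B\<rho> by (auto simp: \<psi>0_def)
      show "subspace (tangent_space ?M m)" if "m \<in> \<Omega>'" for m
      proof (rule V0(3))
        have "m \<in> ball xbar s" using that r(1) by (simp add: \<Omega>'_def r_def)
        then show "m \<in> ?M \<inter> V0" using that s(2) by (auto simp: \<Omega>'_def)
      qed
    qed
  qed
qed

end
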